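(* Let $p$ be a prime with $p\equiv 3\pmod 8$, let $s\ge 1$, $q=p^s$, and let $m\ge 3$ be an integer with $2^{m}\mid(q-1)$ but $2^{m+1}\nmid(q-1)$. Let $n\ge 1$ and let $N$ be the number of $(x_1,\dots,x_n)\in\mathbb F_q^n$ with $x_1^{2^m}+\dots+x_n^{2^m}=0$. For $r=2,3,\dots,m$ let $A_r,B_r$ be integers with $$p^{s/2^{r-2}}=A_r^2+2B_r^2,\qquad A_r\equiv -1\pmod 4,\qquad p\nmid A_r.$$ If $m=3$ then \begin{align*} N=\,&q^{n-1}+\frac{q-1}{8q}\Bigl[2\cdot\left((-q^{\frac12}+4B_3q^{\frac14}i)^n+(-q^{\frac12}-4B_3q^{\frac14}i)^n\right)+2\cdot 3^nq^{\frac n2}\\ &+\left(-q^{\frac12}+4A_3q^{\frac14}i\right)^n+\left(-q^{\frac12}-4A_3q^{\frac14}i\right)^n\Bigr]. \end{align*} If $m=4$ then \begin{align*} N=\,&q^{n-1}+\frac{q-1}{16q}\Bigl[4\cdot\left((q^{\frac12}+4B_3q^{\frac14})^n+(q^{\frac12}-4B_3q^{\frac14})^n\right)\\ &+2\cdot\left((q^{\frac12}+8B_4q^{\frac38}i)^n+(q^{\frac12}-8B_4q^{\frac38}i)^n\right)+2\cdot\left(-3q^{\frac12}-4A_3q^{\frac14}\right)^n\\ &+\left(-3q^{\frac12}+4A_3q^{\frac14}+8A_4q^{\frac38}i\right)^n+\left(-3q^{\frac12}+4A_3q^{\frac14}-8A_4q^{\frac38}i\right)^n\Bigr]. \end{align*}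 If $m\ge 5$ then \begin{align*} N=\,&q^{n-1}+\frac{q-1}{2^mq}\Bigl[2^{m-2}\cdot\Bigl((q^{\frac12}+4B_3q^{\frac14})^n+(q^{\frac12}-4B_3q^{\frac14})^n\Bigr)\\ &+2^{m-3}\cdot\Bigl((q^{\frac12}+8B_4q^{\frac38})^n+(q^{\frac12}-8B_4q^{\frac38})^n\Bigr)\\ &+\sum_{t=2}^{m-4}2^{m-t-2}\Bigl((-3q^{\frac12}+\sum_{r=3}^t 2^{r-1}A_rq^{\frac{2^{r-2}-1}{2^{r-1}}}-2^t A_{t+1}q^{\frac{2^{t-1}-1}{2^t}}+2^{t+2} B_{t+3}q^{\frac{2^{t+1}-1}{2^{t+2}}})^n\\ &\qquad+(-3q^{\frac12}+\sum_{r=3}^t 2^{r-1}A_rq^{\frac{2^{r-2}-1}{2^{r-1}}}-2^t A_{t+1}q^{\frac{2^{t-1}-1}{2^t}}-2^{t+2} B_{t+3}q^{\frac{2^{t+1}-1}{2^{t+2}}})^n\Bigr)\\ &+2\cdot\Bigl((-3q^{\frac 12}+\sum_{r=3}^{m-3} 2^{r-1}A_rq^{\frac{2^{r-2}-1}{2^{r-1}}}-2^{m-3} A_{m-2}q^{\frac{2^{m-4}-1}{2^{m-3}}}+2^{m-1}B_mq^{\frac{2^{m-2}-1}{2^{m-1}}}i)^n\\ &\qquad+(-3q^{\frac 12}+\sum_{r=3}^{m-3} 2^{r-1}A_rq^{\frac{2^{r-2}-1}{2^{r-1}}}-2^{m-3} A_{m-2}q^{\frac{2^{m-4}-1}{2^{m-3}}}-2^{m-1}B_mq^{\frac{2^{m-2}-1}{2^{m-1}}}i)^n\Bigr)\\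 &+2\cdot\Bigl(-3q^{\frac 12}+\sum_{r=3}^{m-2} 2^{r-1}A_rq^{\frac{2^{r-2}-1}{2^{r-1}}}-2^{m-2} A_{m-1}q^{\frac{2^{m-3}-1}{2^{m-2}}}\Bigr)^n\\ &+\Bigl(-3q^{\frac 12}+\sum_{r=3}^{m-1}2^{r-1}A_r q^{\frac{2^{r-2}-1}{2^{r-1}}}+2^{m-1}A_m q^{\frac{2^{m-2}-1}{2^{m-1}}}i\Bigr)^n\\ &+\Bigl(-3q^{\frac 12}+\sum_{r=3}^{m-1}2^{r-1}A_r q^{\frac{2^{r-2}-1}{2^{r-1}}}-2^{m-1}A_m q^{\frac{2^{m-2}-1}{2^{m-1}}}i\Bigr)^n\Bigr]. \end{align*}
   Context: Here $i=\sqrt{-1}$. Powers $q^{a}$ with rational $a$ denote positive real powers. Empty sums are zero. Under the hypotheses, $2^{r-2}\mid s$ for $r\le m$, so $p^{s/2^{r-2}}$ is an integer; the conditions determine $A_r$ uniquely and $B_r$ up to sign, and the formula holds for either choice of signs. *)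

theory Defs
  imports "HOL-Analysis.Analysis" "HOL-Library.FuncSet"
begin

definition qpow :: "nat \<Rightarrow> real \<Rightarrow> complex" where
  "qpow q a = complex_of_real (real q powr a)"

end

theory Submission
  imports Defs "HOL-Algebra.Multiplicative_Group" "HOL-Number_Theory.Number_Theory"
begin

text \<open>
  Additive characters express the number of solutions through the \<open>n\<close>-th powers of the sums
  \<open>S(a) = \<Sum>x. \<psi>(a x ^ (2 ^ m))\<close>, and these through the Gauss sums \<open>G\<^sub>r\<close> of the characters of
  order \<open>2 ^ r\<close>, \<open>r \<le> m\<close>.  As \<open>p\<close> generates the classes 1 and 3 modulo 8 in the units modulo
  \<open>2 ^ r\<close>, Frobenius leaves only \<open>G\<^sub>r\<close> and its conjugate.  The Hasse--Davenport formula for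
  duplication becomes \<open>G\<^sub>r\<^sup>2 = G\<^sub>r\<^sub>-\<^sub>1 G\<^sub>1\<close> for \<open>r \<ge> 4\<close>, and \<open>G\<^sub>3\<^sup>2 = \<plusminus>K G\<^sub>1\<close> with a Jacobi sum \<open>K\<close>
  in \<open>\<int>[\<surd>-2]\<close> of norm \<open>q\<close>.  Modulo \<open>p\<close> the real part of \<open>K\<close> is a unit times a binomial
  coefficient without carries, so \<open>K = \<plusminus>A\<^sub>2 \<plusminus> B\<^sub>2 \<surd>-2\<close>, and successive square roots yield the
  forms \<open>A\<^sub>r \<plusminus> B\<^sub>r \<surd>-2\<close>.  All signs are forced by 2-adic integrality of Gauss periods: for
  \<open>r < m\<close> the prime field lies in the \<open>2 ^ r\<close>-th powers, which makes the periods rational integers.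
\<close>

section \<open>Arithmetic of primes congruent to 3 modulo 8\<close>

text \<open>The obstacle is the signs. Each square root leaves its sign open, and a wrong sign at
  level \<open>r - 1\<close> multiplies the root at level \<open>r\<close> by \<open>\<i>\<close>.
  So the sign at a level is decided one level higher, by whether the 2-adic divisibility of the
  exponential sum there can hold. The sign at level \<open>m\<close> stays open, as do those of all
  \<open>B r\<close>; this is harmless because the final formula contains both choices. That
  \<open>p\<close> does not divide \<open>A r\<close> excludes imprimitive representations and makes
  \<open>A r\<close> unique up to sign. Level \<open>m\<close> is exceptional since only the
  character of full order \<open>2 ^ m\<close> is odd; this is the origin of the factor
  \<open>\<i>\<close>. The shape of the formula comes from the 2-adic valuation \<open>j\<close> of
  the discrete logarithm of the coefficient \<open>a\<close>: a level \<open>r >= 3\<close>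
  contributes one value for \<open>r <= j\<close>, its negative for \<open>r = j + 1\<close>,
  nothing for \<open>r = j + 2\<close>, a value with \<open>B r\<close> for
  \<open>r = j + 3\<close>, and nothing beyond.\<close>

lemma power_two_power_minus_one:
  fixes P :: nat
  assumes "P mod 8 = 3" and "k \<ge> 1"
  shows "\<exists>c. odd c \<and> P ^ (2 ^ k) = 1 + 2 ^ (k + 2) * c"
  using assms(2)
proof (induction k rule: dec_induct)
  case base
  define j where "j = P div 8"
  have P: "P = 8 * j + 3"
    using assms(1) unfolding j_def by (metis mult_div_mod_eq)
  have "P ^ (2 ^ 1) = 1 + 2 ^ (1 + 2) * (8 * j ^ 2 + 6 * j + 1)"
    unfolding P by (simp add: power2_eq_square algebra_simps)
  moreover have "odd (8 * j ^ 2 + 6 * j + 1)" by simp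
  ultimately show ?case by blast
next
  case (step k)
  then obtain c where c: "odd c" "P ^ (2 ^ k) = 1 + 2 ^ (k + 2) * c" by blast
  have "P ^ (2 ^ Suc k) = (1 + 2 ^ (k + 2) * c) ^ 2"
    by (simp only: power_Suc2 power_mult c)
  also have "\<dots> = 1 + 2 ^ (Suc k + 2) * (c * (1 + 2 ^ (k + 1) * c))"
    by (simp add: power2_eq_square algebra_simps)
  finally show ?case
    using c(1) by (intro exI[of _ "c * (1 + 2 ^ (k + 1) * c)"]) auto
qed

text \<open>Lifting to the next power of 2: if \<open>p ^ k\<close> agrees with \<open>c\<close>
  modulo \<open>2 ^ r\<close> only, the two differ by an odd multiple of \<open>2 ^ r\<close>, and
  multiplication by \<open>p ^ (2 ^ (r - 2)) = 1 + 2 ^ r * e\<close> with \<open>e\<close> odd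
  repairs exactly that.\<close>

lemma powers_cover_one_three_mod_8:
  fixes p c :: nat
  assumes p: "p mod 8 = 3" and c: "c mod 8 = 1 \<or> c mod 8 = 3" and r: "r \<ge> 3"
  shows "\<exists>k. [c = p ^ k] (mod 2 ^ r)"
  using r
proof (induction r rule: dec_induct)
  case base
  from c show ?case
  proof
    assume "c mod 8 = 1"
    hence "[c = p ^ 0] (mod 2 ^ 3)" by (simp add: cong_def)
    thus ?thesis by blast
  next
    assume "c mod 8 = 3"
    hence "[c = p ^ 1] (mod 2 ^ 3)" using p by (simp add: cong_def)
    thus ?thesis by blast
  qed
next
  case (step r)
  then obtain k where k: "[c = p ^ k] (mod 2 ^ r)" by blast
  have r1: "1 \<le> r - 2" using step.hyps(1) by linarith
  obtain e where e: "odd e" "p ^ (2 ^ (r - 2)) = 1 + 2 ^ (r - 2 + 2) * e"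
    using power_two_power_minus_one[OF p, of "r - 2"] r1 by blast
  have r2: "r - 2 + 2 = r" using step.hyps by simp
  have oddp: "odd p" using p by presburger
  have "int (2 ^ r) dvd int c - int (p ^ k)"
    using k by (metis cong_iff_dvd_diff cong_int_iff of_nat_power)
  then obtain z where z: "int c - int (p ^ k) = 2 ^ r * z"
    by (auto simp: dvd_def)
  show ?case
  proof (cases "even z")
    case True
    hence "[int c = int (p ^ k)] (mod int (2 ^ Suc r))"
      unfolding cong_iff_dvd_diff using z by (auto elim!: evenE)
    thus ?thesis unfolding cong_int_iff by blast
  next
    case False
    have "int (p ^ (k + 2 ^ (r - 2))) = int (p ^ k) + 2 ^ r * int (p ^ k * e)"
      unfolding power_add e(2) r2 by (simp add: algebra_simps)
    hence "int c - int (p ^ (k + 2 ^ (r - 2))) = 2 ^ r * (z - int (p ^ k * e))"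
      using z by (simp add: algebra_simps)
    moreover have "even (z - int (p ^ k * e))" using False e(1) oddp by simp
    ultimately have "[int c = int (p ^ (k + 2 ^ (r - 2)))] (mod int (2 ^ Suc r))"
      unfolding cong_iff_dvd_diff by (auto elim!: evenE)
    thus ?thesis unfolding cong_int_iff by blast
  qed
qed

section \<open>Binomial coefficients modulo a prime\<close>

lemma prime_dvd_choose_mult:
  fixes p :: nat
  assumes "prime p" and "\<not> p dvd l"
  shows "p dvd (p * n) choose l"
proof -
  have "l > 0" using assms(2) by (metis dvd_0_right neq0_conv)
  hence "l * ((p * n) choose l) = (p * n) * ((p * n - 1) choose (l - 1))"
    using binomial_absorption[of "l - 1" "p * n"] by simp
  hence "p dvd l * ((p * n) choose l)" by simp
  thus ?thesis using assms prime_dvd_mult_iff by blast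
qed

text \<open>Vandermonde for \<open>p + p * n\<close> keeps modulo \<open>p\<close> only the terms
  \<open>j = 0\<close> and \<open>j = p\<close>; what remains is Pascal's rule, which drives the
  induction on \<open>n\<close>.\<close>

lemma choose_prime_mult_cong:
  fixes p :: nat
  assumes p: "prime p"
  shows "[(p * n) choose (p * k) = n choose k] (mod p)"
proof (induction n arbitrary: k)
  case 0
  show ?case using prime_gt_0_nat[OF p] by (cases k) (auto simp: binomial_eq_0)
next
  case (Suc n)
  show ?case
  proof (cases k)
    case 0
    thus ?thesis by simp
  next
    case (Suc k')
    have p0: "p > 0" using p prime_gt_0_nat by blast
    have "(p * Suc n) choose (p * k) = (p + p * n) choose (p * k)" by simp
    also have "\<dots> = (\<Sum>j\<le>p * k. (p choose j) * ((p * n) choose (p * k - j)))"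
      by (rule vandermonde[symmetric])
    also have "[\<dots> = (\<Sum>j\<le>p * k. if j \<in> {0, p} then (p * n) choose (p * k - j) else 0)] (mod p)"
    proof (rule cong_sum)
      fix j
      show "[(p choose j) * ((p * n) choose (p * k - j)) =
            (if j \<in> {0, p} then (p * n) choose (p * k - j) else 0)] (mod p)"
      proof (cases "j \<in> {0, p}")
        case False
        have "p dvd p choose j"
        proof (cases "j < p")
          case True
          thus ?thesis using False p by (intro dvd_choose_prime) auto
        next
          case F: False
          thus ?thesis using False by (auto simp: binomial_eq_0)
        qed
        thus ?thesis using False by (auto simp: cong_0_iff)
      qed auto
    qed
    also have "(\<Sum>j\<le>p * k. if j \<in> {0, p} then (p * n) choose (p * k - j) else 0)
        = (\<Sum>j\<in>{0, p}. (p * n) choose (p * k - j))"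
      using Suc p0 by (subst sum.inter_restrict[symmetric]) (auto intro!: sum.cong)
    also have "\<dots> = ((p * n) choose (p * k)) + ((p * n) choose (p * k'))"
      using p0 Suc by simp
    also have "[\<dots> = (n choose k) + (n choose k')] (mod p)"
      by (intro cong_add Suc.IH)
    finally show ?thesis using Suc by (simp add: add.commute)
  qed
qed

text \<open>One step of Lucas' theorem. In the Vandermonde sum for \<open>a + p * n\<close> a term
  survives modulo \<open>p\<close> only if \<open>p\<close> divides \<open>b + p * k - j\<close>;
  with \<open>b\<close> and \<open>j\<close> at most \<open>a < p\<close> this means
  \<open>j = b\<close>.\<close>

lemma lucas_last_digit:
  fixes p :: nat
  assumes p: "prime p" and a: "a < p" and b: "b \<le> a"
  shows "[(a + p * n) choose (b + p * k) = (a choose b) * (n choose k)] (mod p)"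
proof -
  have "(a + p * n) choose (b + p * k)
      = (\<Sum>j\<le>b + p * k. (a choose j) * ((p * n) choose (b + p * k - j)))"
    by (rule vandermonde[symmetric])
  also have "[\<dots> = (\<Sum>j\<le>b + p * k. if j = b then (a choose b) * ((p * n) choose (p * k)) else 0)] (mod p)"
  proof (rule cong_sum)
    fix j assume j: "j \<in> {..b + p * k}"
    show "[(a choose j) * ((p * n) choose (b + p * k - j))
       = (if j = b then (a choose b) * ((p * n) choose (p * k)) else 0)] (mod p)"
    proof (cases "j = b \<or> j > a")
      case True
      thus ?thesis using b by (auto simp: binomial_eq_0)
    next
      case False
      have "\<not> p dvd b + p * k - j"
      proof
        assume "p dvd b + p * k - j"
        hence "int p dvd int (b + p * k - j)" by simp
        hence "int p dvd int b + int p * int k - int j"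
          using j by (subst (asm) of_nat_diff) auto
        moreover have "int p dvd int p * int k" by simp
        ultimately have "int p dvd int b - int j"
          by (metis add_diff_eq add.commute diff_add_eq dvd_add_right_iff)
        moreover have "int b - int j \<noteq> 0" "\<bar>int b - int j\<bar> < int p"
          using False a b by auto
        ultimately show False
          by (meson dvd_imp_le_int not_less abs_of_nat order.strict_trans2 linorder_not_less zdvd_not_zless zero_less_abs_iff dvd_abs_iff)
      qed
      hence "p dvd (p * n) choose (b + p * k - j)"
        using p by (rule prime_dvd_choose_mult[rotated])
      thus ?thesis using False by (auto simp: cong_0_iff)
    qed
  qed
  also have "(\<Sum>j\<le>b + p * k. if j = b then (a choose b) * ((p * n) choose (p * k)) else 0)
      = (a choose b) * ((p * n) choose (p * k))"
    by simp
  also have "[\<dots> = (a choose b) * (n choose k)] (mod p)"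
    by (intro cong_mult choose_prime_mult_cong p cong_refl)
  finally show ?thesis .
qed

lemma lucas_last_digit_not_dvd:
  fixes p :: nat
  assumes "prime p" "a < p" "b \<le> a" "\<not> p dvd n choose k"
  shows "\<not> p dvd (a + p * n) choose (b + p * k)"
proof -
  have "\<not> p dvd a choose b"
  proof
    assume "p dvd a choose b"
    hence "p dvd fact b * fact (a - b) * (a choose b)" by simp
    hence "p dvd fact a" using binomial_fact_lemma[OF assms(3)] by simp
    thus False using assms by (simp add: prime_dvd_fact_iff)
  qed
  hence "\<not> p dvd (a choose b) * (n choose k)"
    using assms by (simp add: prime_dvd_mult_iff)
  thus ?thesis using lucas_last_digit[OF assms(1-3)] cong_dvd_iff by blast
qed

text \<open>With \<open>p = 8j + 3\<close>, the base-\<open>p\<close> digits of \<open>(p\<^sup>2\<^sup>v - 1) / 8\<close> alternate between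
  \<open>3j + 1\<close> and \<open>j\<close>, those of \<open>(p\<^sup>2\<^sup>v - 1) / 2\<close> are all \<open>4j + 1\<close>.\<close>

lemma not_dvd_choose_quarter:
  fixes p :: nat
  assumes p: "prime p" "p mod 8 = 3"
  shows "\<not> p dvd (4 * ((p ^ (2 * v) - 1) div 8)) choose ((p ^ (2 * v) - 1) div 8)"
proof -
  define j where "j = p div 8"
  have pj: "p = 8 * j + 3"
    using p(2) unfolding j_def by (metis mult_div_mod_eq)
  show ?thesis
  proof (induction v)
    case 0
    thus ?case using p by (simp add: prime_nat_iff)
  next
    case (Suc v)
    define h where "h = (p ^ (2 * v) - 1) div 8"
    have "[(p ^ 2) ^ v = 1 ^ v] (mod 8)"
      by (intro cong_pow) (use p(2) in \<open>simp add: cong_def power_mod[symmetric, of p]\<close>)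
    hence "8 dvd p ^ (2 * v) - 1"
      by (metis cong_altdef_nat' cong_sym power_mult power_one cong_to_1_nat)
    moreover have "p ^ (2 * v) > 0" using p(1) prime_gt_0_nat by simp
    ultimately have h: "p ^ (2 * v) = 8 * h + 1"
      unfolding h_def by auto
    have "p ^ (2 * Suc v) = p * p * (8 * h + 1)"
      using h by (simp add: power2_eq_square algebra_simps)
    also have "\<dots> = 8 * ((3 * j + 1) + p * (j + p * h)) + 1"
      unfolding pj by (simp add: algebra_simps)
    finally have h': "(p ^ (2 * Suc v) - 1) div 8 = (3 * j + 1) + p * (j + p * h)" by simp
    \<comment> \<open>\<open>4 * (3 * j + 1) = (4 * j + 1) + p\<close>: the carry turns the next
      digit \<open>4 * j\<close> into \<open>4 * j + 1\<close>, so both digits of the lower entry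
      stay below those of the upper one.\<close>
    have h4: "4 * ((3 * j + 1) + p * (j + p * h)) = (4 * j + 1) + p * ((4 * j + 1) + p * (4 * h))"
      unfolding pj by (simp add: algebra_simps)
    show ?case unfolding h' h4
      using Suc.IH by (intro lucas_last_digit_not_dvd p) (auto simp: pj h_def)
  qed
qed

text \<open>\<open>p ^ k\<close> divides \<open>(x * b - y * a) * (x * b + y * a)\<close>, but
  \<open>p\<close> cannot divide both factors, so \<open>p ^ k\<close> divides one of them. By the
  composition identity of the form, twice the square of that factor is at most
  \<open>p ^ (2 * k)\<close>, which forces it to vanish.\<close>

lemma prime_power_form_unique:
  fixes p k :: nat and a b x y :: int
  assumes p: "prime p" "odd p"
    and ab: "a\<^sup>2 + 2 * b\<^sup>2 = int (p ^ k)" and xy: "x\<^sup>2 + 2 * y\<^sup>2 = int (p ^ k)"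
    and pa: "\<not> int p dvd a" and px: "\<not> int p dvd x" and k: "k \<ge> 1"
  shows "x\<^sup>2 = a\<^sup>2 \<and> y\<^sup>2 = b\<^sup>2"
proof -
  have pp: "prime (int p)" using p by simp
  have M0: "int (p ^ k) > 0" using p(1) prime_gt_0_nat by simp
  \<comment> \<open>Stated for an arbitrary \<open>y\<close> because both \<open>y\<close> and
    \<open>- y\<close> are needed.\<close>
  have core: "x * b = y * a"
    if y: "x\<^sup>2 + 2 * y\<^sup>2 = int (p ^ k)" and dvd: "int (p ^ k) dvd x * b - y * a" for y
  proof (rule ccontr)
    assume "x * b \<noteq> y * a"
    hence "\<bar>int (p ^ k)\<bar> \<le> \<bar>x * b - y * a\<bar>" using dvd by (intro dvd_imp_le_int) auto
    hence "(int (p ^ k))\<^sup>2 \<le> (x * b - y * a)\<^sup>2" by (simp only: abs_le_square_iff)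
    moreover have "(x * a + 2 * y * b)\<^sup>2 + 2 * (x * b - y * a)\<^sup>2 = (x\<^sup>2 + 2 * y\<^sup>2) * (a\<^sup>2 + 2 * b\<^sup>2)"
      by (simp add: power2_eq_square algebra_simps)
    hence "(x * a + 2 * y * b)\<^sup>2 + 2 * (x * b - y * a)\<^sup>2 = (int (p ^ k))\<^sup>2"
      unfolding ab y by (simp add: power2_eq_square)
    moreover have "(x * a + 2 * y * b)\<^sup>2 \<ge> 0" by simp
    moreover have "(int (p ^ k))\<^sup>2 > 0" using M0 by simp
    ultimately show False by linarith
  qed
  have prod: "(x * b - y * a) * (x * b + y * a) = int (p ^ k) * (b\<^sup>2 - y\<^sup>2)"
  proof -
    have "(x * b - y * a) * (x * b + y * a) = x\<^sup>2 * b\<^sup>2 - y\<^sup>2 * a\<^sup>2"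
      by (simp add: power2_eq_square algebra_simps)
    also have "x\<^sup>2 = int (p ^ k) - 2 * y\<^sup>2" using xy by simp
    also have "a\<^sup>2 = int (p ^ k) - 2 * b\<^sup>2" using ab by simp
    finally show ?thesis by (simp add: algebra_simps)
  qed
  have pk: "int p dvd int (p ^ k)" using k by (cases k) auto
  have "\<not> (int p dvd x * b - y * a \<and> int p dvd x * b + y * a)"
  proof
    assume "int p dvd x * b - y * a \<and> int p dvd x * b + y * a"
    hence "int p dvd (x * b - y * a) + (x * b + y * a)" using dvd_add by blast
    hence "int p dvd 2 * (x * b)" by (simp add: mult_ac)
    moreover have "\<not> int p dvd 2"
      using p by (metis of_nat_numeral of_nat_dvd_iff primes_dvd_imp_eq two_is_prime_nat even_numeral dvd_refl)
    ultimately have "int p dvd b" using pp px by (simp add: prime_dvd_mult_iff)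
    hence "int p dvd int (p ^ k) - 2 * b\<^sup>2" using pk by (auto intro!: dvd_diff simp: power2_eq_square)
    also have "int (p ^ k) - 2 * b\<^sup>2 = a\<^sup>2" using ab by simp
    finally show False using pa pp by (simp add: prime_dvd_power_iff)
  qed
  hence "int (p ^ k) dvd x * b - y * a \<or> int (p ^ k) dvd x * b + y * a"
  proof (cases "int p dvd x * b + y * a")
    case True
    hence "coprime (int p ^ k) (x * b - y * a)"
      using \<open>\<not> (_ \<and> _)\<close> prime_imp_coprime[OF pp] by simp
    moreover have "int p ^ k dvd (x * b - y * a) * (x * b + y * a)" using prod by simp
    ultimately show ?thesis by (simp add: coprime_dvd_mult_right_iff)
  next
    case False
    hence "coprime (int p ^ k) (x * b + y * a)"
      using prime_imp_coprime[OF pp] by simp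
    moreover have "int p ^ k dvd (x * b - y * a) * (x * b + y * a)" using prod by simp
    ultimately show ?thesis by (simp add: coprime_dvd_mult_left_iff)
  qed
  hence "x * b = y * a \<or> x * b = - y * a"
    using core[of y] core[of "- y"] xy by auto
  hence "int (p ^ k) * (b\<^sup>2 - y\<^sup>2) = 0" using prod by auto
  hence "y\<^sup>2 = b\<^sup>2" using M0 by auto
  thus ?thesis using ab xy by simp
qed

section \<open>Generators and additive characters of finite fields\<close>

text \<open>The type is repackaged as a HOL-Algebra record with carrier \<open>UNIV\<close>, where
  cyclicity of the multiplicative group is available.\<close>

lemma finite_field_generator:
  obtains g :: "'a::{finite,field}" where "g \<noteq> 0" "\<And>x. x \<noteq> 0 \<Longrightarrow> \<exists>i. x = g ^ i"
proof -
  define R :: "'a ring" where "R = \<lparr>carrier = UNIV, mult = (*), one = 1, zero = 0, add = (+)\<rparr>"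
  have "abelian_group R"
    by (rule abelian_groupI) (auto simp: R_def add_ac intro: exI[of _ "- _"] ab_left_minus)
  moreover have "Group.comm_monoid R"
    by (rule comm_monoidI) (auto simp: R_def mult_ac)
  ultimately have "cring R"
    by (rule cringI) (auto simp: R_def algebra_simps)
  then interpret cring R .
  have "field R"
  proof (rule cring_fieldI2)
    show "\<exists>b\<in>carrier R. a \<otimes>\<^bsub>R\<^esub> b = \<one>\<^bsub>R\<^esub>" if "a \<in> carrier R" "a \<noteq> \<zero>\<^bsub>R\<^esub>" for a
      using that by (intro bexI[of _ "inverse a"]) (auto simp: R_def)
  qed (auto simp: R_def)
  then interpret field R .
  have pow: "a [^]\<^bsub>R\<^esub> i = a ^ i" for a and i :: nat
    by (induction i) (auto simp: R_def nat_pow_def)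
  obtain g where g: "g \<in> carrier (mult_of R)" "carrier (mult_of R) = {g [^]\<^bsub>R\<^esub> i | i::nat. i \<in> UNIV}"
    using finite_field_mult_group_has_gen by (auto simp: R_def)
  show ?thesis
  proof (rule that[of g])
    show "g \<noteq> 0" using g(1) by (simp add: carrier_mult_of R_def)
    fix x :: 'a assume "x \<noteq> 0"
    hence "x \<in> carrier (mult_of R)" by (simp add: carrier_mult_of R_def)
    thus "\<exists>i. x = g ^ i" using g(2) pow by auto
  qed
qed

lemma finite_field_fermat:
  fixes x :: "'a::{finite,field}"
  assumes "x \<noteq> 0"
  shows "x ^ (CARD('a) - 1) = 1"
proof -
  have "(\<Prod>y\<in>UNIV - {0}. x * y) = (\<Prod>y\<in>UNIV - {0}. y)"
    by (rule prod.reindex_bij_witness[of _ "\<lambda>y. y / x" "\<lambda>y. x * y"]) (use assms in auto)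
  moreover have "(\<Prod>y\<in>UNIV - {0}. x * y) = x ^ (CARD('a) - 1) * (\<Prod>y\<in>UNIV - {0}. y)"
    by (simp add: prod.distrib card_Diff_singleton)
  moreover have "(\<Prod>y\<in>UNIV - {0::'a}. y) \<noteq> 0" by simp
  ultimately show ?thesis by simp
qed

lemma finite_field_pow_card:
  fixes x :: "'a::{finite,field}"
  shows "x ^ CARD('a) = x"
proof (cases "x = 0")
  case False
  have "x ^ CARD('a) = x * x ^ (CARD('a) - 1)"
    by (metis finite_UNIV_card_ge_0 finite_class.finite_UNIV power_eq_if not_gr_zero)
  thus ?thesis using finite_field_fermat[OF False] by simp
qed auto

text \<open>\<open>X ^ p - X\<close> has at most \<open>p\<close> roots, and by Fermat's little
  theorem the images of \<open>0, ..., p - 1\<close> already are \<open>p\<close> distinct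
  ones.\<close>

lemma prime_subfield_of_nat:
  fixes z :: "'a::{finite,field}"
  assumes p: "prime p" and char: "CHAR('a) = p" and z: "z ^ p = z"
  shows "\<exists>k<p. z = of_nat k"
proof -
  have p1: "p > 1" using p prime_gt_1_nat by blast
  define P :: "'a poly" where "P = Polynomial.monom 1 p - Polynomial.monom 1 1"
  have dP: "Polynomial.degree P = p"
    unfolding P_def diff_conv_add_uminus using p1
    by (subst degree_add_eq_left) (auto simp: degree_monom_eq)
  hence P0: "P \<noteq> 0" using p1 by auto
  have root: "poly P x = 0 \<longleftrightarrow> x ^ p = x" for x
    by (simp add: P_def poly_monom)
  have inj: "inj_on (of_nat :: nat \<Rightarrow> 'a) {..<p}"
    by (rule inj_onI) (use char in \<open>auto simp: of_nat_eq_iff_cong_CHAR cong_def\<close>)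
  have sub: "of_nat ` {..<p} \<subseteq> {x::'a. x ^ p = x}"
  proof
    fix x :: 'a assume "x \<in> of_nat ` {..<p}"
    then obtain k where x: "x = of_nat k" by blast
    have "[k ^ p = k] (mod p)"
    proof (cases "p dvd k")
      case True
      thus ?thesis using p1 by (simp add: cong_def dvd_power_le mod_eq_0_iff_dvd dvd_trans[OF True dvd_power])
    next
      case False
      hence "[k ^ (p - 1) * k = 1 * k] (mod p)" using p by (intro cong_mult fermat_theorem) auto
      thus ?thesis using p1 by (metis mult_1 power_minus_mult prime_gt_0_nat p)
    qed
    thus "x \<in> {x. x ^ p = x}"
      unfolding x using char by (simp add: of_nat_eq_iff_cong_CHAR flip: of_nat_power)
  qed
  have "of_nat ` {..<p} = {x::'a. x ^ p = x}"
  proof (rule card_subset_eq[OF _ sub])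
    have "card {x::'a. x ^ p = x} \<le> p"
      using card_poly_roots_bound[OF P0] dP root by simp
    moreover have "card (of_nat ` {..<p} :: 'a set) = p" using inj by (simp add: card_image)
    moreover have "card (of_nat ` {..<p} :: 'a set) \<le> card {x::'a. x ^ p = x}"
      using sub by (intro card_mono) auto
    ultimately show "card (of_nat ` {..<p} :: 'a set) = card {x::'a. x ^ p = x}" by simp
  qed auto
  thus ?thesis using z by blast
qed

text \<open>The character is \<open>exp (2 * pi * \<i> * tr x / p)\<close> with the absolute trace
  \<open>tr\<close>, which is unchanged when Frobenius permutes the conjugates.\<close>

lemma frobenius_invariant_character:
  fixes p s :: nat
  assumes p: "prime p" and char: "CHAR('a::{finite,field}) = p"
    and card: "CARD('a::{finite,field}) = p ^ s"
  obtains \<psi> :: "'a::{finite,field} \<Rightarrow> complex" where "\<And>x y. \<psi> (x + y) = \<psi> x * \<psi> y"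
    "\<psi> 0 = 1" "\<And>x. \<psi> (x ^ p) = \<psi> x" "\<exists>x. \<psi> x \<noteq> 1"
proof -
  have p1: "p > 1" using p prime_gt_1_nat by blast
  have "CARD('a) > 1"
    by (metis finite_class.finite_UNIV card_gt_0_iff UNIV_not_empty One_nat_def Suc_lessI card_1_singletonE UNIV_I empty_iff insert_iff zero_neq_one)
  hence s: "s > 0" using card by (cases s) auto
  define tr :: "'a \<Rightarrow> 'a" where "tr x = (\<Sum>i<s. x ^ (p ^ i))" for x
  have prime_char: "prime CHAR('a)" using p char by simp
  have tr_add: "tr (x + y) = tr x + tr y" for x y
    unfolding tr_def sum.distrib[symmetric]
    by (intro sum.cong refl freshmans_dream'[OF prime_char]) (simp add: char)
  have tr_pow: "tr x ^ p = tr (x ^ p)" for x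
    unfolding tr_def using char
    by (subst freshmans_dream_sum[OF prime_char]) (simp_all add: power_mult[symmetric] mult.commute)
  have tr_frob: "tr (x ^ p) = tr x" for x
  proof -
    have "tr (x ^ p) = (\<Sum>i<s. x ^ (p ^ Suc i))"
      unfolding tr_def by (simp add: power_mult)
    also have "\<dots> + x ^ (p ^ 0) = (\<Sum>i<Suc s. x ^ (p ^ i))"
      by (subst sum.lessThan_Suc_shift) simp
    also have "\<dots> = tr x + x"
      unfolding tr_def using finite_field_pow_card[of x] card by simp
    finally show ?thesis by simp
  qed
  have "\<exists>k. k < p \<and> tr x = of_nat k" for x
    using prime_subfield_of_nat[OF p char, of "tr x"] tr_pow tr_frob by auto
  \<comment> \<open>\<open>L x\<close> represents the trace in \<open>{0..<p}\<close>. It is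
    additive only modulo \<open>p\<close>, which suffices for an exponent of a \<open>p\<close>-th
    root of unity.\<close>
  then obtain L where L: "\<And>x. L x < p" "\<And>x. tr x = of_nat (L x)" by metis
  define \<psi> :: "'a \<Rightarrow> complex" where "\<psi> x = cis (2 * pi / p) ^ L x" for x
  have per: "cis (2 * pi / p) ^ a = cis (2 * pi / p) ^ b" if "[a = b] (mod p)" for a b
  proof -
    have "cis (2 * pi / p) ^ p = 1" using p1 unfolding Complex.DeMoivre by simp
    hence "cis (2 * pi / p) ^ (n mod p) = cis (2 * pi / p) ^ n" for n
      by (metis mult_div_mod_eq power_add power_mult power_one mult_1)
    thus ?thesis using that unfolding cong_def by metis
  qed
  have add: "\<psi> (x + y) = \<psi> x * \<psi> y" for x y
  proof -
    have "(of_nat (L (x + y)) :: 'a) = of_nat (L x + L y)"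
      using tr_add[of x y] L(2) by simp
    hence "[L (x + y) = L x + L y] (mod p)" unfolding of_nat_eq_iff_cong_CHAR char .
    thus ?thesis unfolding \<psi>_def by (simp add: per power_add[symmetric])
  qed
  have frob: "\<psi> (x ^ p) = \<psi> x" for x
  proof -
    have "(of_nat (L (x ^ p)) :: 'a) = of_nat (L x)" using tr_frob[of x] L(2) by simp
    hence "[L (x ^ p) = L x] (mod p)" using char by (simp add: of_nat_eq_iff_cong_CHAR)
    thus ?thesis unfolding \<psi>_def by (rule per)
  qed
  have nontriv: "\<exists>x. \<psi> x \<noteq> 1"
  proof -
    define P :: "'a poly" where "P = (\<Sum>i<s. Polynomial.monom 1 (p ^ i))"
    \<comment> \<open>The coefficient of \<open>X\<close> is 1 since \<open>p ^ i = 1\<close> only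
      for \<open>i = 0\<close>. So the trace polynomial is nonzero, and its degree is too small for
      it to vanish on the whole field.\<close>
    have "Polynomial.coeff P (p ^ 0) = (\<Sum>i<s. if p ^ i = p ^ 0 then 1 else 0)"
      unfolding P_def by (simp add: coeff_sum coeff_monom)
    also have "\<dots> = (\<Sum>i<s. if i = 0 then 1 else 0)"
      by (intro sum.cong) (use p1 in \<open>auto simp: power_eq_1_iff\<close>)
    also have "\<dots> = 1" using s by simp
    finally have "P \<noteq> 0" by auto
    moreover have "Polynomial.degree P \<le> p ^ (s - 1)"
      unfolding P_def by (intro degree_sum_le)
        (auto intro!: order.trans[OF degree_monom_le] power_increasing simp: less_imp_le[OF p1, simplified])
    moreover have "poly P x = tr x" for x
      by (simp add: P_def tr_def poly_sum poly_monom)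
    ultimately have "card {x. tr x = 0} \<le> p ^ (s - 1)"
      using card_poly_roots_bound[of P] by simp
    also have "\<dots> < CARD('a)" unfolding card using p1 s by (intro power_strict_increasing) auto
    finally have "{x. tr x = 0} \<noteq> UNIV" by auto
    then obtain x where "tr x \<noteq> 0" by auto
    hence "L x \<noteq> 0" using L(2) by (metis of_nat_0)
    moreover have "L x < p" by (rule L)
    ultimately have "\<not> int p dvd int (L x)" by (simp add: nat_dvd_not_less)
    have psix: "\<psi> x = cis (2 * pi * L x / p)" unfolding \<psi>_def by (simp add: Complex.DeMoivre mult_ac)
    have "\<psi> x \<noteq> 1"
    proof
      assume "\<psi> x = 1"
      hence "cis (2 * pi * L x / p) = cis 0" using psix by simp
      hence "cos (2 * pi * L x / p) = 1" by (simp add: cis.ctr complex_eq_iff)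
      then obtain n :: int where "2 * pi * L x / p = of_int n * (2 * pi)"
        using cos_one_2pi_int by auto
      hence "real (L x) = of_int n * real p" using p1 by (simp add: field_simps)
      hence "int (L x) = n * int p" by (metis of_int_eq_iff of_int_mult of_int_of_nat_eq)
      thus False using \<open>\<not> int p dvd _\<close> by simp
    qed
    thus ?thesis by blast
  qed
  have "\<psi> 0 * \<psi> 0 = \<psi> 0" "\<psi> 0 \<noteq> 0"
    using add[of 0 0] by (simp_all add: \<psi>_def)
  hence zero: "\<psi> 0 = 1" by simp
  show ?thesis using that add zero frob nontriv by blast
qed

section \<open>Gauss and Jacobi sums\<close>

lemma sum_lessThan_mult_split:
  fixes f :: "nat \<Rightarrow> 'b::comm_monoid_add"
  shows "(\<Sum>i<k * L. f i) = (\<Sum>j<k. \<Sum>i<L. f (i + j * L))"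
proof -
  have "(\<Sum>i<k * L. f i) = (\<Sum>j<k. sum f {j * L..<j * L + L})"
    by (rule sum.nat_group[symmetric])
  also have "\<dots> = (\<Sum>j<k. \<Sum>i<L. f (i + j * L))"
  proof (rule sum.cong[OF refl])
    fix j
    show "sum f {j * L..<j * L + L} = (\<Sum>i<L. f (i + j * L))"
      using sum.shift_bounds_nat_ivl[of f 0 "j * L" L]
      by (simp add: atLeast0LessThan add.commute)
  qed
  finally show ?thesis .
qed

lemma sum_lessThan_periodic:
  fixes f :: "nat \<Rightarrow> 'b::comm_semiring_1"
  assumes "\<And>i. f (i + L) = f i"
  shows "(\<Sum>i<k * L. f i) = of_nat k * (\<Sum>i<L. f i)"
proof -
  have "f (i + j * L) = f i" for i j
    by (induction j) (use assms in \<open>auto simp: add.assoc[symmetric] add.commute[of L]\<close>)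
  thus ?thesis by (simp add: sum_lessThan_mult_split)
qed

lemma sum_lessThan_multiples:
  fixes f :: "nat \<Rightarrow> 'b::comm_monoid_add"
  assumes "k > 0"
  shows "(\<Sum>i<k * L. if k dvd i then f i else 0) = (\<Sum>i<L. f (k * i))"
proof -
  have "(\<Sum>i<k * L. if k dvd i then f i else 0) = (\<Sum>j<L. \<Sum>i<k. if k dvd i + j * k then f (i + j * k) else 0)"
    by (subst mult.commute) (rule sum_lessThan_mult_split)
  also have "\<dots> = (\<Sum>j<L. \<Sum>i<k. if i = 0 then f (k * j) else 0)"
    by (intro sum.cong refl) (use assms in \<open>auto simp: mult.commute dvd_add_left_iff dest: dvd_imp_le\<close>)
  also have "\<dots> = (\<Sum>j<L. f (k * j))" using assms by simp
  finally show ?thesis .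
qed

lemma cis_root_power_eq_1_iff:
  assumes "n > 0"
  shows "cis (2 * pi / real n) ^ k = 1 \<longleftrightarrow> n dvd k"
proof
  assume "n dvd k"
  then obtain c where "k = n * c" by blast
  moreover have "cis (2 * pi / real n) ^ n = 1" using assms unfolding Complex.DeMoivre by simp
  ultimately show "cis (2 * pi / real n) ^ k = 1" by (simp add: power_mult)
next
  assume "cis (2 * pi / real n) ^ k = 1"
  hence "cis (real k * (2 * pi / real n)) = 1" by (simp only: Complex.DeMoivre)
  hence "cos (real k * (2 * pi / real n)) = 1" by (simp add: complex_eq_iff)
  then obtain z :: int where "real k * (2 * pi / real n) = of_int z * (2 * pi)"
    using cos_one_2pi_int by auto
  hence "real k = of_int z * real n" using assms by (simp add: field_simps)
  hence "int k = z * int n" by (metis of_int_eq_iff of_int_mult of_int_of_nat_eq)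
  thus "n dvd k" by (metis dvd_triv_right of_nat_dvd_iff)
qed

lemma sum_powers_root_of_unity:
  fixes z :: complex
  assumes "z ^ n = 1"
  shows "(\<Sum>i<n. z ^ i) = (if z = 1 then of_nat n else 0)"
  using assms by (auto simp: geometric_sum)

lemma power_mod_exponent:
  fixes x :: "'b::monoid_mult"
  assumes "x ^ n = 1"
  shows "x ^ (i mod n) = x ^ i"
proof -
  have "x ^ i = x ^ (n * (i div n) + i mod n)" by simp
  also have "\<dots> = x ^ (i mod n)" unfolding power_add power_mult assms by simp
  finally show ?thesis by simp
qed

locale finite_field_gauss =
  fixes g :: "'a::{finite,field}" and \<psi> :: "'a \<Rightarrow> complex" and p q M :: nat
  assumes card_eq: "CARD('a) = q" and prime_p: "prime p" and char_eq: "CHAR('a) = p"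
    and odd_p: "odd p" and M_def: "M = q - 1"
    and g_nz: "g \<noteq> 0" and generator: "\<And>x. x \<noteq> 0 \<Longrightarrow> \<exists>i. x = g ^ i"
    and psi_add: "\<And>x y. \<psi> (x + y) = \<psi> x * \<psi> y"
    and psi_0 [simp]: "\<psi> 0 = 1"
    and psi_frob: "\<And>x. \<psi> (x ^ p) = \<psi> x"
    and psi_nontrivial: "\<exists>x. \<psi> x \<noteq> 1"
begin

lemma q_gt_1: "q > 1"
proof -
  have "card {0, 1::'a} \<le> CARD('a)" by (rule card_mono) auto
  thus ?thesis using card_eq by simp
qed

lemma M_pos: "M > 0" and q_eq: "q = Suc M"
  using q_gt_1 M_def by auto

lemma fermat: "x \<noteq> 0 \<Longrightarrow> x ^ M = 1" for x :: 'a
  using finite_field_fermat[of x] card_eq M_def by simp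

lemma gen_power_mod: "g ^ (i mod M) = g ^ i"
  using fermat[OF g_nz] by (rule power_mod_exponent)

lemma bij_gen: "bij_betw (\<lambda>i. g ^ i) {..<M} (UNIV - {0})"
proof -
  have im: "(\<lambda>i. g ^ i) ` {..<M} = UNIV - {0}"
  proof
    show "UNIV - {0} \<subseteq> (\<lambda>i. g ^ i) ` {..<M}"
    proof
      fix x :: 'a assume "x \<in> UNIV - {0}"
      then obtain i where "x = g ^ i" using generator by blast
      hence "x = g ^ (i mod M)" by (simp add: gen_power_mod)
      thus "x \<in> (\<lambda>i. g ^ i) ` {..<M}" using M_pos by auto
    qed
  qed (use g_nz in auto)
  moreover have "card (UNIV - {0::'a}) = M"
    using card_eq M_def by (simp add: card_Diff_singleton)
  ultimately have "inj_on (\<lambda>i. g ^ i) {..<M}" by (intro eq_card_imp_inj_on) auto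
  thus ?thesis using im by (simp add: bij_betw_def)
qed

lemma gen_power_eq_iff: "g ^ i = g ^ j \<longleftrightarrow> i mod M = j mod M"
proof
  assume "g ^ i = g ^ j"
  hence "g ^ (i mod M) = g ^ (j mod M)" by (simp add: gen_power_mod)
  thus "i mod M = j mod M"
    using bij_gen M_pos by (auto simp: bij_betw_def inj_on_def)
next
  assume "i mod M = j mod M"
  thus "g ^ i = g ^ j" by (metis gen_power_mod)
qed

lemma sum_nonzero: "(\<Sum>x\<in>UNIV - {0}. f x) = (\<Sum>i<M. f (g ^ i))"
  using sum.reindex_bij_betw[OF bij_gen, of f] by simp

lemma sum_split_0: "(\<Sum>x\<in>UNIV. f x) = f 0 + (\<Sum>x\<in>UNIV - {0}. f x)" for f :: "'a \<Rightarrow> 'b::comm_monoid_add"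
  by (simp add: sum.remove[of UNIV 0])

definition ind :: "'a \<Rightarrow> nat" where "ind x = (SOME i. x = g ^ i)"

lemma gen_ind: "x \<noteq> 0 \<Longrightarrow> g ^ ind x = x"
  unfolding ind_def using generator[of x] by (metis (mono_tags, lifting) someI_ex)

section \<open>Multiplicative characters\<close>

definition \<omega> :: complex where "\<omega> = cis (2 * pi / real M)"

lemma omega_M: "\<omega> ^ M = 1"
  unfolding \<omega>_def using cis_root_power_eq_1_iff[OF M_pos] by simp

lemma omega_eq_1_iff: "\<omega> ^ k = 1 \<longleftrightarrow> M dvd k"
  unfolding \<omega>_def using cis_root_power_eq_1_iff[OF M_pos] by simp

lemma omega_mod: "\<omega> ^ (i mod M) = \<omega> ^ i"
  using omega_M by (rule power_mod_exponent)

lemma omega_cong: "[i = j] (mod M) \<Longrightarrow> \<omega> ^ i = \<omega> ^ j"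
  unfolding cong_def by (metis omega_mod)

lemma cnj_omega: "cnj \<omega> * \<omega> = 1"
  unfolding \<omega>_def by (simp add: cis_cnj cis_mult)

text \<open>\<open>ind x\<close> is a discrete logarithm, determined only modulo the order
  \<open>M\<close> of \<open>\<omega>\<close>. The value at 0 is 0 for the trivial character as
  well, so that sums over the field and over its units agree.\<close>

definition chi :: "nat \<Rightarrow> 'a \<Rightarrow> complex" where
  "chi j x = (if x = 0 then 0 else \<omega> ^ (j * ind x))"

lemma chi_0 [simp]: "chi j 0 = 0"
  by (simp add: chi_def)

lemma chi_gen: "chi j (g ^ i) = \<omega> ^ (j * i)"
proof -
  have "g ^ ind (g ^ i) = g ^ i" using gen_ind g_nz by simp
  hence "[ind (g ^ i) = i] (mod M)" by (simp add: gen_power_eq_iff cong_def)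
  hence "[j * ind (g ^ i) = j * i] (mod M)" by (rule cong_scalar_left)
  thus ?thesis using g_nz by (simp add: chi_def omega_cong)
qed

lemma nonzero_genE:
  assumes "x \<noteq> 0" obtains i where "x = g ^ i"
  using generator[OF assms] by blast

lemma chi_1 [simp]: "chi j 1 = 1"
  using chi_gen[of j 0] by simp

lemma chi_mult: "chi j (x * y) = chi j x * chi j y"
proof (cases "x = 0 \<or> y = 0")
  case False
  then obtain a b where "x = g ^ a" "y = g ^ b" by (metis nonzero_genE)
  thus ?thesis by (simp add: chi_gen power_add[symmetric] algebra_simps)
qed auto

lemma chi_add: "chi (i + j) x = chi i x * chi j x"
  by (simp add: chi_def power_add algebra_simps)

lemma chi_cong: "[i = j] (mod M) \<Longrightarrow> chi i x = chi j x"
  unfolding chi_def by (auto intro!: omega_cong cong_scalar_right)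

lemma chi_power: "n > 0 \<Longrightarrow> chi j (x ^ n) = chi j x ^ n"
  by (induction n rule: nat_induct_non_zero) (auto simp: chi_mult)

lemma chi_times: "x \<noteq> 0 \<Longrightarrow> chi (n * j) x = chi j x ^ n"
  by (simp add: chi_def power_mult[symmetric] mult_ac)

lemma chi_times_eq_power: "n > 0 \<Longrightarrow> chi (j * n) x = chi j (x ^ n)"
  by (cases "x = 0") (auto simp: chi_power chi_times mult.commute[of j])

lemma chi_zero: "x \<noteq> 0 \<Longrightarrow> chi 0 x = 1"
  by (simp add: chi_def)

lemma cnj_chi: "x \<noteq> 0 \<Longrightarrow> cnj (chi j x) * chi j x = 1"
  unfolding chi_def using cnj_omega by (simp add: power_mult_distrib[symmetric])

lemma cnj_chi_inverse: "cnj (chi j x) = chi j (inverse x)"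
proof (cases "x = 0")
  case False
  have "chi j (inverse x) * chi j x = 1" using False by (simp add: chi_mult[symmetric])
  moreover have "chi j x \<noteq> 0" using cnj_chi[OF False, of j] by auto
  ultimately show ?thesis using cnj_chi[OF False, of j] by (metis mult_right_cancel)
qed auto

lemma sum_chi: "\<not> M dvd j \<Longrightarrow> (\<Sum>x\<in>UNIV. chi j x) = 0"
proof -
  assume j: "\<not> M dvd j"
  have "(\<Sum>x\<in>UNIV. chi j x) = (\<Sum>i<M. (\<omega> ^ j) ^ i)"
    unfolding sum_split_0[of "chi j"] sum_nonzero by (simp add: chi_gen power_mult)
  also have "\<dots> = 0"
    using j by (subst sum_powers_root_of_unity)
      (simp_all add: omega_eq_1_iff power_mult[symmetric])
  finally show ?thesis .
qed

section \<open>The additive character\<close>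

lemma psi_sum: "finite A \<Longrightarrow> \<psi> (\<Sum>i\<in>A. f i) = (\<Prod>i\<in>A. \<psi> (f i))"
  by (induction A rule: finite_induct) (auto simp: psi_add)

lemma psi_of_nat: "\<psi> (of_nat t * y) = \<psi> y ^ t"
  by (induction t) (auto simp: psi_add algebra_simps)

lemma psi_p: "\<psi> y ^ p = 1"
  using psi_of_nat[of p y] char_eq by (metis mult_zero_left of_nat_CHAR psi_0)

lemma norm_psi: "norm (\<psi> y) = 1"
proof -
  have "norm (\<psi> y) ^ p = 1" using psi_p[of y] by (metis norm_one norm_power)
  thus ?thesis using prime_gt_0_nat[OF prime_p] by (intro power_eq_imp_eq_base[of _ p 1]) auto
qed

lemma psi_minus: "\<psi> (- y) = cnj (\<psi> y)"
proof -
  have "\<psi> y * \<psi> (- y) = 1" by (simp add: psi_add[symmetric])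
  moreover have "\<psi> y * cnj (\<psi> y) = 1" using norm_psi[of y] by (simp add: complex_norm_square[symmetric])
  moreover have "\<psi> y \<noteq> 0" using norm_psi[of y] by auto
  ultimately show ?thesis by (metis mult_cancel_left)
qed

lemma sum_psi: "(\<Sum>x\<in>UNIV. \<psi> (a * x)) = (if a = 0 then of_nat q else 0)"
proof (cases "a = 0")
  case True
  thus ?thesis using card_eq by simp
next
  case False
  obtain b where b: "\<psi> b \<noteq> 1" using psi_nontrivial by blast
  have "(\<Sum>x\<in>UNIV. \<psi> (a * x)) = (\<Sum>x\<in>UNIV. \<psi> (a * (x + b / a)))"
    by (rule sum.reindex_bij_witness[of _ "\<lambda>x. x + b / a" "\<lambda>x. x - b / a"]) auto
  also have "\<dots> = \<psi> b * (\<Sum>x\<in>UNIV. \<psi> (a * x))"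
    using False by (simp add: distrib_left psi_add sum_distrib_left mult.commute)
  finally have "(\<psi> b - 1) * (\<Sum>x\<in>UNIV. \<psi> (a * x)) = 0" by (simp add: algebra_simps)
  thus ?thesis using b False by simp
qed

section \<open>Gauss sums\<close>

definition gauss :: "nat \<Rightarrow> complex" where
  "gauss j = (\<Sum>x\<in>UNIV. chi j x * \<psi> x)"

lemma gauss_cong: "[i = j] (mod M) \<Longrightarrow> gauss i = gauss j"
  unfolding gauss_def using chi_cong by simp

lemma gauss_twist: "a \<noteq> 0 \<Longrightarrow> (\<Sum>x\<in>UNIV. chi j x * \<psi> (a * x)) = cnj (chi j a) * gauss j"
proof -
  assume a: "a \<noteq> 0"
  have "(\<Sum>x\<in>UNIV. chi j x * \<psi> (a * x)) = (\<Sum>x\<in>UNIV. chi j (inverse a * x) * \<psi> x)"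
    by (rule sum.reindex_bij_witness[of _ "\<lambda>x. inverse a * x" "\<lambda>x. a * x"])
      (use a in \<open>auto simp: mult.assoc[symmetric]\<close>)
  thus ?thesis by (simp add: chi_mult gauss_def sum_distrib_left mult_ac cnj_chi_inverse)
qed

lemma bij_frob: "bij (\<lambda>x::'a. x ^ p)"
proof -
  have "inj (\<lambda>x::'a. x ^ p)"
  proof (rule injI)
    fix x y :: 'a assume "x ^ p = y ^ p"
    moreover have "((x - y) + y) ^ p = (x - y) ^ p + y ^ p"
      by (rule freshmans_dream) (use prime_p char_eq in auto)
    ultimately have "(x - y) ^ p = 0" by simp
    thus "x = y" by simp
  qed
  thus ?thesis by (simp add: finite_UNIV_inj_surj bij_def)
qed

text \<open>Substituting \<open>x ^ p\<close> for \<open>x\<close> preserves \<open>\<psi>\<close>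
  and turns \<open>chi j\<close> into \<open>chi (j * p)\<close>.\<close>

lemma gauss_frob: "gauss (j * p) = gauss j"
proof -
  have "gauss j = (\<Sum>x\<in>UNIV. chi j (x ^ p) * \<psi> (x ^ p))"
    unfolding gauss_def by (rule sum.reindex_bij_betw[OF bij_frob, symmetric])
  also have "\<dots> = gauss (j * p)"
    unfolding gauss_def using prime_p prime_gt_0_nat by (simp add: chi_times_eq_power psi_frob)
  finally show ?thesis by simp
qed

lemma gauss_frob_power: "gauss (j * p ^ k) = gauss j"
proof (induction k)
  case (Suc k)
  have "gauss (j * p ^ Suc k) = gauss (j * p ^ k * p)" by (simp add: mult_ac)
  thus ?case using Suc gauss_frob by simp
qed auto

lemma cnj_chi_neg: "[i + j = 0] (mod M) \<Longrightarrow> chi i x = cnj (chi j x)"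
proof (cases "x = 0")
  case False
  assume "[i + j = 0] (mod M)"
  hence "chi i x * chi j x = 1" using chi_cong[of "i + j" 0 x] chi_add[of i j x] chi_zero[OF False] by simp
  thus ?thesis using cnj_chi[OF False, of j] by (metis mult_right_cancel mult_zero_right zero_neq_one)
qed auto

lemma gauss_neg: "[i + j = 0] (mod M) \<Longrightarrow> gauss i = chi j (- 1) * cnj (gauss j)"
proof -
  assume ij: "[i + j = 0] (mod M)"
  have "cnj (gauss j) = (\<Sum>x\<in>UNIV. chi i x * \<psi> (- 1 * x))"
    unfolding gauss_def using cnj_chi_neg[OF ij] by (simp add: psi_minus)
  also have "\<dots> = cnj (chi i (- 1)) * gauss i" by (rule gauss_twist) simp
  also have "cnj (chi i (- 1)) = chi j (- 1)" using cnj_chi_neg[OF ij] by simp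
  finally have "chi j (- 1) * cnj (gauss j) = (chi j (- 1) * chi j (- 1)) * gauss i" by simp
  thus ?thesis by (simp add: chi_mult[symmetric])
qed

text \<open>\<open>cnj (chi j y) * gauss j\<close> is a twisted Gauss sum, so the product becomes a
  double sum in which orthogonality of \<open>\<psi>\<close> leaves only \<open>x = 1\<close>. The
  term \<open>y = 0\<close> can be included because a nontrivial character sums to 0.\<close>

lemma gauss_norm: "\<not> M dvd j \<Longrightarrow> gauss j * cnj (gauss j) = of_nat q"
proof -
  assume j: "\<not> M dvd j"
  have "gauss j * cnj (gauss j) = (\<Sum>y\<in>UNIV. cnj (chi j y) * gauss j * \<psi> (- y))"
    by (subst (2) gauss_def) (simp add: sum_distrib_left psi_minus mult_ac)
  also have "\<dots> = (\<Sum>y\<in>UNIV. \<Sum>x\<in>UNIV. chi j x * \<psi> ((x - 1) * y))"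
  proof (intro sum.cong refl)
    fix y :: 'a
    show "cnj (chi j y) * gauss j * \<psi> (- y) = (\<Sum>x\<in>UNIV. chi j x * \<psi> ((x - 1) * y))"
    proof (cases "y = 0")
      case False
      have "cnj (chi j y) * gauss j * \<psi> (- y) = (\<Sum>x\<in>UNIV. chi j x * \<psi> (y * x)) * \<psi> (- y)"
        by (simp only: gauss_twist[OF False])
      also have "\<dots> = (\<Sum>x\<in>UNIV. chi j x * \<psi> ((x - 1) * y))"
        unfolding sum_distrib_right mult.assoc psi_add[symmetric] by (simp add: algebra_simps)
      finally show ?thesis .
    qed (use sum_chi[OF j] in simp)
  qed
  also have "\<dots> = (\<Sum>x\<in>UNIV. chi j x * (\<Sum>y\<in>UNIV. \<psi> ((x - 1) * y)))"
    unfolding sum_distrib_left by (rule sum.swap)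
  also have "\<dots> = (\<Sum>x\<in>(UNIV :: 'a set). if x = 1 then of_nat q else 0)"
    by (intro sum.cong refl) (simp add: sum_psi)
  also have "\<dots> = of_nat q" by simp
  finally show ?thesis .
qed

lemma gauss_nonzero: "\<not> M dvd j \<Longrightarrow> gauss j \<noteq> 0"
  using gauss_norm[of j] q_gt_1 by auto

section \<open>Jacobi sums\<close>

definition jacobi :: "nat \<Rightarrow> nat \<Rightarrow> complex" where
  "jacobi i j = (\<Sum>t\<in>UNIV. chi i t * chi j (1 - t))"

text \<open>Collect the terms with \<open>x + y = z\<close>. For nonzero \<open>z\<close> the
  scaling \<open>x = z * t\<close> produces the Jacobi sum; for \<open>z = 0\<close> the terms add
  up to a multiple of the full sum of \<open>chi (i + j)\<close>, which is 0 by hypothesis.\<close>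

lemma gauss_mult: "\<not> M dvd i + j \<Longrightarrow> gauss i * gauss j = jacobi i j * gauss (i + j)"
proof -
  assume ij: "\<not> M dvd i + j"
  have "gauss i * gauss j = (\<Sum>x\<in>UNIV. \<Sum>y\<in>UNIV. chi i x * chi j y * \<psi> (x + y))"
    unfolding gauss_def sum_product by (simp add: psi_add mult_ac)
  also have "\<dots> = (\<Sum>x\<in>UNIV. \<Sum>z\<in>UNIV. chi i x * chi j (z - x) * \<psi> z)"
  proof (rule sum.cong[OF refl])
    fix x :: 'a
    show "(\<Sum>y\<in>UNIV. chi i x * chi j y * \<psi> (x + y)) = (\<Sum>z\<in>UNIV. chi i x * chi j (z - x) * \<psi> z)"
      by (rule sum.reindex_bij_witness[of _ "\<lambda>z. z - x" "\<lambda>y. y + x"]) (auto simp: add.commute)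
  qed
  also have "\<dots> = (\<Sum>z\<in>UNIV. (\<Sum>x\<in>UNIV. chi i x * chi j (z - x)) * \<psi> z)"
    by (subst sum.swap) (simp add: sum_distrib_right)
  also have "\<dots> = (\<Sum>z\<in>UNIV. jacobi i j * chi (i + j) z * \<psi> z)"
  proof (intro sum.cong refl arg_cong2[of _ _ _ _ "(*)"])
    fix z :: 'a
    show "(\<Sum>x\<in>UNIV. chi i x * chi j (z - x)) = jacobi i j * chi (i + j) z"
    proof (cases "z = 0")
      case True
      have "chi i x * chi j (z - x) = chi j (- 1) * chi (i + j) x" for x
        using True chi_mult[of j "- 1" x] by (simp add: chi_add)
      hence "(\<Sum>x\<in>UNIV. chi i x * chi j (z - x)) = (\<Sum>x\<in>UNIV. chi j (- 1) * chi (i + j) x)"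
        by (simp only:)
      also have "\<dots> = 0" using sum_chi[OF ij] by (simp add: sum_distrib_left[symmetric])
      finally show ?thesis using True by simp
    next
      case False
      have "(\<Sum>x\<in>UNIV. chi i x * chi j (z - x)) = (\<Sum>t\<in>UNIV. chi i (z * t) * chi j (z - z * t))"
        by (rule sum.reindex_bij_witness[of _ "\<lambda>t. z * t" "\<lambda>x. x / z"]) (use False in auto)
      also have "\<dots> = (\<Sum>t\<in>UNIV. chi i (z * t) * chi j (z * (1 - t)))"
        by (simp add: right_diff_distrib)
      also have "\<dots> = jacobi i j * chi (i + j) z"
        unfolding jacobi_def sum_distrib_right
        by (intro sum.cong refl) (simp only: chi_mult chi_add mult_ac)
      finally show ?thesis .
    qed
  qed
  also have "\<dots> = jacobi i j * gauss (i + j)"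
    unfolding gauss_def by (simp add: sum_distrib_left mult.assoc)
  finally show ?thesis .
qed

text \<open>The sum of the characters of order dividing \<open>k\<close> is \<open>k\<close> times
  the indicator of the \<open>k\<close>-th powers, each of which has exactly \<open>k\<close>
  roots.\<close>

lemma sum_nonzero_power:
  fixes f :: "'a \<Rightarrow> complex"
  assumes "k dvd M"
  shows "(\<Sum>x\<in>UNIV - {0}. f (x ^ k)) = (\<Sum>x\<in>UNIV - {0}. (\<Sum>c<k. chi (c * (M div k)) x) * f x)"
proof -
  define L where "L = M div k"
  have Mk: "M = k * L" and k: "k > 0" using assms M_pos unfolding L_def by (auto intro: Nat.gr0I)
  have "(\<Sum>x\<in>UNIV - {0}. f (x ^ k)) = (\<Sum>i<k * L. f (g ^ (k * i)))"
    unfolding sum_nonzero Mk[symmetric] by (simp add: power_mult[symmetric] mult.commute)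
  also have "\<dots> = of_nat k * (\<Sum>i<L. f (g ^ (k * i)))"
  proof (rule sum_lessThan_periodic)
    fix i
    have "g ^ (k * (i + L)) = g ^ (k * i)"
      using fermat[OF g_nz] by (simp add: distrib_left power_add Mk[symmetric])
    thus "f (g ^ (k * (i + L))) = f (g ^ (k * i))" by simp
  qed
  also have "\<dots> = (\<Sum>i<L. of_nat k * f (g ^ (k * i)))" by (simp add: sum_distrib_left)
  also have "\<dots> = (\<Sum>i<k * L. if k dvd i then of_nat k * f (g ^ i) else 0)"
    by (rule sum_lessThan_multiples[OF k, symmetric])
  also have "\<dots> = (\<Sum>i<M. (\<Sum>c<k. chi (c * L) (g ^ i)) * f (g ^ i))"
    unfolding Mk[symmetric]
  proof (intro sum.cong refl)
    fix i
    have "(\<Sum>c<k. chi (c * L) (g ^ i)) = (\<Sum>c<k. (\<omega> ^ (L * i)) ^ c)"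
      by (simp add: chi_gen power_mult[symmetric] mult_ac)
    also have "\<dots> = (if k dvd i then of_nat k else 0)"
    proof -
      have "M dvd L * i \<longleftrightarrow> k dvd i" "M dvd L * i * k"
        using M_pos unfolding Mk by (auto simp: mult.commute[of k])
      hence "\<omega> ^ (L * i) = 1 \<longleftrightarrow> k dvd i" "(\<omega> ^ (L * i)) ^ k = 1"
        unfolding power_mult[symmetric] omega_eq_1_iff by blast+
      thus ?thesis by (simp add: sum_powers_root_of_unity)
    qed
    finally show "(if k dvd i then of_nat k * f (g ^ i) else 0) = (\<Sum>c<k. chi (c * L) (g ^ i)) * f (g ^ i)"
      by simp
  qed
  finally show ?thesis unfolding sum_nonzero L_def .
qed

end

section \<open>The duplication formula and characters of 2-power order\<close>

lemma cis_pi_4: "cis (pi / 4) = (1 + \<i>) / of_real (sqrt 2)"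
  by (simp add: complex_eq_iff cos_45 sin_45 Re_divide_of_real Im_divide_of_real real_div_sqrt field_simps)

lemma cis_pi_4_power:
  "cis (pi / 4) ^ 2 = \<i>" "cis (pi / 4) ^ 3 = \<i> * cis (pi / 4)" "cis (pi / 4) ^ 4 = - 1"
  "cis (pi / 4) ^ 8 = 1"
proof -
  show 2: "cis (pi / 4) ^ 2 = \<i>"
    by (simp add: Complex.DeMoivre complex_eq_iff)
  show "cis (pi / 4) ^ 3 = \<i> * cis (pi / 4)"
    using 2 by (simp add: power3_eq_cube power2_eq_square)
  show 4: "cis (pi / 4) ^ 4 = - 1"
    by (simp add: Complex.DeMoivre complex_eq_iff)
  show "cis (pi / 4) ^ 8 = 1"
    by (simp add: Complex.DeMoivre complex_eq_iff)
qed

lemma cis_pi_4_sum: "cis (pi / 4) + cis (pi / 4) ^ 3 = \<i> * of_real (sqrt 2)"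
proof -
  have "cis (pi / 4) + cis (pi / 4) ^ 3 = (1 + \<i>) * cis (pi / 4)"
    by (simp add: cis_pi_4_power algebra_simps)
  also have "\<dots> = 2 * \<i> / of_real (sqrt 2)"
    unfolding cis_pi_4 by (simp add: algebra_simps)
  also have "2 = of_real (sqrt 2) * (of_real (sqrt 2) :: complex)"
    by (simp flip: of_real_mult)
  finally show ?thesis by simp
qed

text \<open>\<open>oct_re\<close> and \<open>oct_im\<close> are the coordinates, in the basis
  \<open>1, sqrt (-2)\<close>, of the trace of the \<open>l\<close>-th power of a primitive eighth
  root of unity to the field of \<open>sqrt (-2)\<close>, which is fixed by cubing that root; see
  \<open>oct_sum\<close>.\<close>

definition oct_re :: "nat \<Rightarrow> int" where
  "oct_re l = (if l mod 8 = 0 then 2 else if l mod 8 = 4 then - 2 else 0)"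

definition oct_im :: "nat \<Rightarrow> int" where
  "oct_im l = (if l mod 8 = 1 \<or> l mod 8 = 3 then 1 else if l mod 8 = 5 \<or> l mod 8 = 7 then - 1 else 0)"

lemma oct_sum:
  "cis (pi / 4) ^ l + cis (pi / 4) ^ (3 * l)
    = of_int (oct_re l) + of_int (oct_im l) * (\<i> * of_real (sqrt 2))"
proof -
  let ?z = "cis (pi / 4)"
  have red: "?z ^ l + ?z ^ (3 * l) = ?z ^ (l mod 8) + (?z ^ (l mod 8)) ^ 3"
    using power_mod_exponent[OF cis_pi_4_power(4), of l]
    by (simp add: power_mult[symmetric] mult.commute)
  have z5: "?z ^ 5 = - ?z" "?z ^ 6 = - \<i>" "?z ^ 7 = - (?z ^ 3)"
    using power_add[of ?z 4 1] power_add[of ?z 4 2] power_add[of ?z 4 3]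
    by (simp_all add: cis_pi_4_power)
  have "?z ^ 9 = ?z" using power_add[of ?z 8 1] cis_pi_4_power(4) by simp
  hence e: "(?z ^ 3) ^ 3 = ?z" by (simp flip: power_mult)
  have e': "(- ?z) ^ 3 = - (?z ^ 3)" "(- (?z ^ 3)) ^ 3 = - ?z"
    using power_minus_odd[of 3 ?z] power_minus_odd[of 3 "?z ^ 3"] e by simp_all
  have s: "?z + ?z ^ 3 = \<i> * of_real (sqrt 2)" "?z ^ 3 + ?z = \<i> * of_real (sqrt 2)"
    "- ?z + - (?z ^ 3) = - (\<i> * of_real (sqrt 2))" "- (?z ^ 3) + - ?z = - (\<i> * of_real (sqrt 2))"
    using cis_pi_4_sum by (simp_all only: add.commute minus_add_distrib[symmetric])
  have "l mod 8 < 8" by simp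
  hence "l mod 8 \<in> {0, 1, 2, 3, 4, 5, 6, 7}" by auto
  thus ?thesis unfolding red oct_re_def oct_im_def
    apply (elim insertE emptyE)
    apply (simp_all only: z5 e e' s cis_pi_4_power(1,3) power_one_right)
    apply (simp_all add: power3_eq_cube)
    done
qed

section \<open>The quadratic character and the duplication formula\<close>

context finite_field_gauss
begin

lemma not_p_dvd_2: "\<not> p dvd 2"
  using odd_p prime_ge_2_nat[OF prime_p] dvd_imp_le[of p 2] by auto

lemma even_M: "even M" and h1: "2 * (M div 2) = M"
proof -
  have ne: "(-1::'a) \<noteq> 1"
  proof
    assume "(-1::'a) = 1"
    hence "of_nat 2 = (0::'a)" by (metis add_eq_0_iff of_nat_numeral one_add_one)
    hence "p dvd 2" using char_eq of_nat_eq_0_iff_char_dvd by metis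
    thus False using not_p_dvd_2 by blast
  qed
  have "(-1::'a) ^ M = 1" by (rule fermat) simp
  thus "even M" using ne by (metis neg_one_odd_power)
  thus "2 * (M div 2) = M" by simp
qed

lemma two_nonzero: "(2::'a) \<noteq> 0" "(4::'a) \<noteq> 0"
proof -
  show 2: "(2::'a) \<noteq> 0" using not_p_dvd_2 char_eq of_nat_eq_0_iff_char_dvd[of 2, where ?'a = 'a] by simp
  have "(4::'a) = 2 * 2" by simp
  thus "(4::'a) \<noteq> 0" using 2 by (metis mult_eq_0_iff)
qed

lemma gen_half: "g ^ (M div 2) = - 1"
proof -
  have "(g ^ (M div 2)) ^ 2 = 1" using h1 fermat[OF g_nz] by (metis mult.commute power_mult)
  moreover have "g ^ (M div 2) \<noteq> g ^ 0"
    unfolding gen_power_eq_iff using h1 M_pos by simp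
  ultimately show ?thesis by (simp add: power2_eq_1_iff)
qed

lemma omega_half: "\<omega> ^ (M div 2) = - 1"
proof -
  have "(\<omega> ^ (M div 2)) ^ 2 = 1" using h1 omega_M by (metis mult.commute power_mult)
  moreover have "\<omega> ^ (M div 2) \<noteq> 1"
    unfolding omega_eq_1_iff using h1 M_pos by (auto dest: dvd_imp_le)
  ultimately show ?thesis by (simp add: power2_eq_1_iff)
qed

lemma chi_minus_1: "chi j (- 1) = (- 1) ^ j"
  using chi_gen[of j "M div 2"] by (simp add: gen_half mult.commute[of j] power_mult omega_half)

abbreviation phi :: "'a \<Rightarrow> complex" where "phi \<equiv> chi (M div 2)"

lemma phi_gen: "phi (g ^ i) = (- 1) ^ i"
  by (simp add: chi_gen power_mult omega_half)

text \<open>An integral copy of the quadratic character, so that sums of its values can also be read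
  in the field, where \<open>euler_criterion\<close> evaluates it.\<close>

definition phi_int :: "'a \<Rightarrow> int" where
  "phi_int x = (if x = 0 then 0 else (- 1) ^ ind x)"

lemma phi_eq_int: "phi x = of_int (phi_int x)"
  using phi_gen[of "ind x"] by (cases "x = 0") (auto simp: phi_int_def gen_ind)

lemma euler_criterion: "of_int (phi_int x) = x ^ (M div 2)"
proof (cases "x = 0")
  case True
  have "M div 2 > 0" using h1 M_pos by (auto intro: Nat.gr0I)
  thus ?thesis using True by (simp add: phi_int_def)
next
  case False
  have "x ^ (M div 2) = (g ^ (M div 2)) ^ ind x"
    using gen_ind[OF False] by (metis mult.commute power_mult)
  thus ?thesis using False by (simp add: gen_half phi_int_def)
qed

lemma sum_square:
  fixes f :: "'a \<Rightarrow> complex"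
  shows "(\<Sum>x\<in>UNIV. f (x ^ 2)) = (\<Sum>x\<in>UNIV. (1 + phi x) * f x)"
proof -
  have "(\<Sum>x\<in>UNIV - {0}. f (x ^ 2)) = (\<Sum>x\<in>UNIV - {0}. (\<Sum>c<2. chi (c * (M div 2)) x) * f x)"
    using even_M by (rule sum_nonzero_power)
  also have "\<dots> = (\<Sum>x\<in>UNIV - {0}. (1 + phi x) * f x)"
    by (intro sum.cong refl) (simp add: numeral_2_eq_2 chi_zero)
  finally show ?thesis by (simp add: sum_split_0)
qed

text \<open>With \<open>t = (1 + v) / 2\<close> one has
  \<open>t * (1 - t) = (1 - v ^ 2) / 4\<close>, and \<open>1 + phi c\<close> counts the square roots
  \<open>v\<close> of \<open>c\<close>.\<close>

lemma jacobi_diagonal: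
  assumes "\<not> M dvd j"
  shows "jacobi j j = cnj (chi j 4) * jacobi (M div 2) j"
proof -
  have "jacobi j j = (\<Sum>v\<in>UNIV. chi j ((1 + v) / 2) * chi j (1 - (1 + v) / 2))"
    unfolding jacobi_def
    by (rule sum.reindex_bij_witness[of _ "\<lambda>v. (1 + v) / 2" "\<lambda>t. 2 * t - 1"])
       (use two_nonzero in \<open>auto simp: field_simps\<close>)
  also have "\<dots> = (\<Sum>v\<in>UNIV. chi j (inverse 4 * (1 - v ^ 2)))"
  proof (rule sum.cong[OF refl])
    fix v :: 'a
    have "1 - (1 + v) / 2 = (1 - v) / 2" using two_nonzero(1) by (simp add: field_simps)
    hence "(1 + v) / 2 * (1 - (1 + v) / 2) = ((1 + v) * (1 - v)) / (2 * 2)"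
      by (simp only: times_divide_times_eq)
    also have "(1 + v) * (1 - v) = 1 - v ^ 2" by (simp add: power2_eq_square algebra_simps)
    also have "(1 - v ^ 2) / (2 * 2) = inverse 4 * (1 - v ^ 2)"
      unfolding divide_inverse by (subst mult.commute) simp
    finally show "chi j ((1 + v) / 2) * chi j (1 - (1 + v) / 2) = chi j (inverse 4 * (1 - v ^ 2))"
      by (simp only: chi_mult[symmetric])
  qed
  also have "\<dots> = (\<Sum>c\<in>UNIV. (1 + phi c) * chi j (inverse 4 * (1 - c)))"
    by (rule sum_square)
  also have "\<dots> = cnj (chi j 4) * ((\<Sum>c\<in>UNIV. chi j (1 - c)) + jacobi (M div 2) j)"
    unfolding jacobi_def chi_mult cnj_chi_inverse
    by (simp only: distrib_left distrib_right mult_1 sum.distrib sum_distrib_left mult_ac)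
  also have "(\<Sum>c\<in>UNIV. chi j (1 - c)) = (\<Sum>c\<in>UNIV. chi j c)"
    by (rule sum.reindex_bij_witness[of _ "\<lambda>t. 1 - t" "\<lambda>t. 1 - t"]) auto
  also have "\<dots> = 0" using assms by (rule sum_chi)
  finally show ?thesis by simp
qed

text \<open>Express \<open>gauss j ^ 2\<close> by \<open>jacobi j j\<close>, trade this for
  \<open>jacobi (M div 2) j\<close> by \<open>jacobi_diagonal\<close>, turn the latter back into
  Gauss sums and cancel one \<open>gauss j\<close>.\<close>

lemma hasse_davenport_duplication:
  assumes "\<not> M dvd 2 * j"
  shows "gauss j * gauss (j + M div 2) = cnj (chi j 4) * gauss (2 * j) * gauss (M div 2)"
proof -
  have j: "\<not> M dvd j" using assms dvd_mult by blast
  have jh: "\<not> M dvd M div 2 + j"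
  proof
    assume "M dvd M div 2 + j"
    hence "M dvd 2 * (M div 2 + j)" by (rule dvd_mult)
    hence "M dvd M + 2 * j" unfolding distrib_left h1 .
    thus False using assms by simp
  qed
  have "gauss j * gauss j * gauss (M div 2 + j)
      = cnj (chi j 4) * gauss (2 * j) * (jacobi (M div 2) j * gauss (M div 2 + j))"
    using gauss_mult[of j j] assms jacobi_diagonal[OF j] by (simp add: mult_2)
  also have "jacobi (M div 2) j * gauss (M div 2 + j) = gauss (M div 2) * gauss j"
    using gauss_mult[OF jh] by simp
  finally show ?thesis using gauss_nonzero[OF j] by (simp add: add.commute)
qed

end

section \<open>Characters of 2-power order and their Gauss sums\<close>

locale octic_field = finite_field_gauss +
  fixes s m :: nat
  assumes p_mod_8: "p mod 8 = 3" and m_ge: "m \<ge> 3" and q_def: "q = p ^ s"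
    and dvd_M: "2 ^ m dvd M" and ndvd_M: "\<not> 2 ^ (m + 1) dvd M"
begin

text \<open>The character \<open>chi (h r)\<close> has exact order \<open>2 ^ r\<close> for \<open>r \<le> m\<close>.\<close>

definition h :: "nat \<Rightarrow> nat" where "h r = M div 2 ^ r"

lemma h_mult: "r \<le> m \<Longrightarrow> 2 ^ r * h r = M"
  unfolding h_def using dvd_M by (simp add: dvd_trans[OF le_imp_power_dvd])

lemma h_pos: "r \<le> m \<Longrightarrow> h r > 0"
  using h_mult[of r] M_pos by (auto intro: Nat.gr0I)

lemma h_add: "r + d \<le> m \<Longrightarrow> h r = 2 ^ d * h (r + d)"
proof -
  assume rd: "r + d \<le> m"
  have "2 ^ r * h r = 2 ^ r * (2 ^ d * h (r + d))"
    using h_mult[of r] h_mult[OF rd] rd by (simp add: power_add mult.assoc)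
  thus ?thesis by simp
qed

lemma h_Suc: "Suc r \<le> m \<Longrightarrow> h r = 2 * h (Suc r)"
  using h_add[of r 1] by simp

lemma M_div_2: "M div 2 = h 1"
  by (simp add: h_def)

lemma even_h_iff: "r \<le> m \<Longrightarrow> even (h r) \<longleftrightarrow> r < m"
proof -
  assume r: "r \<le> m"
  show ?thesis
  proof (cases "r < m")
    case True
    thus ?thesis using h_Suc[of r] by simp
  next
    case False
    hence "r = m" using r by simp
    moreover have "odd (h m)"
    proof
      assume "even (h m)"
      then obtain c where "h m = 2 * c" by blast
      hence "M = 2 ^ (m + 1) * c" using h_mult[of m] by simp
      thus False using ndvd_M by simp
    qed
    ultimately show ?thesis by simp
  qed
qed

text \<open>The value of \<open>chi (h r)\<close> at -1: \<open>h r\<close> is odd only for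
  \<open>r = m\<close>.\<close>

definition sgn_r :: "nat \<Rightarrow> complex" where "sgn_r r = (if r = m then - 1 else 1)"

lemma sgn_r_sq [simp]: "sgn_r r * sgn_r r = 1"
  by (simp add: sgn_r_def)

lemma chi_h_minus_1: "r \<le> m \<Longrightarrow> chi (h r) (- 1) = sgn_r r"
  using even_h_iff[of r] by (auto simp: chi_minus_1 sgn_r_def)

lemma omega_h: "r \<le> m \<Longrightarrow> \<omega> ^ h r = cis (2 * pi / 2 ^ r)"
proof -
  assume r: "r \<le> m"
  have "real M = 2 ^ r * real (h r)" using h_mult[OF r] by (metis of_nat_mult of_nat_numeral of_nat_power)
  thus ?thesis unfolding \<omega>_def Complex.DeMoivre using h_pos[OF r] by (simp add: field_simps)
qed

lemma omega_h3: "\<omega> ^ h 3 = cis (pi / 4)"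
  using omega_h[of 3] m_ge by simp

lemma not_M_dvd_h: "r \<le> m \<Longrightarrow> \<not> 2 ^ r dvd c \<Longrightarrow> \<not> M dvd c * h r"
proof
  assume r: "r \<le> m" and c: "\<not> 2 ^ r dvd c" and "M dvd c * h r"
  hence "2 ^ r * h r dvd c * h r" using h_mult[OF r] by simp
  thus False using h_pos[OF r] c by simp
qed

lemma h_cong: "r \<le> m \<Longrightarrow> [c = d] (mod 2 ^ r) \<Longrightarrow> [c * h r = d * h r] (mod M)"
proof -
  assume r: "r \<le> m" and cd: "[c = d] (mod 2 ^ r)"
  have "[c * h r = d * h r] (mod 2 ^ r * h r)"
    using cd unfolding cong_def by (simp add: mult_mod_left[symmetric] mult.commute)
  thus ?thesis using h_mult[OF r] by simp
qed

text \<open>The order of 4 divides \<open>(p - 1) / 2\<close>, which is odd because \<open>p\<close>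
  is 3 modulo 4, whereas the character takes values of 2-power order.\<close>

lemma chi_h_4: "r \<le> m \<Longrightarrow> chi (h r) 4 = 1"
proof -
  assume r: "r \<le> m"
  define e where "e = (p - 1) div 2"
  have p: "p = 2 * e + 1" using odd_p unfolding e_def by (auto elim!: oddE)
  have "odd e" using p_mod_8 unfolding p by presburger
  have "[2 ^ (p - 1) = 1] (mod p)" using prime_p not_p_dvd_2 by (rule fermat_theorem)
  hence "of_nat (2 ^ (p - 1)) = (of_nat 1 :: 'a)"
    unfolding of_nat_eq_iff_cong_CHAR char_eq .
  hence "(2::'a) ^ (2 * e) = 1" using p by simp
  hence "(4::'a) ^ e = 1" by (simp add: power_mult)
  moreover have "e > 0" using \<open>odd e\<close> by (auto intro: Nat.gr0I)
  ultimately have 1: "chi (h r) 4 ^ e = 1" using chi_power[of e "h r" 4] by simp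
  have "chi (h r) 4 ^ (2 ^ r) = chi M 4"
    using chi_times[OF two_nonzero(2), of "2 ^ r" "h r"] h_mult[OF r] by simp
  also have "\<dots> = 1" using chi_cong[of M 0 4] chi_zero[OF two_nonzero(2)] by (simp add: cong_def)
  finally have 2: "chi (h r) 4 ^ (2 ^ r) = 1" .
  have "coprime e (2 ^ r)" using \<open>odd e\<close> by simp
  then obtain a b where ab: "e * a = 2 ^ r * b + 1"
    using bezout_nat[of e "2 ^ r"] \<open>e > 0\<close> by auto
  have "chi (h r) 4 = chi (h r) 4 ^ (2 ^ r * b + 1)" using 2 by (simp add: power_mult)
  also have "\<dots> = 1" unfolding ab[symmetric] using 1 by (simp add: power_mult)
  finally show ?thesis .
qed

lemma gauss_h_13:
  assumes "3 \<le> r" "r \<le> m" "c mod 8 = 1 \<or> c mod 8 = 3"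
  shows "gauss (c * h r) = gauss (h r)"
proof -
  obtain k where "[c = p ^ k] (mod 2 ^ r)"
    using powers_cover_one_three_mod_8[OF p_mod_8 assms(3,1)] by blast
  hence "[c * h r = p ^ k * h r] (mod M)" using assms(2) by (intro h_cong)
  hence "gauss (c * h r) = gauss (h r * p ^ k)" by (simp add: gauss_cong mult.commute)
  thus ?thesis by (simp add: gauss_frob_power)
qed

lemma gauss_h_57:
  assumes "3 \<le> r" "r \<le> m" "c mod 8 = 5 \<or> c mod 8 = 7"
  shows "gauss (c * h r) = sgn_r r * cnj (gauss (h r))"
proof -
  \<comment> \<open>\<open>c'\<close> represents \<open>- c\<close> modulo \<open>2 ^ r\<close>; it
    lies in class 1 or 3 modulo 8, so \<open>gauss_h_13\<close> applies to it.\<close>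
  define c' where "c' = (2 ^ r - 1) * c"
  have "[c + c' = 0] (mod 2 ^ r)"
    unfolding c'_def by (simp add: cong_0_iff algebra_simps)
  hence "[c * h r + c' * h r = 0] (mod M)"
    using h_cong[OF assms(2), of "c + c'" 0] by (simp add: distrib_right)
  hence "gauss (c * h r) = chi (c' * h r) (- 1) * cnj (gauss (c' * h r))"
    by (rule gauss_neg)
  also have "gauss (c' * h r) = gauss (h r)"
  proof (rule gauss_h_13[OF assms(1,2)])
    obtain d where d: "(2::nat) ^ r = 8 * d"
      using le_imp_power_dvd[OF assms(1), of "2::nat"] by (auto simp: dvd_def)
    hence "d > 0" by (auto intro: Nat.gr0I)
    have "(2::nat) ^ r - 1 = 8 * (d - 1) + 7" using d \<open>d > 0\<close> by simp
    moreover have "(8 * (d - 1) + 7) mod 8 = 7" by simp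
    ultimately have "((2::nat) ^ r - 1) mod 8 = 7" by metis
    hence "c' mod 8 = (7 * (c mod 8)) mod 8" unfolding c'_def by (metis mod_mult_eq mod_mod_trivial)
    thus "c' mod 8 = 1 \<or> c' mod 8 = 3" using assms(3) by auto
  qed
  also have "chi (c' * h r) (- 1) = sgn_r r"
  proof -
    have "odd c" using assms(3) by presburger
    hence "odd c'" using assms(1) unfolding c'_def by simp
    hence "(sgn_r r) ^ c' = sgn_r r" by (simp add: sgn_r_def)
    thus ?thesis using chi_h_minus_1[OF assms(2)] chi_times[of "-1" c' "h r"] by simp
  qed
  finally show ?thesis .
qed

text \<open>Since \<open>1 < m\<close> the quadratic character is even and its Gauss sum real. The
  sign is settled in \<open>gauss_h1\<close>.\<close>

lemma gauss_h1_sq: "gauss (h 1) ^ 2 = of_nat q"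
proof -
  have m: "1 < m" "1 \<le> m" using m_ge by auto
  have "[h 1 + h 1 = 0] (mod M)" using h_mult[OF m(2)] by (simp add: mult_2 cong_0_iff)
  hence "gauss (h 1) = chi (h 1) (- 1) * cnj (gauss (h 1))" by (rule gauss_neg)
  hence c: "cnj (gauss (h 1)) = gauss (h 1)" using m by (simp add: chi_h_minus_1 sgn_r_def)
  have "\<not> M dvd 1 * h 1" by (rule not_M_dvd_h) (use m in auto)
  hence "gauss (h 1) * cnj (gauss (h 1)) = of_nat q" by (intro gauss_norm) simp
  thus ?thesis using c by (simp add: power2_eq_square)
qed

lemma gauss_h1_nonzero: "gauss (h 1) \<noteq> 0"
  using gauss_h1_sq q_gt_1 by auto

lemma gauss_h_norm: "1 \<le> r \<Longrightarrow> r \<le> m \<Longrightarrow> gauss (h r) * cnj (gauss (h r)) = of_nat q"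
  using not_M_dvd_h[of r 1] by (intro gauss_norm) simp

text \<open>Duplication for \<open>j = h r\<close>, where
  \<open>h r + M div 2 = (1 + 2 ^ (r - 1)) * h r\<close>; the character value at 4 drops out by
  \<open>chi_h_4\<close>.\<close>

lemma hasse_davenport_h:
  assumes "2 \<le> r" "r \<le> m"
  shows "gauss (h r) * gauss ((1 + 2 ^ (r - 1)) * h r) = gauss (h (r - 1)) * gauss (h 1)"
proof -
  have 1: "2 * h r = h (r - 1)" using h_Suc[of "r - 1"] assms by simp
  have 2: "h 1 = 2 ^ (r - 1) * h r" using h_add[of 1 "r - 1"] assms by simp
  have "\<not> M dvd 2 * h r"
  proof (rule not_M_dvd_h[OF assms(2)])
    have "(2::nat) ^ 2 \<le> 2 ^ r" using assms(1) by (intro power_increasing) auto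
    thus "\<not> 2 ^ r dvd (2::nat)" by (auto dest: dvd_imp_le)
  qed
  from hasse_davenport_duplication[OF this] show ?thesis
    using chi_h_4[OF assms(2)] unfolding M_div_2 1 distrib_right 2[symmetric] by simp
qed

text \<open>At \<open>r = 3\<close> the second index in \<open>hasse_davenport_h\<close> is 5, so
  the product there is a norm up to sign. It determines level 2 but not level 3, for which
  \<open>K\<close> is introduced.\<close>

lemma gauss_h2: "gauss (h 2) = sgn_r 3 * gauss (h 1)"
proof -
  have "gauss (h 3) * gauss (5 * h 3) = gauss (h 2) * gauss (h 1)"
    using hasse_davenport_h[of 3] m_ge by simp
  moreover have "gauss (5 * h 3) = sgn_r 3 * cnj (gauss (h 3))"
    using m_ge by (intro gauss_h_57) auto
  ultimately have "gauss (h 2) * gauss (h 1) = sgn_r 3 * (gauss (h 3) * cnj (gauss (h 3)))"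
    by (simp add: mult_ac)
  also have "\<dots> = sgn_r 3 * gauss (h 1) * gauss (h 1)"
    using gauss_h_norm[of 3] m_ge gauss_h1_sq by (simp add: power2_eq_square)
  finally show ?thesis using gauss_h1_nonzero by simp
qed

text \<open>For \<open>r >= 4\<close> the index \<open>1 + 2 ^ (r - 1)\<close> is 1 modulo 8, so the
  two Gauss sums on the left of \<open>hasse_davenport_h\<close> coincide.\<close>

lemma gauss_h_square:
  assumes "4 \<le> r" "r \<le> m"
  shows "gauss (h r) ^ 2 = gauss (h (r - 1)) * gauss (h 1)"
proof -
  have r: "3 \<le> r - 1" using assms(1) by simp
  obtain d where d: "(2::nat) ^ (r - 1) = 8 * d"
    using le_imp_power_dvd[of 3 "r - 1" "2::nat", OF r] by (auto simp: dvd_def)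
  have "gauss ((1 + 2 ^ (r - 1)) * h r) = gauss (h r)"
    using assms d by (intro gauss_h_13 disjI1) (simp_all only: d, simp_all)
  thus ?thesis using hasse_davenport_h[of r] assms by (simp add: power2_eq_square)
qed

text \<open>Chosen because \<open>h 3 + h 1 = 5 * h 3\<close>: the product character has Gauss sum
  \<open>cnj (gauss (h 3))\<close> up to sign, so that \<open>gauss_mult\<close> yields
  \<open>gauss (h 3) ^ 2\<close>.\<close>

definition K :: complex where "K = jacobi (h 3) (h 1)"

lemma gauss_h3_K: "gauss (h 3) * gauss (h 1) = K * sgn_r 3 * cnj (gauss (h 3))"
proof -
  have e: "h 3 + h 1 = 5 * h 3" using h_add[of 1 2] m_ge by (simp add: eval_nat_numeral)
  have "\<not> M dvd 5 * h 3" by (rule not_M_dvd_h) (use m_ge in auto)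
  hence "gauss (h 3) * gauss (h 1) = K * gauss (5 * h 3)"
    unfolding K_def e[symmetric] by (rule gauss_mult)
  also have "gauss (5 * h 3) = sgn_r 3 * cnj (gauss (h 3))"
    using m_ge by (intro gauss_h_57) auto
  finally show ?thesis by simp
qed

lemma gauss_h3_sq: "gauss (h 3) ^ 2 = sgn_r 3 * K * gauss (h 1)"
proof -
  have "gauss (h 3) * gauss (h 3) * gauss (h 1) = K * sgn_r 3 * (gauss (h 3) * cnj (gauss (h 3)))"
    using gauss_h3_K by (simp add: mult_ac)
  also have "\<dots> = sgn_r 3 * K * gauss (h 1) * gauss (h 1)"
    using gauss_h_norm[of 3] m_ge gauss_h1_sq by (simp add: power2_eq_square)
  finally show ?thesis using gauss_h1_nonzero by (simp add: power2_eq_square)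
qed

lemma K_norm: "K * cnj K = of_nat q"
proof -
  have "(gauss (h 3) * cnj (gauss (h 3))) * (gauss (h 1) * cnj (gauss (h 1)))
      = (K * cnj K) * (sgn_r 3 * cnj (sgn_r 3)) * (gauss (h 3) * cnj (gauss (h 3)))"
    using arg_cong2[OF gauss_h3_K arg_cong[OF gauss_h3_K, of cnj], of "(*)"] by (simp add: mult_ac)
  moreover have "sgn_r 3 * cnj (sgn_r 3) = 1" by (simp add: sgn_r_def)
  ultimately show ?thesis using gauss_h_norm[of 3] gauss_h_norm[of 1] m_ge q_gt_1 by simp
qed

end

section \<open>The octic Jacobi sum\<close>

lemma oct_re_even: "oct_re i = 2 * (oct_re i div 2)"
  by (simp add: oct_re_def)

context octic_field
begin

lemma p_cong_3: "[p = 3] (mod 8)"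
  using p_mod_8 by (simp add: cong_def)

lemma q_mod_8: "q mod 8 = 1"
proof -
  have "8 * h 3 = M" using h_mult[of 3] m_ge by simp
  hence "q = 8 * h 3 + 1" using q_eq by simp
  thus ?thesis by (simp add: mod_Suc)
qed

lemma p_odd_power_mod_8: "odd u \<Longrightarrow> p ^ u mod 8 = 3"
proof -
  assume "odd u"
  then obtain v where u: "u = 2 * v + 1" by (auto elim: oddE)
  have "[p ^ u = 3 ^ u] (mod 8)" using p_cong_3 by (rule cong_pow)
  also have "(3::nat) ^ u = 9 ^ v * 3" unfolding u by (simp add: power_mult)
  also have "[9 ^ v * 3 = 1 ^ v * (3::nat)] (mod 8)"
    by (intro cong_mult cong_pow) (auto simp: cong_def)
  finally show ?thesis by (simp add: cong_def)
qed

lemma even_s: "even s"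
  using p_odd_power_mod_8[of s] q_mod_8 q_def by auto

lemma of_nat_q: "of_nat q = (0::'a)"
proof -
  have "CHAR('a) dvd q" using card_eq CHAR_dvd_CARD[where ?'a = 'a] by simp
  thus ?thesis by (simp add: of_nat_eq_0_iff_char_dvd)
qed

lemma of_nat_h3_nonzero: "of_nat (h 3) \<noteq> (0::'a)"
proof
  assume 0: "of_nat (h 3) = (0::'a)"
  have "8 * h 3 = M" using h_mult[of 3] m_ge by simp
  hence "of_nat M = (0::'a)" using 0 by (metis mult_zero_right of_nat_mult)
  moreover have "of_nat q = of_nat M + (1::'a)" unfolding q_eq by simp
  ultimately show False using of_nat_q by simp
qed

lemma jacobi_frob: "jacobi (i * p) (j * p) = jacobi i j"
proof -
  have p0: "p > 0" using prime_gt_0_nat[OF prime_p] .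
  have "jacobi i j = (\<Sum>t\<in>UNIV. chi i (t ^ p) * chi j (1 - t ^ p))"
    unfolding jacobi_def by (rule sum.reindex_bij_betw[OF bij_frob, symmetric])
  also have "\<dots> = (\<Sum>t\<in>UNIV. chi i (t ^ p) * chi j ((1 - t) ^ p))"
  proof (rule sum.cong[OF refl])
    fix t :: 'a
    have "((1 - t) + t) ^ p = (1 - t) ^ p + t ^ p"
      by (rule freshmans_dream) (use prime_p char_eq in auto)
    hence "(1 - t) ^ p = 1 - t ^ p" by (simp add: algebra_simps)
    thus "chi i (t ^ p) * chi j (1 - t ^ p) = chi i (t ^ p) * chi j ((1 - t) ^ p)" by simp
  qed
  also have "\<dots> = jacobi (i * p) (j * p)"
    unfolding jacobi_def using p0 by (simp add: chi_times_eq_power)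
  finally show ?thesis by simp
qed

text \<open>All values of \<open>oct_re\<close> are even, hence the division. \<open>Kim\<close> is
  twice the coefficient of \<open>sqrt (-2)\<close> in \<open>K\<close>; that it is even follows
  only from the norm equation, in \<open>alpha_2\<close>.\<close>

definition Kre :: int where
  "Kre = (\<Sum>i<M. (oct_re i div 2) * phi_int (1 - g ^ i))"

definition Kim :: int where
  "Kim = (\<Sum>i<M. oct_im i * phi_int (1 - g ^ i))"

lemma K_eq_sum: "jacobi (c * h 3) (h 1) = (\<Sum>i<M. cis (pi / 4) ^ (c * i) * of_int (phi_int (1 - g ^ i)))"
proof -
  have "jacobi (c * h 3) (h 1) = (\<Sum>i<M. chi (c * h 3) (g ^ i) * chi (h 1) (1 - g ^ i))"
    unfolding jacobi_def sum_split_0[of "\<lambda>t. chi (c * h 3) t * chi (h 1) (1 - t)"] sum_nonzero by simp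
  also have "\<dots> = (\<Sum>i<M. cis (pi / 4) ^ (c * i) * of_int (phi_int (1 - g ^ i)))"
  proof (rule sum.cong[OF refl])
    fix i
    have "chi (c * h 3) (g ^ i) = cis (pi / 4) ^ (c * i)"
      unfolding chi_gen omega_h3[symmetric] power_mult[symmetric] by (simp add: mult_ac)
    thus "chi (c * h 3) (g ^ i) * chi (h 1) (1 - g ^ i) = cis (pi / 4) ^ (c * i) * of_int (phi_int (1 - g ^ i))"
      using phi_eq_int M_div_2 by simp
  qed
  finally show ?thesis .
qed

text \<open>As \<open>p\<close> is 3 modulo 8, Frobenius gives
  \<open>K = jacobi (3 * h 3) (h 1)\<close>. Averaging both expressions replaces the powers of the
  eighth root of unity by half their traces.\<close>

lemma K_form: "K = of_int Kre + of_int Kim / 2 * (\<i> * of_real (sqrt 2))"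
proof -
  have "K = jacobi (h 3 * p) (h 1 * p)" unfolding K_def jacobi_frob ..
  also have "\<dots> = jacobi (3 * h 3) (h 1)"
  proof -
    have "[p * h 3 = 3 * h 3] (mod M)" using p_cong_3 m_ge by (intro h_cong) auto
    moreover have "[p * h 1 = 1 * h 1] (mod M)"
      using odd_p m_ge by (intro h_cong) (auto simp: cong_def odd_iff_mod_2_eq_one)
    ultimately have "chi (h 3 * p) x = chi (3 * h 3) x" "chi (h 1 * p) x = chi (h 1) x" for x
      by (auto simp: mult.commute intro!: chi_cong)
    thus ?thesis unfolding jacobi_def by simp
  qed
  finally have "2 * K = jacobi (1 * h 3) (h 1) + jacobi (3 * h 3) (h 1)"
    by (simp add: K_def)
  also have "\<dots> = (\<Sum>i<M. (cis (pi / 4) ^ i + cis (pi / 4) ^ (3 * i)) * of_int (phi_int (1 - g ^ i)))"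
    unfolding K_eq_sum by (simp add: sum.distrib distrib_right)
  also have "\<dots> = (\<Sum>i<M. of_int (oct_re i * phi_int (1 - g ^ i))
      + of_int (oct_im i * phi_int (1 - g ^ i)) * (\<i> * of_real (sqrt 2)))"
    unfolding oct_sum by (intro sum.cong refl) (simp add: algebra_simps)
  also have "\<dots> = of_int (\<Sum>i<M. oct_re i * phi_int (1 - g ^ i)) + of_int Kim * (\<i> * of_real (sqrt 2))"
    unfolding sum.distrib sum_distrib_right[symmetric] Kim_def by (simp only: of_int_sum)
  also have "(\<Sum>i<M. oct_re i * phi_int (1 - g ^ i)) = 2 * Kre"
    unfolding Kre_def sum_distrib_left
    by (intro sum.cong refl) (subst oct_re_even, simp only: mult.assoc)
  finally show ?thesis by (simp add: field_simps)
qed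

text \<open>The powers \<open>g ^ (8 * a)\<close> run through the subgroup of order
  \<open>h 3\<close>, so summation over \<open>a\<close> kills every binomial term whose exponent is
  not a multiple of \<open>h 3\<close>.\<close>

lemma sum_power_h3:
  fixes b :: 'a
  shows "(\<Sum>a<h 3. (1 - b * g ^ (8 * a)) ^ (4 * h 3))
    = of_nat (h 3) * (\<Sum>t<5. of_nat ((4 * h 3) choose (h 3 * t)) * (- b) ^ (h 3 * t))"
proof -
  let ?h = "h 3"
  have hp: "?h > 0" using h_pos m_ge by simp
  have M8: "8 * ?h = M" using h_mult[of 3] m_ge by simp
  \<comment> \<open>Vanishing coefficients extend the range to \<open>5 * h 3\<close>, the form that
    \<open>sum_lessThan_multiples\<close> requires.\<close>
  have bin: "(1 - y) ^ (4 * ?h) = (\<Sum>j<?h * 5. of_nat ((4 * ?h) choose j) * (- y) ^ j)" for y :: 'a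
  proof -
    have "(1 - y) ^ (4 * ?h) = ((- y) + 1) ^ (4 * ?h)" by simp
    also have "\<dots> = (\<Sum>j\<le>4 * ?h. of_nat ((4 * ?h) choose j) * (- y) ^ j)"
      by (subst binomial_ring) simp
    also have "\<dots> = (\<Sum>j<?h * 5. of_nat ((4 * ?h) choose j) * (- y) ^ j)"
      using hp by (intro sum.mono_neutral_left) (auto simp: binomial_eq_0)
    finally show ?thesis .
  qed
  have geo: "(\<Sum>a<?h. (g ^ (8 * a)) ^ j) = (if ?h dvd j then of_nat ?h else (0::'a))" for j
  proof -
    have "(\<Sum>a<?h. (g ^ (8 * a)) ^ j) = (\<Sum>a<?h. (g ^ (8 * j)) ^ a)"
      by (simp add: power_mult[symmetric] mult_ac)
    also have "\<dots> = (if ?h dvd j then of_nat ?h else 0)"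
    proof -
      have "g ^ (8 * j) = g ^ 0 \<longleftrightarrow> 8 * ?h dvd 8 * j"
        unfolding gen_power_eq_iff M8 by (simp add: mod_eq_0_iff_dvd)
      hence iff: "g ^ (8 * j) = 1 \<longleftrightarrow> ?h dvd j" by simp
      have "(g ^ (8 * j)) ^ ?h = (g ^ (8 * ?h)) ^ j"
        by (simp only: power_mult[symmetric] mult_ac)
      also have "\<dots> = 1" unfolding M8 using fermat[OF g_nz] by simp
      finally show ?thesis using iff by (auto simp: geometric_sum)
    qed
    finally show ?thesis .
  qed
  have "(\<Sum>a<?h. (1 - b * g ^ (8 * a)) ^ (4 * ?h))
      = (\<Sum>a<?h. \<Sum>j<?h * 5. of_nat ((4 * ?h) choose j) * (- b) ^ j * (g ^ (8 * a)) ^ j)"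
    unfolding bin by (simp add: power_mult_distrib[symmetric] mult.assoc)
  also have "\<dots> = (\<Sum>j<?h * 5. of_nat ((4 * ?h) choose j) * (- b) ^ j * (\<Sum>a<?h. (g ^ (8 * a)) ^ j))"
    by (subst sum.swap) (simp only: sum_distrib_left)
  also have "\<dots> = (\<Sum>j<?h * 5. if ?h dvd j then of_nat ?h * (of_nat ((4 * ?h) choose j) * (- b) ^ j) else 0)"
    unfolding geo by (intro sum.cong refl) simp
  also have "\<dots> = (\<Sum>t<5. of_nat ?h * (of_nat ((4 * ?h) choose (?h * t)) * (- b) ^ (?h * t)))"
    by (rule sum_lessThan_multiples[OF hp])
  finally show ?thesis by (simp add: sum_distrib_left)
qed

text \<open>By Euler's criterion \<open>Kre\<close> is, modulo \<open>p\<close>, a power sum over the field, in which only the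
  binomial coefficients at the multiples of \<open>h 3\<close> survive.\<close>

lemma p_not_dvd_Kre: "\<not> int p dvd Kre"
proof -
  let ?h = "h 3"
  have M8: "M = ?h * 8" using h_mult[of 3] m_ge by simp
  have M2: "M div 2 = 4 * ?h" using M8 by simp
  let ?f = "\<lambda>i. of_int (oct_re i div 2) * (1 - g ^ i) ^ (4 * ?h)"
  have "of_int Kre = (\<Sum>i<M. of_int (oct_re i div 2) * of_int (phi_int (1 - g ^ i)) :: 'a)"
    unfolding Kre_def by simp
  also have "\<dots> = (\<Sum>i<?h * 8. ?f i)"
    unfolding euler_criterion M2 M8[symmetric] ..
  also have "\<dots> = (\<Sum>a<?h. \<Sum>i<8. ?f (i + a * 8))"
    by (rule sum_lessThan_mult_split)
  \<comment> \<open>In each block of eight exponents only the residues 0 and 4 have nonzero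
    \<open>oct_re\<close>, with weights 1 and -1. The factor 1 is written out to match
    \<open>sum_power_h3\<close>.\<close>
  also have "\<dots> = (\<Sum>a<?h. (1 - 1 * g ^ (8 * a)) ^ (4 * ?h) - (1 - g ^ 4 * g ^ (8 * a)) ^ (4 * ?h))"
  proof (rule sum.cong[OF refl])
    fix a
    have "oct_re (i + a * 8) = oct_re i" for i by (simp add: oct_re_def)
    moreover have "{..<8} = {0, 1, 2, 3, 4, 5, 6, 7 :: nat}" by auto
    ultimately show "(\<Sum>i<8. ?f (i + a * 8)) = (1 - 1 * g ^ (8 * a)) ^ (4 * ?h) - (1 - g ^ 4 * g ^ (8 * a)) ^ (4 * ?h)"
      by (simp add: oct_re_def power_add mult.commute)
  qed
  also have "\<dots> = of_nat ?h * (\<Sum>t<5. of_nat ((4 * ?h) choose (?h * t)) * ((- 1) ^ (?h * t) - (- (g ^ 4)) ^ (?h * t)))"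
    unfolding sum_subtractf sum_power_h3 by (simp add: right_diff_distrib sum_subtractf)
  also have "\<dots> = of_nat ?h * (\<Sum>t<5. of_nat ((4 * ?h) choose (?h * t)) * ((- 1) ^ (?h * t) * (1 - (- 1) ^ t)))"
  proof -
    have "(- (g ^ 4)) ^ (?h * t) = (- 1) ^ (?h * t) * (- 1) ^ t" for t
    proof -
      have "(- (g ^ 4)) ^ (?h * t) = (- 1 * g ^ 4) ^ (?h * t)" by simp
      also have "\<dots> = (- 1) ^ (?h * t) * (g ^ (4 * ?h)) ^ t"
        unfolding power_mult_distrib by (simp add: power_mult)
      also have "g ^ (4 * ?h) = - 1" using gen_half M2 by simp
      finally show ?thesis .
    qed
    thus ?thesis by (simp add: right_diff_distrib)
  qed
  \<comment> \<open>Only \<open>t = 1\<close> and \<open>t = 3\<close> survive, each with a factor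
    2, and their binomial coefficients agree by symmetry.\<close>
  also have "\<dots> = of_nat ?h * (4 * (- 1) ^ ?h * of_nat ((4 * ?h) choose ?h))"
  proof -
    have "(4 * ?h) choose (?h * 3) = (4 * ?h) choose ?h"
      using binomial_symmetric[of "?h * 3" "4 * ?h"] by simp
    moreover have "(- 1 :: 'a) ^ (?h * 3) = (- 1) ^ ?h" by (simp add: power_mult power3_eq_cube flip: power_mult_distrib)
    moreover have "{..<5} = {0, 1, 2, 3, 4 :: nat}" by auto
    ultimately show ?thesis by (simp add: algebra_simps)
  qed
  finally have eq: "of_int Kre = of_nat ?h * (4 * (- 1) ^ ?h * of_nat ((4 * ?h) choose ?h) :: 'a)" .
  have "\<not> p dvd (4 * ?h) choose ?h"
  proof -
    obtain v where "s = 2 * v" using even_s by blast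
    hence "?h = (p ^ (2 * v) - 1) div 8" using h_def[of 3] M_def q_def by simp
    thus ?thesis using not_dvd_choose_quarter[OF prime_p p_mod_8] by simp
  qed
  hence "of_nat ((4 * ?h) choose ?h) \<noteq> (0::'a)"
    using char_eq of_nat_eq_0_iff_char_dvd by metis
  hence "of_int Kre \<noteq> (0::'a)" unfolding eq using of_nat_h3_nonzero two_nonzero by simp
  thus ?thesis
    by (metis char_eq dvd_def mult_zero_left of_int_mult of_int_of_nat_eq of_nat_CHAR)
qed

end

section \<open>Decomposition of the exponential sums\<close>

lemma sum_lessThan_double:
  fixes f :: "nat \<Rightarrow> 'b::comm_monoid_add"
  shows "(\<Sum>c<2 * n. f c) = (\<Sum>c<n. f (2 * c)) + (\<Sum>c<n. f (2 * c + 1))"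
proof -
  have "(\<Sum>c<2 * n. f c) = (\<Sum>c<n. \<Sum>i<2. f (i + c * 2))"
    using sum_lessThan_mult_split[of f n 2] by (simp add: mult.commute)
  thus ?thesis by (simp add: numeral_2_eq_2 sum.distrib mult.commute)
qed

context octic_field
begin

definition S :: "nat \<Rightarrow> 'a \<Rightarrow> complex" where
  "S k a = (\<Sum>x\<in>UNIV. \<psi> (a * x ^ (2 ^ k)))"

text \<open>\<open>T r\<close> is the contribution of the characters of exact order \<open>2 ^ r\<close> to \<open>S r\<close>.\<close>

definition T :: "nat \<Rightarrow> 'a \<Rightarrow> complex" where
  "T r a = S r a - S (r - 1) a"

lemma S_0: "a \<noteq> 0 \<Longrightarrow> S 0 a = 0"
  using sum_psi[of a] by (simp add: S_def)

lemma S_eq_sum_T: "a \<noteq> 0 \<Longrightarrow> S k a = (\<Sum>r=1..k. T r a)"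
  by (induction k) (auto simp: S_0 T_def)

lemma S_expand:
  assumes "k \<le> m" "a \<noteq> 0"
  shows "S k a = 1 + (\<Sum>c<2 ^ k. cnj (chi (c * h k) a) * gauss (c * h k))"
proof -
  have "S k a = 1 + (\<Sum>x\<in>UNIV - {0}. \<psi> (a * x ^ (2 ^ k)))"
    unfolding S_def sum_split_0[of "\<lambda>x. \<psi> (a * x ^ 2 ^ k)"] by (simp add: zero_power)
  also have "(\<Sum>x\<in>UNIV - {0}. \<psi> (a * x ^ (2 ^ k)))
      = (\<Sum>x\<in>UNIV - {0}. (\<Sum>c<2 ^ k. chi (c * (M div 2 ^ k)) x) * \<psi> (a * x))"
    using h_mult[OF assms(1)] by (intro sum_nonzero_power[of "2 ^ k" "\<lambda>y. \<psi> (a * y)"]) (metis dvd_triv_left)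
  also have "\<dots> = (\<Sum>c<2 ^ k. \<Sum>x\<in>UNIV - {0}. chi (c * h k) x * \<psi> (a * x))"
    unfolding sum_distrib_right h_def by (rule sum.swap)
  also have "\<dots> = (\<Sum>c<2 ^ k. cnj (chi (c * h k) a) * gauss (c * h k))"
  proof (rule sum.cong[OF refl])
    fix c
    show "(\<Sum>x\<in>UNIV - {0}. chi (c * h k) x * \<psi> (a * x)) = cnj (chi (c * h k) a) * gauss (c * h k)"
      unfolding gauss_twist[OF assms(2), symmetric]
      using sum_split_0[of "\<lambda>x. chi (c * h k) x * \<psi> (a * x)"] by simp
  qed
  finally show ?thesis .
qed

text \<open>Even indices at level \<open>r\<close> give the characters of level
  \<open>r - 1\<close>, so the difference keeps the odd ones.\<close>

lemma T_expand:
  assumes "1 \<le> r" "r \<le> m" "a \<noteq> 0"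
  shows "T r a = (\<Sum>c<2 ^ (r - 1). cnj (chi ((2 * c + 1) * h r) a) * gauss ((2 * c + 1) * h r))"
proof -
  have r: "(2::nat) ^ r = 2 * 2 ^ (r - 1)" using assms(1) by (cases r) auto
  have e: "2 * c * h r = c * h (r - 1)" for c
    using h_Suc[of "r - 1"] assms by simp
  have r1: "r - 1 \<le> m" using assms by simp
  show ?thesis
    unfolding T_def S_expand[OF assms(2,3)] S_expand[OF r1 assms(3)] r sum_lessThan_double e
    by simp
qed

definition \<theta> :: "nat \<Rightarrow> complex" where "\<theta> r = cnj (\<omega> ^ h r)"

lemma T_gen:
  assumes "1 \<le> r" "r \<le> m"
  shows "T r (g ^ l) = (\<Sum>c<2 ^ (r - 1). \<theta> r ^ ((2 * c + 1) * l) * gauss ((2 * c + 1) * h r))"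
proof -
  have "cnj (chi (d * h r) (g ^ l)) = \<theta> r ^ (d * l)" for d
    by (simp add: chi_gen \<theta>_def power_mult[symmetric] mult_ac flip: complex_cnj_power)
  moreover have "T r (g ^ l) = (\<Sum>c<2 ^ (r - 1). cnj (chi ((2 * c + 1) * h r) (g ^ l)) * gauss ((2 * c + 1) * h r))"
    by (rule T_expand[OF assms]) (use g_nz in simp)
  ultimately show ?thesis by (simp only:)
qed

lemma theta_eq: "r \<le> m \<Longrightarrow> \<theta> r = cnj (cis (2 * pi / 2 ^ r))"
  by (simp add: \<theta>_def omega_h)

lemma T_1: "T 1 (g ^ l) = (- 1) ^ l * gauss (h 1)"
  using T_gen[of 1 l] m_ge theta_eq[of 1] by (simp add: cis_pi)

lemma theta_2: "\<theta> 2 = - \<i>"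
  using theta_eq[of 2] m_ge by (simp add: complex_eq_iff)

lemma T_2: "T 2 (g ^ l) = of_int (if l mod 4 = 0 then 2 else if l mod 4 = 2 then - 2 else 0) * gauss (h 2)"
proof -
  have "[3 * h 2 = p * h 2] (mod M)"
  proof (rule h_cong)
    show "[3 = p] (mod 2 ^ 2)" using p_mod_8 by (simp add: cong_def) presburger
  qed (use m_ge in simp)
  hence g3: "gauss (3 * h 2) = gauss (h 2)" using gauss_cong gauss_frob[of "h 2"] by (simp add: mult.commute)
  have "T 2 (g ^ l) = ((- \<i>) ^ l + (- \<i>) ^ (3 * l)) * gauss (h 2)"
  proof -
    have sum2: "(\<Sum>c<2 ^ (2 - 1). F c) = F 0 + F 1" for F :: "nat \<Rightarrow> complex"
      by (simp add: numeral_2_eq_2)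
    have "T 2 (g ^ l) = (\<Sum>c<2 ^ (2 - 1). \<theta> 2 ^ ((2 * c + 1) * l) * gauss ((2 * c + 1) * h 2))"
      by (rule T_gen) (use m_ge in auto)
    also have "\<dots> = \<theta> 2 ^ ((2 * 0 + 1) * l) * gauss ((2 * 0 + 1) * h 2)
        + \<theta> 2 ^ ((2 * 1 + 1) * l) * gauss ((2 * 1 + 1) * h 2)"
      by (rule sum2)
    finally show ?thesis using g3 by (simp add: theta_2 distrib_right)
  qed
  also have "(- \<i>) ^ l + (- \<i>) ^ (3 * l) = (- \<i>) ^ (l mod 4) + ((- \<i>) ^ (l mod 4)) ^ 3"
    using power_mod_exponent[of "- \<i>" 4 l] by (simp add: power_mult[symmetric] mult.commute)
  also have "\<dots> = of_int (if l mod 4 = 0 then 2 else if l mod 4 = 2 then - 2 else 0)"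
  proof -
    have "l mod 4 < 4" by simp
    hence "l mod 4 \<in> {0, 1, 2, 3}" by auto
    thus ?thesis by (elim insertE emptyE) (simp_all add: power3_eq_cube power2_eq_square)
  qed
  finally show ?thesis .
qed

definition Gs :: "nat \<Rightarrow> complex" where "Gs r = sgn_r r * cnj (gauss (h r))"

text \<open>Odd indices are taken in blocks of four, namely 1, 3, 5, 7 modulo 8. The Gauss sum
  depends only on the class modulo 8, so the block number \<open>b\<close> leaves just a geometric
  factor.\<close>

lemma T_ge_3:
  assumes "3 \<le> r" "r \<le> m"
  shows "T r (g ^ l) = (\<Sum>b<2 ^ (r - 3). (\<theta> r ^ (8 * l)) ^ b) *
    (gauss (h r) * (\<theta> r ^ l + \<theta> r ^ (3 * l)) + Gs r * (\<theta> r ^ (5 * l) + \<theta> r ^ (7 * l)))"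
proof -
  have "r - 1 = (r - 3) + 2" using assms by simp
  hence r: "(2::nat) ^ (r - 1) = 2 ^ (r - 3) * 4" by (metis power_add power2_eq_square mult_2 numeral_Bit0)
  have "T r (g ^ l) = (\<Sum>b<2 ^ (r - 3). \<Sum>j<4.
      \<theta> r ^ ((2 * (j + b * 4) + 1) * l) * gauss ((2 * (j + b * 4) + 1) * h r))"
    using T_gen[of r l] assms unfolding r by (simp add: sum_lessThan_mult_split)
  also have "\<dots> = (\<Sum>b<2 ^ (r - 3). (\<theta> r ^ (8 * l)) ^ b *
    (gauss (h r) * (\<theta> r ^ l + \<theta> r ^ (3 * l)) + Gs r * (\<theta> r ^ (5 * l) + \<theta> r ^ (7 * l))))"
  proof (rule sum.cong[OF refl])
    fix b
    have pw: "\<theta> r ^ ((2 * (j + b * 4) + 1) * l) = (\<theta> r ^ (8 * l)) ^ b * \<theta> r ^ ((2 * j + 1) * l)" for j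
      by (simp add: power_mult[symmetric] power_add[symmetric] algebra_simps)
    have g13: "gauss ((2 * (j + b * 4) + 1) * h r) = gauss (h r)" if "j = 0 \<or> j = 1" for j
    proof (rule gauss_h_13[OF assms])
      have "(2 * (j + b * 4) + 1) mod 8 = (2 * j + 1 + 8 * b) mod 8" by (simp add: algebra_simps)
      also have "\<dots> = (2 * j + 1) mod 8" by (rule mod_mult_self2)
      finally show "(2 * (j + b * 4) + 1) mod 8 = 1 \<or> (2 * (j + b * 4) + 1) mod 8 = 3" using that by auto
    qed
    have g57: "gauss ((2 * (j + b * 4) + 1) * h r) = Gs r" if "j = 2 \<or> j = 3" for j
      unfolding Gs_def
    proof (rule gauss_h_57[OF assms])
      have "(2 * (j + b * 4) + 1) mod 8 = (2 * j + 1 + 8 * b) mod 8" by (simp add: algebra_simps)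
      also have "\<dots> = (2 * j + 1) mod 8" by (rule mod_mult_self2)
      finally show "(2 * (j + b * 4) + 1) mod 8 = 5 \<or> (2 * (j + b * 4) + 1) mod 8 = 7" using that by auto
    qed
    have sum4: "(\<Sum>j<4. F j) = F 0 + (F 1 + (F 2 + F 3))" for F :: "nat \<Rightarrow> complex"
      by (simp add: eval_nat_numeral add.assoc)
    have "(\<Sum>j<4. \<theta> r ^ ((2 * (j + b * 4) + 1) * l) * gauss ((2 * (j + b * 4) + 1) * h r))
      = \<theta> r ^ ((2 * (0 + b * 4) + 1) * l) * gauss ((2 * (0 + b * 4) + 1) * h r)
       + (\<theta> r ^ ((2 * (1 + b * 4) + 1) * l) * gauss ((2 * (1 + b * 4) + 1) * h r)
       + (\<theta> r ^ ((2 * (2 + b * 4) + 1) * l) * gauss ((2 * (2 + b * 4) + 1) * h r)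
       + \<theta> r ^ ((2 * (3 + b * 4) + 1) * l) * gauss ((2 * (3 + b * 4) + 1) * h r)))"
      by (rule sum4)
    also have "\<dots> = (\<theta> r ^ (8 * l)) ^ b * \<theta> r ^ ((2 * 0 + 1) * l) * gauss (h r)
       + ((\<theta> r ^ (8 * l)) ^ b * \<theta> r ^ ((2 * 1 + 1) * l) * gauss (h r)
       + ((\<theta> r ^ (8 * l)) ^ b * \<theta> r ^ ((2 * 2 + 1) * l) * Gs r
       + (\<theta> r ^ (8 * l)) ^ b * \<theta> r ^ ((2 * 3 + 1) * l) * Gs r))"
      unfolding pw by (subst g13, simp, subst g13, simp, subst g57, simp, subst g57, simp, rule refl)
    also have "\<dots> = (\<theta> r ^ (8 * l)) ^ b *
      (gauss (h r) * (\<theta> r ^ l + \<theta> r ^ (3 * l)) + Gs r * (\<theta> r ^ (5 * l) + \<theta> r ^ (7 * l)))"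
    proof -
      have "(2 * 0 + 1) * l = l" "(2 * 1 + 1) * l = 3 * l" "(2 * 2 + 1) * l = 5 * l" "(2 * 3 + 1) * l = 7 * l"
        by simp_all
      thus ?thesis by (simp only: distrib_left mult_ac add_ac)
    qed
    finally show "(\<Sum>j<4. \<theta> r ^ ((2 * (j + b * 4) + 1) * l) * gauss ((2 * (j + b * 4) + 1) * h r)) = \<dots>" .
  qed
  finally show ?thesis by (simp only: sum_distrib_right)
qed

lemma theta_power_eq_1_iff: "r \<le> m \<Longrightarrow> \<theta> r ^ k = 1 \<longleftrightarrow> 2 ^ r dvd k"
proof -
  assume r: "r \<le> m"
  have "\<theta> r ^ k = 1 \<longleftrightarrow> cnj (\<theta> r ^ k) = cnj 1" by (simp only: complex_cnj_cancel_iff)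
  also have "\<dots> \<longleftrightarrow> cis (2 * pi / real (2 ^ r)) ^ k = 1" using theta_eq[OF r] by simp
  also have "\<dots> \<longleftrightarrow> 2 ^ r dvd k" by (rule cis_root_power_eq_1_iff) simp
  finally show ?thesis .
qed

text \<open>The geometric factor of \<open>T_ge_3\<close> is a full sum over powers of a
  \<open>2 ^ (r - 3)\<close>-th root of unity other than 1.\<close>

lemma T_eq_0:
  assumes "3 \<le> r" "r \<le> m" "\<not> 2 ^ (r - 3) dvd l"
  shows "T r (g ^ l) = 0"
proof -
  have r: "(2::nat) ^ r = 8 * 2 ^ (r - 3)" using assms(1) power_add[of "2::nat" 3 "r - 3"] by simp
  have "\<theta> r ^ (8 * l) \<noteq> 1" unfolding theta_power_eq_1_iff[OF assms(2)] r using assms(3) by simp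
  moreover have "(\<theta> r ^ (8 * l)) ^ (2 ^ (r - 3)) = 1"
    unfolding power_mult[symmetric] theta_power_eq_1_iff[OF assms(2)] r by (simp add: mult_ac)
  ultimately show ?thesis unfolding T_ge_3[OF assms(1,2)] by (simp add: sum_powers_root_of_unity)
qed

text \<open>\<open>\<theta> r ^ (2 ^ (r - 3))\<close> is a primitive eighth root of unity; the
  classes 1, 3 and 5, 7 give the two conjugate traces of \<open>oct_sum\<close>, and the geometric
  factor is \<open>2 ^ (r - 3)\<close>.\<close>

lemma T_value:
  assumes "3 \<le> r" "r \<le> m"
  shows "T r (g ^ (2 ^ (r - 3) * l)) = 2 ^ (r - 3) * ((gauss (h r) + Gs r) * of_int (oct_re l)
      - (gauss (h r) - Gs r) * of_int (oct_im l) * (\<i> * of_real (sqrt 2)))"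
proof -
  have r: "(2::nat) ^ r = 8 * 2 ^ (r - 3)" using assms(1) power_add[of "2::nat" 3 "r - 3"] by simp
  define z where "z = cis (pi / 4)"
  have "h 3 = 2 ^ (r - 3) * h r" using h_add[of 3 "r - 3"] assms by simp
  hence th: "\<theta> r ^ (2 ^ (r - 3)) = cnj z"
    unfolding \<theta>_def z_def omega_h3[symmetric] by (simp add: power_mult mult.commute flip: complex_cnj_power)
  have thl: "\<theta> r ^ (c * (2 ^ (r - 3) * l)) = cnj z ^ (c * l)" for c
    unfolding th[symmetric] power_mult[symmetric] by (simp add: mult_ac)
  have one: "\<theta> r ^ (8 * (2 ^ (r - 3) * l)) = 1"
    unfolding theta_power_eq_1_iff[OF assms(2)] r by simp
  have s13: "cnj z ^ (1 * l) + cnj z ^ (3 * l)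
      = of_int (oct_re l) - of_int (oct_im l) * (\<i> * of_real (sqrt 2))"
    using arg_cong[OF oct_sum[of l], of cnj] unfolding z_def by simp
  have "cnj z * z = 1" unfolding z_def by (simp add: cis_cnj cis_mult)
  moreover have "cnj z ^ 8 = 1"
    unfolding z_def using cis_pi_4_power(4) by (metis complex_cnj_one complex_cnj_power)
  ultimately have z57: "cnj z ^ 5 = z ^ 3" "cnj z ^ 7 = z"
  proof -
    assume a: "cnj z * z = 1" "cnj z ^ 8 = 1"
    have "cnj z ^ 5 = cnj z ^ 5 * (cnj z * z) ^ 3" using a by simp
    also have "\<dots> = cnj z ^ 8 * z ^ 3" unfolding power_mult_distrib mult.assoc[symmetric] power_add[symmetric] by simp
    finally show "cnj z ^ 5 = z ^ 3" using a by simp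
    have "cnj z ^ 7 = cnj z ^ 7 * (cnj z * z)" using a by simp
    also have "\<dots> = cnj z ^ 8 * z" by (simp add: eval_nat_numeral mult_ac)
    finally show "cnj z ^ 7 = z" using a by simp
  qed
  have s57: "cnj z ^ (5 * l) + cnj z ^ (7 * l)
      = of_int (oct_re l) + of_int (oct_im l) * (\<i> * of_real (sqrt 2))"
    using oct_sum[of l] unfolding z_def[symmetric] power_mult z57 by (simp add: add.commute)
  show ?thesis
    unfolding T_ge_3[OF assms] one thl[of 5] thl[of 7] thl[of 3] thl[of 1, simplified] s57 s13[simplified]
    by (simp add: algebra_simps)
qed

text \<open>Passing from \<open>S (r - 1)\<close> to \<open>S r\<close> replaces the variable by a
  square, counted with weight \<open>1 + phi\<close>. This ties \<open>T r\<close> to powers of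
  exponent \<open>2 ^ (r - 1)\<close>, where integrality is available even for
  \<open>r = m\<close>.\<close>

lemma T_quadratic:
  assumes "1 \<le> r"
  shows "T r a = (\<Sum>y\<in>UNIV. phi y * \<psi> (a * y ^ (2 ^ (r - 1))))"
proof -
  have r: "(2::nat) ^ r = 2 * 2 ^ (r - 1)" using assms by (cases r) auto
  have "S r a = (\<Sum>x\<in>UNIV. \<psi> (a * (x ^ 2) ^ (2 ^ (r - 1))))"
    unfolding S_def r by (simp add: power_mult)
  also have "\<dots> = (\<Sum>y\<in>UNIV. (1 + phi y) * \<psi> (a * y ^ (2 ^ (r - 1))))"
    by (rule sum_square)
  finally show ?thesis unfolding T_def S_def by (simp add: distrib_right sum.distrib)
qed

end

section \<open>Integrality of the Gauss periods\<close>

lemma two_power_odd_decomp: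
  fixes n :: nat
  assumes "n > 0"
  shows "\<exists>k u. odd u \<and> n = 2 ^ k * u"
  using assms
proof (induction n rule: less_induct)
  case (less n)
  show ?case
  proof (cases "odd n")
    case True
    hence "odd n \<and> n = 2 ^ 0 * n" by simp
    thus ?thesis by blast
  next
    case False
    then obtain c where c: "n = 2 * c" by blast
    then obtain k u where "odd u" "c = 2 ^ k * u" using less.IH[of c] less.prems by auto
    hence "odd u \<and> n = 2 ^ Suc k * u" using c by simp
    thus ?thesis by blast
  qed
qed

context octic_field
begin

lemma sum_prime_subfield:
  fixes F :: "'a \<Rightarrow> complex"
  assumes "\<gamma> ^ (p - 1) = 1" "inj_on (\<lambda>v. \<gamma> ^ v) {..<p - 1}"
  shows "(\<Sum>v<p - 1. F (\<gamma> ^ v)) = (\<Sum>t\<in>{1..<p}. F (of_nat t))"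
proof -
  have p1: "p > 1" using prime_p prime_gt_1_nat by blast
  have g0: "\<gamma> \<noteq> 0" using assms(1) p1 by (auto simp: zero_power)
  have inj: "inj_on (of_nat :: nat \<Rightarrow> 'a) {1..<p}"
    by (rule inj_onI) (use char_eq in \<open>auto simp: of_nat_eq_iff_cong_CHAR cong_def\<close>)
  have sub: "(\<lambda>v. \<gamma> ^ v) ` {..<p - 1} \<subseteq> of_nat ` {1..<p}"
  proof
    fix x assume "x \<in> (\<lambda>v. \<gamma> ^ v) ` {..<p - 1}"
    then obtain v where x: "x = \<gamma> ^ v" by blast
    have "\<gamma> ^ p = \<gamma>" using assms(1) p1 by (metis mult_1 power_minus_mult prime_gt_0_nat prime_p)
    hence "x ^ p = x" unfolding x by (metis mult.commute power_mult)
    then obtain k where k: "k < p" "x = of_nat k" using prime_subfield_of_nat[OF prime_p char_eq] by blast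
    have "k \<noteq> 0" using k x g0 by (auto intro: Nat.gr0I)
    thus "x \<in> of_nat ` {1..<p}" using k by auto
  qed
  have eq: "(\<lambda>v. \<gamma> ^ v) ` {..<p - 1} = of_nat ` {1..<p}"
    by (rule card_subset_eq[OF _ sub]) (simp, unfold card_image[OF inj] card_image[OF assms(2)], simp)
  have "(\<Sum>v<p - 1. F (\<gamma> ^ v)) = (\<Sum>x\<in>(\<lambda>v. \<gamma> ^ v) ` {..<p - 1}. F x)"
    by (simp only: sum.reindex[OF assms(2)] o_def)
  also have "\<dots> = (\<Sum>t\<in>{1..<p}. F (of_nat t))"
    unfolding eq by (simp only: sum.reindex[OF inj] o_def)
  finally show ?thesis .
qed

lemma sum_psi_prime_subfield:
  "(\<Sum>t\<in>{1..<p}. \<psi> (y * of_nat t)) = of_int (if \<psi> y = 1 then int p - 1 else - 1)"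
proof -
  have p0: "p > 0" using prime_gt_0_nat[OF prime_p] .
  have "(\<Sum>t\<in>{1..<p}. \<psi> (y * of_nat t)) = (\<Sum>t\<in>{1..<p}. \<psi> y ^ t)"
    by (rule sum.cong[OF refl]) (metis psi_of_nat mult.commute)
  also have "\<dots> = (\<Sum>t<p. \<psi> y ^ t) - 1"
    using p0 by (simp add: atLeast0LessThan[symmetric] sum.atLeast_Suc_lessThan)
  also have "\<dots> = of_int (if \<psi> y = 1 then int p - 1 else - 1)"
    by (simp add: sum_powers_root_of_unity[OF psi_p])
  finally show ?thesis .
qed

text \<open>For \<open>k < m\<close> the prime field consists of \<open>2 ^ k\<close>-th powers, so the orbits of its unit group
  make the Gauss period a rational integer.\<close>

lemma S_integral:
  assumes k: "k < m"
  shows "\<exists>n::int. S k b = 1 + 2 ^ k * of_int n"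
proof -
  define e where "e = (p - 1) div 2"
  have p: "p = 2 * e + 1" using odd_p unfolding e_def by (auto elim!: oddE)
  have "odd e" using p_mod_8 unfolding p by presburger
  have "p - 1 dvd M"
  proof -
    have "[p = 1] (mod p - 1)"
      using prime_gt_0_nat[OF prime_p] by (simp add: cong_altdef_nat)
    hence "[p ^ s = 1 ^ s] (mod p - 1)" by (rule cong_pow)
    hence "p - 1 dvd p ^ s - 1" unfolding power_one by (rule cong_to_1_nat)
    thus ?thesis using q_def M_def by simp
  qed
  hence "e dvd M" using p by auto
  \<comment> \<open>Here \<open>k < m\<close> enters: the odd number \<open>e\<close> divides
    \<open>h (Suc k)\<close>, and the further factor 2 of \<open>h k\<close> completes
    \<open>p - 1 = 2 * e\<close>.\<close>
  hence "e dvd 2 ^ (Suc k) * h (Suc k)" using h_mult[of "Suc k"] k by simp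
  moreover have "coprime e (2 ^ Suc k)" using \<open>odd e\<close> by simp
  ultimately have "e dvd h (Suc k)" by (simp only: coprime_dvd_mult_right_iff)
  then obtain c where "h (Suc k) = e * c" by blast
  hence hk: "h k = (p - 1) * c" using h_Suc[of k] k p by simp
  have Mk: "M = 2 ^ k * ((p - 1) * c)" using h_mult[of k] k hk by simp
  \<comment> \<open>A \<open>2 ^ k\<close>-th power of order \<open>p - 1\<close>, hence a generator
    of the units of the prime field.\<close>
  define \<gamma> where "\<gamma> = g ^ (2 ^ k * c)"
  have cp: "c > 0" using M_pos Mk by (auto intro: Nat.gr0I)
  have g1: "\<gamma> ^ (p - 1) = 1"
    unfolding \<gamma>_def using fermat[OF g_nz] Mk by (simp add: power_mult[symmetric] mult_ac)
  have ginj: "inj_on (\<lambda>v. \<gamma> ^ v) {..<p - 1}"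
  proof (rule inj_onI)
    fix v w assume vw: "v \<in> {..<p - 1}" "w \<in> {..<p - 1}" "\<gamma> ^ v = \<gamma> ^ w"
    have lt: "2 ^ k * c * i < M" if "i < p - 1" for i
      unfolding Mk using that cp by simp
    have "(2 ^ k * c * v) mod M = (2 ^ k * c * w) mod M"
      using vw(3) unfolding \<gamma>_def power_mult[symmetric] gen_power_eq_iff .
    hence "2 ^ k * c * v = 2 ^ k * c * w" using lt vw(1,2) by simp
    thus "v = w" using cp by simp
  qed
  define y where "y i = b * g ^ (2 ^ k * i)" for i
  have "S k b = 1 + (\<Sum>i<M. \<psi> (b * g ^ (2 ^ k * i)))"
    unfolding S_def sum_split_0[of "\<lambda>x. \<psi> (b * x ^ 2 ^ k)"] sum_nonzero
    by (simp add: zero_power power_mult[symmetric] mult.commute)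
  also have "(\<Sum>i<M. \<psi> (b * g ^ (2 ^ k * i))) = (\<Sum>i<2 ^ k * h k. \<psi> (y i))"
    using h_mult[of k] k by (simp add: y_def)
  also have "\<dots> = of_nat (2 ^ k) * (\<Sum>i<h k. \<psi> (y i))"
  proof (rule sum_lessThan_periodic)
    fix i
    have "g ^ (2 ^ k * (i + h k)) = g ^ (2 ^ k * i)"
      using h_mult[of k] k fermat[OF g_nz] by (simp add: distrib_left power_add)
    thus "\<psi> (y (i + h k)) = \<psi> (y i)" by (simp add: y_def)
  qed
  also have "(\<Sum>i<h k. \<psi> (y i)) = (\<Sum>v<p - 1. \<Sum>i<c. \<psi> (y (i + v * c)))"
    unfolding hk by (rule sum_lessThan_mult_split)
  also have "\<dots> = (\<Sum>i<c. \<Sum>v<p - 1. \<psi> (y (i + v * c)))" by (rule sum.swap)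
  also have "\<dots> = (\<Sum>i<c. of_int (if \<psi> (y i) = 1 then int p - 1 else - 1))"
  proof (rule sum.cong[OF refl])
    fix i
    have "y (i + v * c) = y i * \<gamma> ^ v" for v
      by (simp add: y_def \<gamma>_def power_mult[symmetric] power_add[symmetric] algebra_simps)
    hence "(\<Sum>v<p - 1. \<psi> (y (i + v * c))) = (\<Sum>v<p - 1. \<psi> (y i * \<gamma> ^ v))" by simp
    also have "\<dots> = (\<Sum>t\<in>{1..<p}. \<psi> (y i * of_nat t))"
      by (rule sum_prime_subfield[OF g1 ginj, of "\<lambda>x. \<psi> (y i * x)"])
    finally show "(\<Sum>v<p - 1. \<psi> (y (i + v * c))) = of_int (if \<psi> (y i) = 1 then int p - 1 else - 1)"
      unfolding sum_psi_prime_subfield .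
  qed
  finally have "S k b = 1 + 2 ^ k * of_int (\<Sum>i<c. if \<psi> (y i) = 1 then int p - 1 else - 1)"
    by (simp only: of_int_sum of_nat_power of_nat_numeral)
  thus ?thesis by blast
qed

text \<open>Expand the norm by \<open>T_quadratic\<close> and put \<open>y = z * w\<close>: the sum
  over \<open>z\<close> becomes a value of \<open>S k\<close> minus 1 with \<open>k = r - 1\<close>,
  a multiple of \<open>2 ^ k\<close>, and the sum over \<open>w\<close> supplies a second
  \<open>2 ^ k\<close>. The norm is used because \<open>S_integral\<close> does not reach
  \<open>S m\<close>, while the case \<open>r = m\<close> is needed.\<close>

lemma T_norm_integral:
  assumes r: "1 \<le> r" "r \<le> m"
  shows "\<exists>n::int. T r a * cnj (T r a) = 4 ^ (r - 1) * of_int n"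
proof -
  define k where "k = r - 1"
  have k: "k < m" using r unfolding k_def by simp
  obtain nn :: "'a \<Rightarrow> int" where nn: "\<And>b. S k b = 1 + 2 ^ k * of_int (nn b)"
    using S_integral[OF k] by metis
  have Tn: "T r a = (\<Sum>y\<in>UNIV - {0}. phi y * \<psi> (a * y ^ (2 ^ k)))"
    unfolding T_quadratic[OF r(1)] k_def
    using sum_split_0[of "\<lambda>y. phi y * \<psi> (a * y ^ (2 ^ (r - 1)))"] by simp
  have "T r a * cnj (T r a) = (\<Sum>z\<in>UNIV - {0}. \<Sum>y\<in>UNIV - {0}. phi y * phi z * \<psi> (a * (y ^ (2 ^ k) - z ^ (2 ^ k))))"
  proof -
    have "cnj (phi z * \<psi> (a * z ^ (2 ^ k))) = phi z * \<psi> (- (a * z ^ (2 ^ k)))" for z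
      by (simp add: phi_eq_int psi_minus)
    hence "cnj (T r a) = (\<Sum>z\<in>UNIV - {0}. phi z * \<psi> (- (a * z ^ (2 ^ k))))"
      unfolding Tn by (simp only: cnj_sum)
    hence "T r a * cnj (T r a) = (\<Sum>z\<in>UNIV - {0}. phi z * \<psi> (- (a * z ^ (2 ^ k)))) * (\<Sum>y\<in>UNIV - {0}. phi y * \<psi> (a * y ^ (2 ^ k)))"
      using Tn by (simp add: mult.commute)
    also have "\<dots> = (\<Sum>z\<in>UNIV - {0}. \<Sum>y\<in>UNIV - {0}. phi y * phi z * \<psi> (a * (y ^ (2 ^ k) - z ^ (2 ^ k))))"
      unfolding sum_product
    proof (intro sum.cong refl)
      fix z y :: 'a
      have "\<psi> (a * (y ^ (2 ^ k) - z ^ (2 ^ k))) = \<psi> (a * y ^ (2 ^ k)) * \<psi> (- (a * z ^ (2 ^ k)))"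
        by (simp add: psi_add[symmetric] right_diff_distrib)
      thus "phi z * \<psi> (- (a * z ^ 2 ^ k)) * (phi y * \<psi> (a * y ^ 2 ^ k)) =
         phi y * phi z * \<psi> (a * (y ^ 2 ^ k - z ^ 2 ^ k))" by (simp add: mult_ac)
    qed
    finally show ?thesis .
  qed
  also have "\<dots> = (\<Sum>z\<in>UNIV - {0}. \<Sum>w\<in>UNIV - {0}. phi w * \<psi> ((a * (w ^ (2 ^ k) - 1)) * z ^ (2 ^ k)))"
  proof (rule sum.cong[OF refl])
    fix z :: 'a assume z: "z \<in> UNIV - {0}"
    have "(\<Sum>y\<in>UNIV - {0}. phi y * phi z * \<psi> (a * (y ^ (2 ^ k) - z ^ (2 ^ k))))
       = (\<Sum>w\<in>UNIV - {0}. phi (z * w) * phi z * \<psi> (a * ((z * w) ^ (2 ^ k) - z ^ (2 ^ k))))"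
      by (rule sum.reindex_bij_witness[of _ "\<lambda>w. z * w" "\<lambda>y. y / z"]) (use z in auto)
    also have "\<dots> = (\<Sum>w\<in>UNIV - {0}. phi w * \<psi> ((a * (w ^ (2 ^ k) - 1)) * z ^ (2 ^ k)))"
    proof (intro sum.cong refl)
      fix w :: 'a
      have "phi z * phi z = 1" using z cnj_chi[of z "M div 2"] by (simp add: phi_eq_int)
      hence "phi (z * w) * phi z = phi w" unfolding chi_mult by (metis mult.commute mult.left_commute mult_1_right)
      moreover have "a * ((z * w) ^ (2 ^ k) - z ^ (2 ^ k)) = (a * (w ^ (2 ^ k) - 1)) * z ^ (2 ^ k)"
        by (simp add: power_mult_distrib algebra_simps)
      ultimately show "phi (z * w) * phi z * \<psi> (a * ((z * w) ^ 2 ^ k - z ^ 2 ^ k)) =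
         phi w * \<psi> (a * (w ^ 2 ^ k - 1) * z ^ 2 ^ k)" by (simp only:)
    qed
    finally show "(\<Sum>y\<in>UNIV - {0}. phi y * phi z * \<psi> (a * (y ^ (2 ^ k) - z ^ (2 ^ k)))) = \<dots>" .
  qed
  also have "\<dots> = (\<Sum>w\<in>UNIV - {0}. phi w * (S k (a * (w ^ (2 ^ k) - 1)) - 1))"
  proof (subst sum.swap, rule sum.cong[OF refl])
    fix w :: 'a
    show "(\<Sum>z\<in>UNIV - {0}. phi w * \<psi> ((a * (w ^ (2 ^ k) - 1)) * z ^ (2 ^ k))) = phi w * (S k (a * (w ^ (2 ^ k) - 1)) - 1)"
      unfolding S_def sum_distrib_left[symmetric]
      using sum_split_0[of "\<lambda>z. \<psi> ((a * (w ^ (2 ^ k) - 1)) * z ^ (2 ^ k))"] by (simp add: zero_power)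
  qed
  also have "\<dots> = 2 ^ k * of_int (\<Sum>i<M. (- 1) ^ i * nn (a * (g ^ (i * 2 ^ k) - 1)))"
    unfolding sum_nonzero nn
    by (simp add: phi_gen sum_distrib_left power_mult mult_ac)
  \<comment> \<open>The second factor \<open>2 ^ k\<close>: the summand has period
    \<open>h k\<close>, its sign included because \<open>h k\<close> is even for
    \<open>k < m\<close>.\<close>
  also have "(\<Sum>i<M. (- 1) ^ i * nn (a * (g ^ (i * 2 ^ k) - 1))) =
     of_nat (2 ^ k) * (\<Sum>i<h k. (- 1) ^ i * nn (a * (g ^ (i * 2 ^ k) - 1)))"
  proof -
    have "(\<Sum>i<2 ^ k * h k. (- 1) ^ i * nn (a * (g ^ (i * 2 ^ k) - 1))) =
     of_nat (2 ^ k) * (\<Sum>i<h k. (- 1) ^ i * nn (a * (g ^ (i * 2 ^ k) - 1)))"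
    proof (rule sum_lessThan_periodic)
      fix i
      have "g ^ ((i + h k) * 2 ^ k) = g ^ (i * 2 ^ k) * g ^ (2 ^ k * h k)"
        by (simp add: power_add[symmetric] algebra_simps)
      hence "g ^ ((i + h k) * 2 ^ k) = g ^ (i * 2 ^ k)" using h_mult[of k] k fermat[OF g_nz] by simp
      moreover have "even (h k)" using even_h_iff[of k] k by simp
      ultimately show "(- 1) ^ (i + h k) * nn (a * (g ^ ((i + h k) * 2 ^ k) - 1)) = (- 1) ^ i * nn (a * (g ^ (i * 2 ^ k) - 1))"
        by (simp add: power_add)
    qed
    thus ?thesis using h_mult[of k] k by simp
  qed
  finally have "T r a * cnj (T r a) = 2 ^ k * (2 ^ k * of_int (\<Sum>i<h k. (- 1) ^ i * nn (a * (g ^ (i * 2 ^ k) - 1))))"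
    by (simp only: of_int_mult of_int_of_nat_eq of_nat_power of_nat_numeral of_int_power of_int_numeral)
  also have "\<dots> = 4 ^ (r - 1) * of_int (\<Sum>i<h k. (- 1) ^ i * nn (a * (g ^ (i * 2 ^ k) - 1)))"
    unfolding k_def[symmetric] by (simp add: power_mult_distrib[symmetric] mult.assoc[symmetric])
  finally show ?thesis by blast
qed

text \<open>With \<open>s = 2 ^ (m - 2) * u\<close> and \<open>u\<close> odd this is
  \<open>p ^ u\<close>; the form of level \<open>r\<close> represents
  \<open>P ^ (2 ^ (m - r))\<close>.\<close>

definition P :: nat where "P = p ^ (s div 2 ^ (m - 2))"

text \<open>For \<open>s = 2 ^ k * u\<close> with \<open>u\<close> odd,
  \<open>power_two_power_minus_one\<close> applied to \<open>p ^ u\<close> shows that exactly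
  \<open>2 ^ (k + 2)\<close> divides \<open>q - 1\<close>, so \<open>m = k + 2\<close>.\<close>

lemma s_decomp: "\<exists>u. odd u \<and> s = 2 ^ (m - 2) * u"
proof -
  have "s > 0" using q_gt_1 q_def by (auto intro: Nat.gr0I)
  then obtain k u where ku: "odd u" "s = 2 ^ k * u" using two_power_odd_decomp by blast
  have k1: "k \<ge> 1" using even_s ku by (cases k) auto
  have "p ^ u mod 8 = 3" using ku(1) by (rule p_odd_power_mod_8)
  then obtain c where c: "odd c" "(p ^ u) ^ (2 ^ k) = 1 + 2 ^ (k + 2) * c"
    using power_two_power_minus_one[OF _ k1] by blast
  have M: "M = 2 ^ (k + 2) * c"
    using c(2) q_def M_def ku(2) by (simp add: power_mult[symmetric] mult.commute)
  have "m = k + 2"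
  proof (rule linorder_cases[of m "k + 2"])
    assume "m < k + 2"
    hence "2 ^ (m + 1) dvd (2::nat) ^ (k + 2)" by (intro le_imp_power_dvd) simp
    hence "2 ^ (m + 1) dvd M" unfolding M by (rule dvd_mult2)
    thus ?thesis using ndvd_M by simp
  next
    assume "m > k + 2"
    hence "2 ^ (k + 2 + 1) dvd (2::nat) ^ m" by (intro le_imp_power_dvd) simp
    hence "2 ^ (k + 2 + 1) dvd M" using dvd_M dvd_trans by blast
    hence "2 ^ (k + 2) * 2 dvd 2 ^ (k + 2) * c" unfolding M by (simp only: power_add power_one_right)
    hence "2 dvd c" by (simp only: nat_mult_dvd_cancel_disj) simp
    thus ?thesis using c(1) by simp
  qed
  thus ?thesis using ku by auto
qed

lemma P_decomp: obtains u where "odd u" "s = 2 ^ (m - 2) * u" "P = p ^ u"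
  using s_decomp unfolding P_def by fastforce

lemma P_mod_8: "P mod 8 = 3"
proof -
  obtain u where "odd u" "P = p ^ u" using P_decomp by blast
  thus ?thesis by (simp add: p_odd_power_mod_8)
qed

lemma q_eq_P: "q = P ^ (2 ^ (m - 2))"
  using P_decomp q_def by (metis mult.commute power_mult)

lemma P_pow_mod_8: "j \<ge> 1 \<Longrightarrow> P ^ (2 ^ j) mod 8 = 1"
proof -
  assume "j \<ge> 1"
  then obtain c where "P ^ (2 ^ j) = 1 + 2 ^ (j + 2) * c" "j + 2 = (j - 1) + 3"
    using power_two_power_minus_one[OF P_mod_8] by auto
  hence "P ^ (2 ^ j) = 1 + 8 * (2 ^ (j - 1) * c)" by (simp only: power_add) simp
  thus ?thesis by (simp add: mod_Suc)
qed

text \<open>The value of \<open>S 2\<close> at 1 is \<open>(1 + 2 * sgn_r 3) * gauss (h 1)\<close>,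
  and by \<open>S_integral\<close> it is 1 modulo 4. As \<open>sqrt q\<close> is an odd integer,
  only one sign is possible.\<close>

lemma gauss_h1: "gauss (h 1) = - sgn_r 3 * of_real (sqrt (real q))"
proof -
  define R where "R = P ^ (2 ^ (m - 3))"
  have "m - 2 = Suc (m - 3)" using m_ge by simp
  hence qR: "q = R ^ 2" unfolding q_eq_P R_def by (simp add: power_mult[symmetric] mult.commute)
  hence sq: "sqrt (real q) = real R" by simp
  have "gauss (h 1) ^ 2 = (of_nat R) ^ 2" using gauss_h1_sq qR by simp
  hence "\<exists>\<delta>::int. \<delta>\<^sup>2 = 1 \<and> gauss (h 1) = of_int (\<delta> * int R)"
    unfolding power2_eq_iff by (elim disjE) (auto intro: exI[of _ 1] exI[of _ "-1"])
  then obtain \<delta> :: int where d: "\<delta>\<^sup>2 = 1" "gauss (h 1) = of_int (\<delta> * int R)" by blast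
  obtain n :: int where n: "S 2 (g ^ 0) = 1 + 2 ^ 2 * of_int n" using S_integral[of 2 "g ^ 0"] m_ge by auto
  have "S 2 (g ^ 0) = T 1 (g ^ 0) + T 2 (g ^ 0)"
    by (subst S_eq_sum_T) (simp_all add: numeral_2_eq_2)
  also have "\<dots> = gauss (h 1) + 2 * gauss (h 2)" unfolding T_1 T_2 by simp
  also have "\<dots> = (1 + 2 * sgn_r 3) * gauss (h 1)" unfolding gauss_h2 by (simp add: algebra_simps)
  finally have e: "(1 + 2 * sgn_r 3) * of_int (\<delta> * int R) = 1 + 4 * of_int n" using n d by simp
  \<comment> \<open>\<open>1 + 2 * \<sigma>\<close> is -1 or 3, and \<open>R\<close> is 3 modulo 4
    if \<open>m = 3\<close> and 1 otherwise; both cases give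
    \<open>\<delta> = - \<sigma>\<close>.\<close>
  define \<sigma> :: int where "\<sigma> = (if m = 3 then - 1 else 1)"
  have sg: "sgn_r 3 = of_int \<sigma>" by (simp add: sgn_r_def \<sigma>_def)
  have "of_int ((1 + 2 * \<sigma>) * (\<delta> * int R)) = (of_int (1 + 4 * n) :: complex)"
    using e unfolding sg by simp
  hence e': "(1 + 2 * \<sigma>) * (\<delta> * int R) = 1 + 4 * n" by (simp only: of_int_eq_iff)
  have "\<delta> = - \<sigma>"
  proof (cases "m = 3")
    case True
    have "R mod 4 = 3" using P_mod_8 True unfolding R_def by simp presburger
    hence "int R mod 4 = 3" by (metis of_nat_mod of_nat_numeral)
    moreover have "\<delta> = 1 \<or> \<delta> = - 1" using d(1) by (simp add: power2_eq_1_iff)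
    moreover have "\<delta> * int R = - (1 + 4 * n)" using e' True by (simp add: \<sigma>_def)
    moreover have "int R \<noteq> 1 + 4 * n" using \<open>int R mod 4 = 3\<close> by presburger
    ultimately show ?thesis using True by (auto simp: \<sigma>_def)
  next
    case False
    have "R mod 8 = 1" unfolding R_def using m_ge False by (intro P_pow_mod_8) simp
    hence "R mod 4 = 1" by presburger
    hence "int R mod 4 = 1" by (metis of_nat_mod of_nat_numeral of_nat_1)
    moreover have "\<delta> = 1 \<or> \<delta> = - 1" using d(1) by (simp add: power2_eq_1_iff)
    moreover have "3 * (\<delta> * int R) = 1 + 4 * n" using e' False by (simp add: \<sigma>_def)
    moreover have "3 * int R \<noteq> 1 + 4 * n" using \<open>int R mod 4 = 1\<close> by presburger
    ultimately show ?thesis using False by (auto simp: \<sigma>_def)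
  qed
  thus ?thesis using d(2) sq sg by simp
qed

end

section \<open>The ladder of square roots\<close>

lemma powr_square:
  fixes x :: real
  shows "(x powr a) ^ 2 = x powr (2 * a)"
  by (simp add: power2_eq_square powr_add[symmetric])

context octic_field
begin

text \<open>Chosen so that \<open>gauss (h r) / E r\<close> has norm
  \<open>q powr (1 / 2 ^ (r - 2))\<close>, the number represented by the form of level
  \<open>r\<close>. \<open>E_Suc\<close> parallels the recursion of the Gauss sums.\<close>

definition E :: "nat \<Rightarrow> real" where
  "E r = real q powr ((2 ^ (r - 2) - 1) / 2 ^ (r - 1))"

lemma E_pos: "E r > 0"
  unfolding E_def using q_gt_1 by simp

lemma E_2: "E 2 = 1"
  unfolding E_def using q_gt_1 by simp

lemma E_Suc: "r \<ge> 2 \<Longrightarrow> E (Suc r) ^ 2 = E r * sqrt (real q)"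
proof -
  assume r: "r \<ge> 2"
  then obtain d where d: "r = d + 2" by (metis add.commute le_Suc_ex)
  have "E (Suc r) ^ 2 = real q powr (2 * ((2 ^ (Suc r - 2) - 1) / 2 ^ (Suc r - 1)))"
    unfolding E_def by (rule powr_square)
  also have "2 * ((2 ^ (Suc r - 2) - 1) / 2 ^ (Suc r - 1)) = (2 ^ (r - 2) - 1) / 2 ^ (r - 1) + (1/2 :: real)"
    unfolding d by (simp add: field_simps)
  finally show ?thesis unfolding powr_add E_def using q_gt_1 by (simp add: powr_half_sqrt)
qed

lemma E_sq:
  assumes "2 \<le> r" "r \<le> m"
  shows "E r ^ 2 * real (P ^ (2 ^ (m - r))) = real q"
proof -
  obtain d where d: "r = d + 2" using assms by (metis add.commute le_Suc_ex)
  have P0: "P > 0" using P_mod_8 by (auto intro: Nat.gr0I)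
  have "real q = real P powr (2 ^ (m - 2))"
    unfolding q_eq_P using P0 powr_realpow[of "real P" "2 ^ (m - 2)"] by simp
  hence "real q powr (1 / 2 ^ d) = real P powr (2 ^ (m - 2) / 2 ^ d)"
    by (simp add: powr_powr)
  also have "(2::real) ^ (m - 2) / 2 ^ d = real (2 ^ (m - r))"
  proof -
    have "m - 2 = (m - r) + d" using d assms by simp
    thus ?thesis by (simp add: power_add)
  qed
  also have "real P powr real (2 ^ (m - r)) = real P ^ (2 ^ (m - r))"
    using P0 by (intro powr_realpow) simp
  finally have 1: "real (P ^ (2 ^ (m - r))) = real q powr (1 / 2 ^ d)" by simp
  have "E r ^ 2 = real q powr (2 * ((2 ^ (r - 2) - 1) / 2 ^ (r - 1)))"
    unfolding E_def by (rule powr_square)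
  also have "2 * ((2 ^ (r - 2) - 1) / 2 ^ (r - 1)) = (1 - 1 / 2 ^ d :: real)"
    unfolding d by (simp add: field_simps)
  finally have "E r ^ 2 * real (P ^ (2 ^ (m - r))) = real q powr ((1 - 1 / 2 ^ d) + 1 / 2 ^ d)"
    unfolding 1 powr_add by simp
  thus ?thesis using q_gt_1 by simp
qed

text \<open>\<open>E r ^ 2\<close> is a power of the odd number \<open>P\<close>;
  \<open>alpha_step\<close> needs its oddness.\<close>

lemma E_sq_odd:
  assumes "2 \<le> r" "r \<le> m"
  obtains n :: int where "odd n" "E r ^ 2 = real_of_int n"
proof -
  have P0: "P > 0" "odd P" using P_mod_8 by (auto intro: Nat.gr0I) presburger+
  have le: "(2::nat) ^ (m - r) \<le> 2 ^ (m - 2)" using assms by (intro power_increasing) auto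
  have "E r ^ 2 * real (P ^ (2 ^ (m - r))) = real (P ^ (2 ^ (m - 2)))"
    using E_sq[OF assms] q_eq_P by simp
  also have "\<dots> = real (P ^ (2 ^ (m - 2) - 2 ^ (m - r))) * real (P ^ (2 ^ (m - r)))"
    using le by (simp flip: power_add)
  finally have "E r ^ 2 = real (P ^ (2 ^ (m - 2) - 2 ^ (m - r)))" using P0 by simp
  thus ?thesis using that[of "int (P ^ (2 ^ (m - 2) - 2 ^ (m - r)))"] P0 by simp
qed

definition W :: complex where "W = \<i> * of_real (sqrt 2)"

lemma W_sq: "W * W = - 2"
proof -
  have "W * W = (\<i> * \<i>) * of_real (sqrt 2 * sqrt 2)" unfolding W_def of_real_mult by (simp only: mult_ac)
  thus ?thesis by simp
qed

lemma cnj_W: "cnj W = - W"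
  by (simp add: W_def)

definition \<alpha> :: "nat \<Rightarrow> complex" where
  "\<alpha> r = (if r = 2 then K else gauss (h r) / of_real (E r))"

lemma gauss_alpha: "r \<ge> 3 \<Longrightarrow> gauss (h r) = of_real (E r) * \<alpha> r"
  using E_pos[of r] by (simp add: \<alpha>_def)

text \<open>Setting \<open>\<alpha> 2 = K\<close> makes the case \<open>r = 3\<close> of the recursion uniform with the others.\<close>

lemma alpha_sq:
  assumes "3 \<le> r" "r \<le> m"
  shows "\<alpha> r ^ 2 = - \<alpha> (r - 1)"
proof -
  have E: "of_real (E r) ^ 2 = (of_real (E (r - 1)) * of_real (sqrt (real q)) :: complex)"
  proof -
    have "E (Suc (r - 1)) ^ 2 = E (r - 1) * sqrt (real q)" using assms by (intro E_Suc) simp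
    thus ?thesis using assms by (simp flip: of_real_mult of_real_power)
  qed
  have ne: "of_real (E (r - 1)) * of_real (sqrt (real q)) \<noteq> (0::complex)"
    using E_pos[of "r - 1"] q_gt_1 by simp
  have "of_real (E r) ^ 2 * \<alpha> r ^ 2 = gauss (h r) ^ 2"
    using gauss_alpha[OF assms(1)] by (simp add: power_mult_distrib)
  also have "\<dots> = - (of_real (E (r - 1)) * of_real (sqrt (real q))) * \<alpha> (r - 1)"
  proof (cases "r = 3")
    \<comment> \<open>The factors \<open>sgn_r 3\<close> of \<open>gauss_h3_sq\<close> and
      \<open>gauss_h1\<close> cancel, leaving the same minus sign as at the higher levels.\<close>
    case True
    have "E (3 - 1) = 1" using E_2 by simp
    thus ?thesis using True gauss_h3_sq gauss_h1 by (simp add: \<alpha>_def mult_ac)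
  next
    case False
    hence r: "4 \<le> r" "3 \<le> r - 1" using assms by auto
    have "m \<noteq> 3" using r assms by simp
    thus ?thesis
      using gauss_h_square[OF r(1) assms(2)] gauss_h1 gauss_alpha[OF r(2)] by (simp add: sgn_r_def mult_ac)
  qed
  finally have "(of_real (E (r - 1)) * of_real (sqrt (real q))) * \<alpha> r ^ 2
      = (of_real (E (r - 1)) * of_real (sqrt (real q))) * (- \<alpha> (r - 1))"
    unfolding E by simp
  thus ?thesis using mult_left_cancel[OF ne] by blast
qed

end

section \<open>The given forms and the determination of the Gauss sums by them\<close>

locale octic_forms = octic_field +
  fixes A B :: "nat \<Rightarrow> int"
  assumes AB: "\<And>r. 2 \<le> r \<Longrightarrow> r \<le> m \<Longrightarrow> A r ^ 2 + 2 * B r ^ 2 = int (P ^ (2 ^ (m - r)))"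
    and A_mod_4: "\<And>r. 2 \<le> r \<Longrightarrow> r \<le> m \<Longrightarrow> A r mod 4 = 3"
    and p_not_dvd_A: "\<And>r. 2 \<le> r \<Longrightarrow> r \<le> m \<Longrightarrow> \<not> int p dvd A r"
begin

lemma form_unique:
  assumes "2 \<le> r" "r \<le> m" "x\<^sup>2 + 2 * y\<^sup>2 = int (P ^ (2 ^ (m - r)))" "\<not> int p dvd x"
  shows "x\<^sup>2 = (A r)\<^sup>2 \<and> y\<^sup>2 = (B r)\<^sup>2"
proof -
  obtain u where u: "odd u" "P = p ^ u" using P_decomp by blast
  have "P ^ (2 ^ (m - r)) = p ^ (u * 2 ^ (m - r))" unfolding u by (simp add: power_mult)
  moreover have "u * 2 ^ (m - r) \<ge> 1" using u by (simp add: Suc_le_eq odd_pos)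
  ultimately show ?thesis
    using prime_power_form_unique[OF prime_p odd_p, of "A r" "B r" "u * 2 ^ (m - r)" x y]
      AB[OF assms(1,2)] p_not_dvd_A[OF assms(1,2)] assms(3,4) by simp
qed

text \<open>The sign in \<open>A_pred\<close>: modulo 8 the form shows that \<open>B r\<close> is
  odd exactly for \<open>r = m\<close>, which decides whether \<open>A r ^ 2 - 2 * B r ^ 2\<close>
  is 3 or 1 modulo 4.\<close>

definition \<kappa> :: "nat \<Rightarrow> int" where "\<kappa> r = (if r = m then 1 else - 1)"

text \<open>The square of \<open>A r + B r * sqrt (-2)\<close> yields a representation at level
  \<open>r - 1\<close>, so uniqueness identifies it up to signs; the sign of
  \<open>A (r - 1)\<close> follows from its residue modulo 4.\<close>

lemma A_pred:
  assumes "3 \<le> r" "r \<le> m"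
  shows "A (r - 1) = \<kappa> r * ((A r)\<^sup>2 - 2 * (B r)\<^sup>2)" "(2 * A r * B r)\<^sup>2 = (B (r - 1))\<^sup>2"
proof -
  have r2: "2 \<le> r" "2 \<le> r - 1" "r - 1 \<le> m" using assms by auto
  define x where "x = (A r)\<^sup>2 - 2 * (B r)\<^sup>2"
  have "x\<^sup>2 + 2 * (2 * A r * B r)\<^sup>2 = ((A r)\<^sup>2 + 2 * (B r)\<^sup>2)\<^sup>2"
    unfolding x_def by (simp add: power2_eq_square algebra_simps)
  also have "\<dots> = int (P ^ (2 ^ (m - (r - 1))))"
  proof -
    have "m - (r - 1) = Suc (m - r)" using assms by simp
    thus ?thesis unfolding AB[OF r2(1) assms(2)] by (simp add: power_mult[symmetric] mult.commute)
  qed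
  finally have form: "x\<^sup>2 + 2 * (2 * A r * B r)\<^sup>2 = int (P ^ (2 ^ (m - (r - 1))))" .
  have px: "\<not> int p dvd x"
  proof
    assume px: "int p dvd x"
    obtain u where u: "odd u" "P = p ^ u" using P_decomp by blast
    have "u > 0" using u(1) by (rule odd_pos)
    hence "p dvd P" using u by simp
    hence "p dvd P ^ (2 ^ (m - r))" by (metis dvd_power_le le_refl dvd_trans dvd_power zero_less_numeral zero_less_power)
    hence "int p dvd (A r)\<^sup>2 + 2 * (B r)\<^sup>2" using AB[OF r2(1) assms(2)] by (metis of_nat_dvd_iff)
    hence "int p dvd ((A r)\<^sup>2 + 2 * (B r)\<^sup>2) + x" using px by (rule dvd_add)
    hence "int p dvd 2 * (A r)\<^sup>2" unfolding x_def by simp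
    moreover have "prime (int p)" using prime_p by simp
    moreover have "\<not> int p dvd 2"
      using not_p_dvd_2 by (metis of_nat_dvd_iff of_nat_numeral)
    ultimately show False
      using p_not_dvd_A[OF r2(1) assms(2)] by (simp add: prime_dvd_mult_iff prime_dvd_power_iff)
  qed
  have un: "x\<^sup>2 = (A (r - 1))\<^sup>2 \<and> (2 * A r * B r)\<^sup>2 = (B (r - 1))\<^sup>2"
    by (rule form_unique[OF r2(2,3) form px])
  thus "(2 * A r * B r)\<^sup>2 = (B (r - 1))\<^sup>2" by simp
  have "x = A (r - 1) \<or> x = - A (r - 1)" using un by (simp add: power2_eq_iff)
  moreover have "A (r - 1) mod 4 = 3" using A_mod_4 r2 by simp
  moreover have "x mod 4 = (if r = m then 3 else 1)"
  proof -
    define a where "a = A r div 4"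
    have a: "A r = 4 * a + 3" using A_mod_4[OF r2(1) assms(2)] unfolding a_def by (metis mult_div_mod_eq)
    have a2: "(A r)\<^sup>2 = 8 * (2 * a\<^sup>2 + 3 * a + 1) + 1" unfolding a by (simp add: power2_eq_square algebra_simps)
    show ?thesis
    proof (cases "r = m")
      case True
      have "int P mod 8 = 3" using P_mod_8 by (metis of_nat_mod of_nat_numeral)
      hence "(8 * (2 * a\<^sup>2 + 3 * a + 1) + 1 + 2 * (B r)\<^sup>2) mod 8 = 3"
        using AB[OF r2(1) assms(2)] True a2 by simp
      moreover have "even (B r) \<Longrightarrow> (B r)\<^sup>2 mod 4 = 0" by (auto elim!: evenE simp: power2_eq_square)
      ultimately have "odd (B r)" by presburger
      then obtain b where "B r = 2 * b + 1" by (auto elim: oddE)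
      hence "(B r)\<^sup>2 = 4 * (b\<^sup>2 + b) + 1" by (simp add: power2_eq_square algebra_simps)
      thus ?thesis unfolding x_def a2 using True by simp presburger
    next
      case False
      have "P ^ (2 ^ (m - r)) mod 8 = 1" using False assms by (intro P_pow_mod_8) simp
      hence "int (P ^ (2 ^ (m - r))) mod 8 = 1" by (metis of_nat_mod of_nat_numeral of_nat_1)
      hence "(8 * (2 * a\<^sup>2 + 3 * a + 1) + 1 + 2 * (B r)\<^sup>2) mod 8 = 1"
        using AB[OF r2(1) assms(2)] a2 by simp
      hence "(B r)\<^sup>2 mod 4 = 0" by presburger
      thus ?thesis unfolding x_def a2 using False by simp presburger
    qed
  qed
  ultimately show "A (r - 1) = \<kappa> r * ((A r)\<^sup>2 - 2 * (B r)\<^sup>2)"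
    unfolding \<kappa>_def x_def[symmetric] by (auto split: if_splits) presburger+
qed

text \<open>A square root of \<open>- \<kappa> r\<close>: it reconciles the minus sign of
  \<open>alpha_sq\<close> with the sign in \<open>A_pred\<close>.\<close>

definition \<iota> :: "nat \<Rightarrow> complex" where "\<iota> r = (if r = m then \<i> else 1)"

lemma iota_sq: "\<iota> r * \<iota> r = - of_int (\<kappa> r)"
  by (simp add: \<iota>_def \<kappa>_def)

lemma norm_iota: "\<iota> r * cnj (\<iota> r) = 1"
  by (simp add: \<iota>_def)

lemma sgn_cnj_iota: "sgn_r r * cnj (\<iota> r) = \<iota> r"
  by (simp add: \<iota>_def sgn_r_def)

text \<open>Were the sign of \<open>\<alpha> (r - 1)\<close> wrong, \<open>\<alpha> r\<close> would be off by a factor \<open>\<i>\<close>, and then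
  \<open>|T r a|\<^sup>2\<close> would not be divisible by \<open>4 ^ (r - 1)\<close>.\<close>

lemma alpha_step:
  assumes r: "3 \<le> r" "r \<le> m"
    and prev: "\<alpha> (r - 1) = of_int \<delta> * (of_int (A (r - 1)) + of_int \<beta> * W)"
    and d: "\<delta>\<^sup>2 = 1" and b: "\<beta>\<^sup>2 = (B (r - 1))\<^sup>2"
  shows "\<delta> = 1 \<and> (\<exists>\<delta>' \<beta>'. \<delta>'\<^sup>2 = 1 \<and> \<beta>'\<^sup>2 = (B r)\<^sup>2 \<and>
      \<alpha> r = of_int \<delta>' * \<iota> r * (of_int (A r) + of_int \<beta>' * W))"
proof -
  have k2: "\<kappa> r * \<kappa> r = 1" by (simp add: \<kappa>_def)
  have "(2 * A r * B r)\<^sup>2 = (\<kappa> r * \<beta>)\<^sup>2"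
    using A_pred(2)[OF r] b k2 unfolding power_mult_distrib[of "\<kappa> r"] power2_eq_square[of "\<kappa> r"] by simp
  hence "2 * A r * B r = \<kappa> r * \<beta> \<or> 2 * A r * - B r = \<kappa> r * \<beta>"
    unfolding power2_eq_iff by auto
  \<comment> \<open>The sign of \<open>\<beta>'\<close> is chosen so that squaring \<open>c\<close>
    returns \<open>\<beta>\<close> itself.\<close>
  then obtain \<beta>' where b': "\<beta>'\<^sup>2 = (B r)\<^sup>2" "2 * A r * \<beta>' = \<kappa> r * \<beta>" by (metis power2_minus)
  define c where "c = of_int (A r) + of_int \<beta>' * W"
  have "of_int (\<kappa> r) * (c * c) = of_int (\<kappa> r * ((A r)\<^sup>2 - 2 * \<beta>'\<^sup>2)) + of_int (\<kappa> r * (2 * A r * \<beta>')) * W"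
  proof -
    have cc: "c * c = of_int (A r) * of_int (A r) + 2 * of_int (A r) * of_int \<beta>' * W + of_int \<beta>' * of_int \<beta>' * (W * W)"
      unfolding c_def by (simp add: algebra_simps)
    show ?thesis unfolding cc W_sq by (simp add: algebra_simps power2_eq_square)
  qed
  also have "\<kappa> r * ((A r)\<^sup>2 - 2 * \<beta>'\<^sup>2) = A (r - 1)" using A_pred(1)[OF r] b' by simp
  also have "\<kappa> r * (2 * A r * \<beta>') = \<beta>" unfolding b' using k2 by (simp add: mult.assoc[symmetric])
  finally have kc: "of_int (\<kappa> r) * (c * c) = of_int (A (r - 1)) + of_int \<beta> * W" .
  have sq: "\<alpha> r ^ 2 = of_int \<delta> * (\<iota> r * c) ^ 2"
  proof -
    have "\<alpha> r ^ 2 = - (of_int \<delta> * (of_int (\<kappa> r) * (c * c)))"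
      unfolding alpha_sq[OF r] prev kc ..
    also have "\<dots> = of_int \<delta> * ((\<iota> r * \<iota> r) * (c * c))" unfolding iota_sq by simp
    finally show ?thesis by (simp add: power2_eq_square mult_ac)
  qed
  have "\<delta> = 1"
  proof (rule ccontr)
    assume "\<delta> \<noteq> 1"
    hence "\<delta> = - 1" using d by (auto simp: power2_eq_1_iff)
    hence "\<alpha> r ^ 2 = (\<i> * (\<iota> r * c)) ^ 2" using sq by (simp add: power_mult_distrib)
    then obtain \<nu> where nu: "\<nu> = \<i> * \<iota> r \<or> \<nu> = - (\<i> * \<iota> r)" "\<alpha> r = \<nu> * c"
      unfolding power2_eq_iff by (metis mult.assoc mult_minus_left)
    have nn: "\<nu> * cnj \<nu> = 1" using nu(1) norm_iota[of r] by (elim disjE) (simp_all add: mult_ac)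
    have sn: "sgn_r r * cnj \<nu> = - \<nu>" using nu(1) sgn_cnj_iota[of r] by (elim disjE) (simp_all add: mult_ac)
    have cc: "c + cnj c = 2 * of_int (A r)" unfolding c_def by (simp add: cnj_W)
    have ga: "gauss (h r) = of_real (E r) * (\<nu> * c)" using gauss_alpha[OF r(1)] nu(2) by simp
    have "Gs r = of_real (E r) * ((sgn_r r * cnj \<nu>) * cnj c)"
      unfolding Gs_def ga by (simp add: mult_ac)
    hence "gauss (h r) - Gs r = of_real (E r) * \<nu> * (c + cnj c)"
      unfolding ga sn by (simp add: algebra_simps)
    hence diff: "gauss (h r) - Gs r = 2 * of_real (E r) * \<nu> * of_int (A r)" unfolding cc by simp
    have "T r (g ^ (2 ^ (r - 3) * 1)) = - (2 ^ (r - 3) * 2) * (of_real (E r) * \<nu> * of_int (A r) * W)"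
      unfolding T_value[OF r] diff W_def[symmetric] by (simp add: oct_re_def oct_im_def)
    also have "(2::complex) ^ (r - 3) * 2 = 2 ^ (r - 2)"
    proof -
      have "r - 2 = Suc (r - 3)" using r by simp
      thus ?thesis by simp
    qed
    finally have Tv: "T r (g ^ (2 ^ (r - 3) * 1)) = - (2 ^ (r - 2)) * (of_real (E r) * \<nu> * of_int (A r) * W)" .
    obtain n :: int where n: "T r (g ^ (2 ^ (r - 3) * 1)) * cnj (T r (g ^ (2 ^ (r - 3) * 1))) = 4 ^ (r - 1) * of_int n"
      using T_norm_integral[of r] r by auto
    have "T r (g ^ (2 ^ (r - 3) * 1)) * cnj (T r (g ^ (2 ^ (r - 3) * 1)))
       = (2 ^ (r - 2) * 2 ^ (r - 2)) * (\<nu> * cnj \<nu>) * (- (W * W)) * of_real (E r * E r) * of_int (A r * A r)"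
      unfolding Tv by (simp add: cnj_W mult_ac)
    also have "\<dots> = 4 ^ (r - 2) * 2 * of_real (E r ^ 2) * of_int (A r * A r)"
      unfolding nn W_sq by (simp add: power2_eq_square power_mult_distrib[symmetric])
    finally have "4 ^ (r - 2) * 2 * of_real (E r ^ 2) * of_int (A r * A r) = (4 ^ (r - 1) * of_int n :: complex)"
      using n by simp
    also have "(4::complex) ^ (r - 1) = 4 ^ (r - 2) * 4"
    proof -
      have "r - 1 = Suc (r - 2)" using r by simp
      thus ?thesis by simp
    qed
    finally have "4 ^ (r - 2) * 2 * (of_real (E r ^ 2) * of_int (A r * A r)) = (4 ^ (r - 2) * 4 * of_int n :: complex)"
      by (simp only: mult.assoc)
    moreover have "x = 2 * y" if "4 ^ (r - 2) * 2 * x = 4 ^ (r - 2) * 4 * y" for x y :: complex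
      using that by simp
    ultimately have eq: "of_real (E r ^ 2) * of_int (A r * A r) = (2 * of_int n :: complex)" by blast
    \<comment> \<open>Since \<open>E r ^ 2\<close> and \<open>A r\<close> are odd, the norm has just
      one factor 2 beyond \<open>4 ^ (r - 2)\<close>, whereas \<open>4 ^ (r - 1)\<close> requires
      two.\<close>
    obtain N :: int where N: "odd N" "E r ^ 2 = real_of_int N" using E_sq_odd[of r] r by auto
    have "of_int (N * (A r * A r)) = (of_int (2 * n) :: complex)" using eq unfolding N by simp
    hence "N * (A r * A r) = 2 * n" by (simp only: of_int_eq_iff)
    moreover have "odd (A r)" using A_mod_4[of r] r by presburger
    ultimately show False using N(1) by (metis dvd_triv_left even_mult_iff)
  qed
  moreover have "\<exists>\<delta>' \<beta>'. \<delta>'\<^sup>2 = 1 \<and> \<beta>'\<^sup>2 = (B r)\<^sup>2 \<and>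
      \<alpha> r = of_int \<delta>' * \<iota> r * (of_int (A r) + of_int \<beta>' * W)"
  proof -
    have "\<alpha> r = \<iota> r * c \<or> \<alpha> r = - (\<iota> r * c)" using sq \<open>\<delta> = 1\<close> by (simp add: power2_eq_iff)
    thus ?thesis
    proof
      assume "\<alpha> r = \<iota> r * c"
      thus ?thesis using b'(1) unfolding c_def by (intro exI[of _ 1] exI[of _ \<beta>']) simp
    next
      assume "\<alpha> r = - (\<iota> r * c)"
      thus ?thesis using b'(1) unfolding c_def by (intro exI[of _ "-1"] exI[of _ \<beta>']) simp
    qed
  qed
  ultimately show ?thesis by blast
qed

text \<open>\<open>K_norm\<close> reads \<open>2 * q = 2 * Kre ^ 2 + Kim ^ 2\<close>, so
  \<open>Kim\<close> is even and \<open>K\<close> represents \<open>q\<close>;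
  \<open>p_not_dvd_Kre\<close> makes uniqueness applicable.\<close>

lemma alpha_2: "\<exists>\<delta> \<beta>. \<delta>\<^sup>2 = 1 \<and> \<beta>\<^sup>2 = (B 2)\<^sup>2 \<and> \<alpha> 2 = of_int \<delta> * (of_int (A 2) + of_int \<beta> * W)"
proof -
  have "K * cnj K = of_int Kre * of_int Kre - of_int Kim * of_int Kim / 4 * (W * W)"
    unfolding K_form W_def[symmetric] by (simp add: cnj_W algebra_simps)
  hence "of_nat q = (of_int Kre * of_int Kre + of_int Kim * of_int Kim / 2 :: complex)"
    unfolding K_norm W_sq by simp
  hence "(of_int (2 * int q) :: complex) = of_int (2 * Kre * Kre + Kim * Kim)"
    by (simp add: field_simps)
  hence e: "2 * int q = 2 * Kre * Kre + Kim * Kim" by (simp only: of_int_eq_iff)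
  hence "Kim * Kim = 2 * (int q - Kre * Kre)" by (simp add: algebra_simps)
  hence "even (Kim * Kim)" by simp
  hence "even Kim" by simp
  then obtain y where y: "Kim = 2 * y" by blast
  have form: "Kre\<^sup>2 + 2 * y\<^sup>2 = int (P ^ (2 ^ (m - 2)))"
    using e unfolding y q_eq_P[symmetric] by (simp add: power2_eq_square)
  have "2 \<le> m" using m_ge by simp
  from form_unique[OF _ this form p_not_dvd_Kre] have un: "Kre\<^sup>2 = (A 2)\<^sup>2" "y\<^sup>2 = (B 2)\<^sup>2" by auto
  have K: "\<alpha> 2 = of_int Kre + of_int y * W"
    unfolding \<alpha>_def using K_form y by (simp add: W_def)
  from un(1) have "Kre = A 2 \<or> Kre = - A 2" by (simp add: power2_eq_iff)
  thus ?thesis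
  proof
    assume "Kre = A 2"
    thus ?thesis using un(2) K by (intro exI[of _ 1] exI[of _ y]) simp
  next
    assume "Kre = - A 2"
    thus ?thesis using un(2) K by (intro exI[of _ "-1"] exI[of _ "-y"]) simp
  qed
qed

lemma alpha_exists:
  assumes "2 \<le> r" "r \<le> m"
  shows "\<exists>\<delta> \<beta>. \<delta>\<^sup>2 = 1 \<and> \<beta>\<^sup>2 = (B r)\<^sup>2 \<and> \<alpha> r = of_int \<delta> * \<iota> r * (of_int (A r) + of_int \<beta> * W)"
  using assms
proof (induction r rule: dec_induct)
  case base
  have "\<iota> 2 = 1" using m_ge by (simp add: \<iota>_def)
  thus ?case using alpha_2 by simp
next
  case (step r)
  have "\<iota> r = 1" using step by (simp add: \<iota>_def)
  then obtain \<delta> \<beta> where "\<delta>\<^sup>2 = 1" "\<beta>\<^sup>2 = (B r)\<^sup>2" "\<alpha> r = of_int \<delta> * (of_int (A r) + of_int \<beta> * W)"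
    using step by auto
  thus ?case using alpha_step[of "Suc r" \<delta> \<beta>] step by simp
qed

text \<open>For \<open>r < m\<close> the sign is forced by \<open>alpha_step\<close> at level
  \<open>r + 1\<close>; level \<open>m\<close> has no successor.\<close>

lemma alpha_value:
  assumes "2 \<le> r" "r \<le> m"
  shows "\<exists>\<delta> \<beta>. \<delta>\<^sup>2 = 1 \<and> (r < m \<longrightarrow> \<delta> = 1) \<and> \<beta>\<^sup>2 = (B r)\<^sup>2 \<and>
    \<alpha> r = of_int \<delta> * \<iota> r * (of_int (A r) + of_int \<beta> * W)"
proof -
  obtain \<delta> \<beta> where d: "\<delta>\<^sup>2 = 1" "\<beta>\<^sup>2 = (B r)\<^sup>2"
      "\<alpha> r = of_int \<delta> * \<iota> r * (of_int (A r) + of_int \<beta> * W)"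
    using alpha_exists[OF assms] by blast
  have "\<delta> = 1" if "r < m"
  proof -
    have "\<alpha> r = of_int \<delta> * (of_int (A r) + of_int \<beta> * W)" using d(3) that by (simp add: \<iota>_def)
    thus ?thesis using alpha_step[of "Suc r" \<delta> \<beta>] d that assms by simp
  qed
  thus ?thesis using d by blast
qed

text \<open>Sum and difference of \<open>gauss (h r)\<close> and \<open>Gs r\<close> isolate
  \<open>A r\<close> and \<open>\<beta> * W\<close>; the second \<open>W\<close>, from
  \<open>T_value\<close>, turns the latter into \<open>-2 * \<beta>\<close>.\<close>

lemma T_final:
  assumes r: "3 \<le> r" "r \<le> m"
  shows "\<exists>\<delta> \<beta>. \<delta>\<^sup>2 = 1 \<and> (r < m \<longrightarrow> \<delta> = 1) \<and> \<beta>\<^sup>2 = (B r)\<^sup>2 \<and>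
    (\<forall>l. T r (g ^ (2 ^ (r - 3) * l)) =
      2 ^ (r - 2) * of_real (E r) * (of_int \<delta> * \<iota> r) * of_int (A r * oct_re l + 2 * \<beta> * oct_im l))"
proof -
  obtain \<delta> \<beta> where d: "\<delta>\<^sup>2 = 1" "r < m \<longrightarrow> \<delta> = 1" "\<beta>\<^sup>2 = (B r)\<^sup>2"
      "\<alpha> r = of_int \<delta> * \<iota> r * (of_int (A r) + of_int \<beta> * W)"
    using alpha_value[of r] r by auto
  define \<nu> where "\<nu> = of_int \<delta> * \<iota> r"
  define c where "c = of_int (A r) + of_int \<beta> * W"
  have sn: "sgn_r r * cnj \<nu> = \<nu>" unfolding \<nu>_def using sgn_cnj_iota[of r] by (simp add: mult_ac)
  have ga: "gauss (h r) = of_real (E r) * (\<nu> * c)"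
    using gauss_alpha[OF r(1)] d(4) by (simp add: \<nu>_def c_def)
  have "Gs r = of_real (E r) * ((sgn_r r * cnj \<nu>) * cnj c)"
    unfolding Gs_def ga by (simp add: mult_ac)
  hence G: "Gs r = of_real (E r) * (\<nu> * cnj c)" unfolding sn .
  have cc: "c + cnj c = 2 * of_int (A r)" "c - cnj c = 2 * of_int \<beta> * W" unfolding c_def by (simp_all add: cnj_W)
  have sum: "gauss (h r) + Gs r = 2 * of_real (E r) * \<nu> * of_int (A r)"
  proof -
    have "gauss (h r) + Gs r = of_real (E r) * \<nu> * (c + cnj c)" unfolding ga G by (simp add: algebra_simps)
    thus ?thesis unfolding cc by simp
  qed
  have diff: "gauss (h r) - Gs r = 2 * of_real (E r) * \<nu> * of_int \<beta> * W"
  proof -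
    have "gauss (h r) - Gs r = of_real (E r) * \<nu> * (c - cnj c)" unfolding ga G by (simp add: algebra_simps)
    thus ?thesis unfolding cc by simp
  qed
  have two: "(2::complex) ^ (r - 2) = 2 ^ (r - 3) * 2"
  proof -
    have "r - 2 = Suc (r - 3)" using r by simp
    thus ?thesis by simp
  qed
  have "T r (g ^ (2 ^ (r - 3) * l)) =
      2 ^ (r - 2) * of_real (E r) * \<nu> * of_int (A r * oct_re l + 2 * \<beta> * oct_im l)" for l
  proof -
    have "T r (g ^ (2 ^ (r - 3) * l)) = 2 ^ (r - 3) * (2 * of_real (E r) * \<nu> * of_int (A r) * of_int (oct_re l)
       - 2 * of_real (E r) * \<nu> * of_int \<beta> * of_int (oct_im l) * (W * W))"
      unfolding T_value[OF r] sum diff W_def[symmetric] by (simp only: mult_ac)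
    thus ?thesis unfolding W_sq two by (simp add: algebra_simps)
  qed
  thus ?thesis using d(1-3) unfolding \<nu>_def by blast
qed

end

section \<open>Counting solutions\<close>

text \<open>Splitting off the odd multipliers \<open>k\<close> times sorts the exponents by 2-adic
  valuation.\<close>

lemma sum_power2_split:
  fixes f :: "nat \<Rightarrow> 'b::comm_monoid_add"
  assumes "k \<le> m"
  shows "(\<Sum>l<2 ^ m. f l) = (\<Sum>l<2 ^ (m - k). f (2 ^ k * l)) + (\<Sum>j<k. \<Sum>c<2 ^ (m - j - 1). f (2 ^ j * (2 * c + 1)))"
  using assms
proof (induction k)
  case (Suc k)
  have m: "(2::nat) ^ (m - k) = 2 * 2 ^ (m - Suc k)"
    using Suc.prems by (metis Suc_diff_Suc Suc_le_eq power_Suc)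
  have "(\<Sum>l<2 ^ (m - k). f (2 ^ k * l))
      = (\<Sum>l<2 ^ (m - Suc k). f (2 ^ Suc k * l)) + (\<Sum>c<2 ^ (m - k - 1). f (2 ^ k * (2 * c + 1)))"
    unfolding m sum_lessThan_double by (simp add: mult_ac)
  thus ?case using Suc by (simp add: add_ac)
qed auto

lemma sum_Icc_filter:
  fixes f :: "nat \<Rightarrow> 'b::comm_monoid_add"
  assumes "j \<le> m"
  shows "(\<Sum>r=3..m. if r \<le> j then f r else 0) = (\<Sum>r=3..j. f r)"
proof -
  have "(\<Sum>r=3..m. if r \<le> j then f r else 0) = (\<Sum>r\<in>{r\<in>{3..m}. r \<le> j}. f r)"
    by (rule sum.inter_filter[symmetric]) simp
  also have "{r\<in>{3..m}. r \<le> j} = {3..j}" using assms by auto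
  finally show ?thesis .
qed

lemma power_pm_cong:
  fixes c z w :: complex
  assumes "z = w \<or> z = - w"
  shows "(c + z) ^ n + (c - z) ^ n = (c + w) ^ n + (c - w) ^ n"
  using assms by (auto simp: add.commute)

context octic_field
begin

text \<open>Orthogonality of \<open>\<psi>\<close> counts the solutions. \<open>S m a\<close>
  depends only on the coset of \<open>a\<close> modulo \<open>2 ^ m\<close>-th powers, so the
  nonzero \<open>a\<close> form \<open>h m = (q - 1) / 2 ^ m\<close> equal blocks.\<close>

lemma card_solutions:
  assumes "n \<ge> 1"
  shows "of_nat (card {x \<in> {..<n} \<rightarrow>\<^sub>E (UNIV :: 'a set). (\<Sum>j<n. x j ^ (2 ^ m)) = 0})
    = of_nat q ^ (n - 1) + (of_nat q - 1) / (2 ^ m * of_nat q) * (\<Sum>l<2 ^ m. S m (g ^ l) ^ n)"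
proof -
  define X where "X = ({..<n} \<rightarrow>\<^sub>E (UNIV :: 'a set))"
  have fin: "finite X" unfolding X_def by (intro finite_PiE) auto
  define N where "N = card {x \<in> X. (\<Sum>j<n. x j ^ (2 ^ m)) = 0}"
  have "of_nat q * of_nat N = (\<Sum>x\<in>X. if (\<Sum>j<n. x j ^ (2 ^ m)) = 0 then of_nat q else (0::complex))"
    unfolding N_def using fin by (simp add: sum.inter_filter[symmetric] mult.commute)
  also have "\<dots> = (\<Sum>x\<in>X. \<Sum>a\<in>UNIV. \<psi> ((\<Sum>j<n. x j ^ (2 ^ m)) * a))"
    unfolding sum_psi ..
  also have "\<dots> = (\<Sum>a\<in>UNIV. \<Sum>x\<in>X. \<Prod>j<n. \<psi> (a * x j ^ (2 ^ m)))"
  proof -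
    have "\<psi> ((\<Sum>j<n. x j ^ (2 ^ m)) * a) = (\<Prod>j<n. \<psi> (a * x j ^ (2 ^ m)))" for a :: 'a and x
      by (subst mult.commute) (simp add: sum_distrib_left psi_sum)
    thus ?thesis by (subst sum.swap) (simp only:)
  qed
  also have "\<dots> = (\<Sum>a\<in>UNIV. \<Prod>j<n. \<Sum>y\<in>UNIV. \<psi> (a * y ^ (2 ^ m)))"
    unfolding X_def by (subst prod_sum_PiE) auto
  also have "\<dots> = (\<Sum>a\<in>UNIV. S m a ^ n)" by (simp add: S_def)
  also have "\<dots> = of_nat q ^ n + (\<Sum>i<M. S m (g ^ i) ^ n)"
  proof -
    have "S m 0 = of_nat q" using card_eq by (simp add: S_def)
    thus ?thesis unfolding sum_split_0[of "\<lambda>a. S m a ^ n"] sum_nonzero by simp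
  qed
  also have "(\<Sum>i<M. S m (g ^ i) ^ n) = of_nat (h m) * (\<Sum>l<2 ^ m. S m (g ^ l) ^ n)"
  proof -
    have "(\<Sum>i<h m * 2 ^ m. S m (g ^ i) ^ n) = of_nat (h m) * (\<Sum>l<2 ^ m. S m (g ^ l) ^ n)"
    proof (rule sum_lessThan_periodic)
      fix i
      have "S m (g ^ (i + 2 ^ m)) = (\<Sum>x\<in>UNIV. \<psi> (g ^ i * (g * x) ^ (2 ^ m)))"
        unfolding S_def by (simp add: power_add power_mult_distrib mult_ac)
      also have "\<dots> = S m (g ^ i)" unfolding S_def
        by (rule sum.reindex_bij_witness[of _ "\<lambda>x. x / g" "\<lambda>x. g * x"]) (use g_nz in auto)
      finally show "S m (g ^ (i + 2 ^ m)) ^ n = S m (g ^ i) ^ n" by simp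
    qed
    thus ?thesis using h_mult[of m] by (simp add: mult.commute)
  qed
  finally have eq: "of_nat q * of_nat N = of_nat q ^ n + of_nat (h m) * (\<Sum>l<2 ^ m. S m (g ^ l) ^ n)" .
  have "of_nat (2 ^ m * h m) + 1 = (of_nat q :: complex)"
    unfolding h_mult[OF order.refl] using q_eq by simp
  hence hm: "of_nat (h m) = (of_nat q - 1) / (2 ^ m :: complex)" by (simp add: field_simps)
  have q0: "(of_nat q :: complex) \<noteq> 0" using q_gt_1 by simp
  have "(of_nat q :: complex) ^ n = of_nat q * of_nat q ^ (n - 1)" using assms by (simp add: power_eq_if)
  hence "of_nat N = of_nat q ^ (n - 1) + (of_nat q - 1) / (2 ^ m * of_nat q) * (\<Sum>l<2 ^ m. S m (g ^ l) ^ n)"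
    using eq q0 unfolding hm by (simp add: field_simps)
  thus ?thesis unfolding N_def X_def .
qed

text \<open>The joint contribution of levels 1 and 2 at valuation \<open>j\<close>, constant from
  \<open>j = 2\<close> on.\<close>

definition base :: "nat \<Rightarrow> complex" where
  "base j = (if j = 0 then sgn_r 3 * of_real (sqrt q)
    else if j = 1 then (2 - sgn_r 3) * of_real (sqrt q) else - (2 + sgn_r 3) * of_real (sqrt q))"

lemma T_12:
  assumes "odd l"
  shows "T 1 (g ^ (2 ^ j * l)) + T 2 (g ^ (2 ^ j * l)) = base j"
proof -
  have g2: "gauss (h 2) = - of_real (sqrt q)"
    unfolding gauss_h2 gauss_h1 by (simp add: sgn_r_def)
  consider "j = 0" | "j = 1" | i where "j = i + 2"
    by (metis One_nat_def add_2_eq_Suc' old.nat.exhaust)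
  thus ?thesis
  proof cases
    case 1
    have "l mod 4 \<noteq> 0" "l mod 4 \<noteq> 2" using assms by presburger+
    thus ?thesis unfolding T_1 T_2 gauss_h1 using assms 1 by (simp add: base_def)
  next
    case 2
    have "(2 * l) mod 4 = 2" using assms by presburger
    hence t: "T 1 (g ^ (2 * l)) = gauss (h 1)" "T 2 (g ^ (2 * l)) = - 2 * gauss (h 2)"
      unfolding T_1 T_2 by simp_all
    have e: "2 ^ j * l = 2 * l" using 2 by simp
    show ?thesis unfolding e t gauss_h1 g2 using 2 by (simp add: base_def algebra_simps)
  next
    case 3
    have "(2 ^ j * l) mod 4 = 0" "even (2 ^ j * l)" unfolding 3 by (simp_all add: power_add mult.commute)
    thus ?thesis unfolding T_1 T_2 gauss_h1 g2 using 3 by (simp add: base_def algebra_simps)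
  qed
qed

lemma T_12_0: "T 1 (g ^ 0) + T 2 (g ^ 0) = base 2"
proof -
  have g2: "gauss (h 2) = - of_real (sqrt q)"
    unfolding gauss_h2 gauss_h1 by (simp add: sgn_r_def)
  show ?thesis unfolding T_1 T_2 gauss_h1 g2 by (simp add: base_def algebra_simps)
qed

lemma S_m_split: "a \<noteq> 0 \<Longrightarrow> S m a = T 1 a + T 2 a + (\<Sum>r=3..m. T r a)"
proof -
  assume a: "a \<noteq> 0"
  have "{1..m} = {1, 2} \<union> {3..m}" using m_ge by auto
  hence "(\<Sum>r=1..m. T r a) = (\<Sum>r\<in>{1, 2}. T r a) + (\<Sum>r=3..m. T r a)"
    by (simp only:) (subst sum.union_disjoint, auto)
  thus ?thesis using S_eq_sum_T[OF a, of m] by simp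
qed

lemma oct_odd: "odd l \<Longrightarrow> oct_re l = 0"
  unfolding oct_re_def by presburger

lemma oct_2_odd: "odd l \<Longrightarrow> oct_re (2 * l) = 0 \<and> oct_im (2 * l) = 0"
  unfolding oct_re_def oct_im_def by presburger

lemma oct_4_odd: "odd l \<Longrightarrow> oct_re (4 * l) = - 2 \<and> oct_im (4 * l) = 0"
  unfolding oct_re_def oct_im_def by presburger

lemma oct_8: "oct_re (8 * l) = 2 \<and> oct_im (8 * l) = 0"
  unfolding oct_re_def oct_im_def by simp

end

section \<open>Values of the exponential sum on the cosets of \<open>2 ^ m\<close>-th powers\<close>

context octic_forms
begin

definition Y :: "nat \<Rightarrow> complex" where
  "Y r = 2 ^ (r - 1) * of_int (A r) * of_real (E r)"

text \<open>Unlike \<open>Y r\<close> this includes \<open>\<iota> r\<close>; for \<open>Y\<close>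
  that factor matters only at \<open>r = m\<close> and is written out in
  \<open>sum_periods\<close>.\<close>

definition Z :: "nat \<Rightarrow> complex" where
  "Z r = 2 ^ (r - 1) * of_int (B r) * of_real (E r) * \<iota> r"

text \<open>The part of \<open>S m\<close> at valuation \<open>j <= m - 2\<close> that comes from
  levels up to \<open>j + 2\<close>. The guard is there because levels below 3 are already in
  \<open>base j\<close>.\<close>

definition C :: "nat \<Rightarrow> complex" where
  "C j = base j + (\<Sum>r=3..j. Y r) - (if j \<ge> 2 then Y (j + 1) else 0)"

text \<open>The common part of the values at exponents \<open>2 ^ (m - 1)\<close> and 0, which
  differ only in the sign of the level \<open>m\<close> term.\<close>

definition D :: complex where
  "D = base 2 + (\<Sum>r=3..m - 1. Y r)"

text \<open>The signs that \<open>T_final\<close> leaves open, those of \<open>\<beta> r\<close> and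
  \<open>\<delta> m\<close>, only exchange the two members of a pair \<open>c + z\<close>,
  \<open>c - z\<close>, so \<open>power_pm_cong\<close> removes them.\<close>

lemma sum_periods:
  "(\<Sum>l<2 ^ m. S m (g ^ l) ^ n) =
    (\<Sum>j<m - 2. 2 ^ (m - j - 2) * ((C j + Z (j + 3)) ^ n + (C j - Z (j + 3)) ^ n))
    + 2 * C (m - 2) ^ n + ((D + \<i> * Y m) ^ n + (D - \<i> * Y m) ^ n)"
proof -
  define Q where "Q r \<delta> \<beta> \<longleftrightarrow> (3 \<le> r \<longrightarrow> r \<le> m \<longrightarrow> \<delta>\<^sup>2 = 1 \<and> (r < m \<longrightarrow> \<delta> = 1) \<and> \<beta>\<^sup>2 = (B r)\<^sup>2 \<and>
    (\<forall>l. T r (g ^ (2 ^ (r - 3) * l)) =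
      2 ^ (r - 2) * of_real (E r) * (of_int \<delta> * \<iota> r) * of_int (A r * oct_re l + 2 * \<beta> * oct_im l)))"
    for r and \<delta> \<beta> :: int
  have "\<exists>\<delta> \<beta>. Q r \<delta> \<beta>" for r
    using T_final[of r] unfolding Q_def by blast
  then obtain \<delta> \<beta> :: "nat \<Rightarrow> int" where Q: "\<And>r. Q r (\<delta> r) (\<beta> r)" by metis
  have db: "\<And>r. 3 \<le> r \<Longrightarrow> r \<le> m \<Longrightarrow> (\<delta> r)\<^sup>2 = 1"
      "\<And>r. 3 \<le> r \<Longrightarrow> r < m \<Longrightarrow> \<delta> r = 1" "\<And>r. 3 \<le> r \<Longrightarrow> r \<le> m \<Longrightarrow> (\<beta> r)\<^sup>2 = (B r)\<^sup>2"
    using Q unfolding Q_def by (simp_all add: less_imp_le)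
  have Tv: "T r (g ^ (2 ^ (r - 3) * l)) =
      2 ^ (r - 2) * of_real (E r) * (of_int (\<delta> r) * \<iota> r) * of_int (A r * oct_re l + 2 * \<beta> r * oct_im l)"
    if "3 \<le> r" "r \<le> m" for r l
    using Q[of r] that unfolding Q_def by blast
  define \<nu> where "\<nu> r = of_int (\<delta> r) * \<iota> r" for r
  define Z' where "Z' r = 2 ^ (r - 1) * of_real (E r) * \<nu> r * of_int (\<beta> r)" for r
  have nu1: "\<nu> r = 1" if "3 \<le> r" "r < m" for r
    using db(2)[OF that] that by (simp add: \<nu>_def \<iota>_def)
  have two: "(2::complex) ^ (r - 2) * 2 = 2 ^ (r - 1)" if "3 \<le> r" for r
  proof -
    have "r - 1 = Suc (r - 2)" using that by simp
    thus ?thesis by simp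
  qed
  have T8: "T r (g ^ (2 ^ (r - 3) * (8 * l))) = \<nu> r * Y r" if "3 \<le> r" "r \<le> m" for r l
    unfolding Tv[OF that] Y_def two[OF that(1), symmetric] \<nu>_def by (simp add: oct_8)
  have T4: "T r (g ^ (2 ^ (r - 3) * (4 * l))) = - (\<nu> r * Y r)" if "3 \<le> r" "r \<le> m" "odd l" for r l
    unfolding Tv[OF that(1,2)] Y_def two[OF that(1), symmetric] \<nu>_def using oct_4_odd[OF that(3)] by simp
  have T2: "T r (g ^ (2 ^ (r - 3) * (2 * l))) = 0" if "3 \<le> r" "r \<le> m" "odd l" for r l
    unfolding Tv[OF that(1,2)] using oct_2_odd[OF that(3)] by simp
  have T1: "T r (g ^ (2 ^ (r - 3) * l)) = of_int (oct_im l) * Z' r" if "3 \<le> r" "r \<le> m" "odd l" for r l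
    unfolding Tv[OF that(1,2)] Z'_def two[OF that(1), symmetric] \<nu>_def using oct_odd[OF that(3)] by simp
  \<comment> \<open>The cases: \<open>2 ^ j * l\<close> divided by \<open>2 ^ (r - 3)\<close> is a
    multiple of 8, an odd number times 4, an odd number times 2, odd, or not an integer.\<close>
  have Tall: "T r (g ^ (2 ^ j * l)) = (if r \<le> j then \<nu> r * Y r else 0) + (if r = j + 1 then - (\<nu> r * Y r) else 0)
      + (if r = j + 3 then of_int (oct_im l) * Z' r else 0)" if r: "3 \<le> r" "r \<le> m" and l: "odd l" for r j l
  proof -
    consider "r \<le> j" | "r = j + 1" | "r = j + 2" | "r = j + 3" | "r > j + 3" by linarith
    thus ?thesis
    proof cases
      case 1
      then obtain i where i: "j = r - 3 + 3 + i" using r by (metis le_add_diff_inverse2 le_Suc_ex)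
      have e: "2 ^ j * l = 2 ^ (r - 3) * (8 * (2 ^ i * l))" unfolding i power_add by simp
      show ?thesis unfolding e T8[OF r] using 1 by simp
    next
      case 2
      hence "j = r - 3 + 2" using r by simp
      hence e: "2 ^ j * l = 2 ^ (r - 3) * (4 * l)" by (simp add: power_add)
      show ?thesis unfolding e T4[OF r l] using 2 by simp
    next
      case 3
      hence "j = r - 3 + 1" using r by simp
      hence e: "2 ^ j * l = 2 ^ (r - 3) * (2 * l)" by (simp add: power_add)
      show ?thesis unfolding e T2[OF r l] using 3 by simp
    next
      case 4
      hence "j = r - 3" by simp
      thus ?thesis using T1[OF r l] 4 by simp
    next
      case 5
      have "\<not> 2 ^ (r - 3) dvd 2 ^ j * l"
      proof
        assume "2 ^ (r - 3) dvd 2 ^ j * l"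
        moreover have "2 ^ (j + 1) dvd (2::nat) ^ (r - 3)" using 5 by (intro le_imp_power_dvd) simp
        ultimately have "2 ^ (j + 1) dvd 2 ^ j * l" using dvd_trans by blast
        thus False using l by simp
      qed
      thus ?thesis using T_eq_0[OF r] 5 by simp
    qed
  qed
  have gnz: "g ^ i \<noteq> 0" for i using g_nz by simp
  have Vj: "S m (g ^ (2 ^ j * l)) = base j + (\<Sum>r=3..j. \<nu> r * Y r) - (if j \<ge> 2 then \<nu> (j + 1) * Y (j + 1) else 0)
      + (if j + 3 \<le> m then of_int (oct_im l) * Z' (j + 3) else 0)" if l: "odd l" and j: "j < m" for j l
  proof -
    have "(\<Sum>r=3..m. T r (g ^ (2 ^ j * l))) = (\<Sum>r=3..m. (if r \<le> j then \<nu> r * Y r else 0)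
       + (if r = j + 1 then - (\<nu> r * Y r) else 0) + (if r = j + 3 then of_int (oct_im l) * Z' r else 0))"
      using Tall l by (intro sum.cong refl) auto
    also have "\<dots> = (\<Sum>r=3..j. \<nu> r * Y r) + (if j \<ge> 2 then - (\<nu> (j + 1) * Y (j + 1)) else 0)
       + (if j + 3 \<le> m then of_int (oct_im l) * Z' (j + 3) else 0)"
    proof -
      have "j + 1 \<in> {3..m} \<longleftrightarrow> j \<ge> 2" "j + 3 \<in> {3..m} \<longleftrightarrow> j + 3 \<le> m" using j by auto
      thus ?thesis unfolding sum.distrib sum_Icc_filter[OF less_imp_le[OF j]]
        by (simp only: sum.delta finite_atLeastAtMost)
    qed
    finally show ?thesis using S_m_split[OF gnz, of "2 ^ j * l"] T_12[OF l, of j] by simp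
  qed
  have Yeq: "(\<Sum>r=3..j. \<nu> r * Y r) = (\<Sum>r=3..j. Y r)" if "j < m" for j
    using that nu1 by (intro sum.cong refl) auto
  have Vlow: "S m (g ^ (2 ^ j * l)) = C j + of_int (oct_im l) * Z' (j + 3)" if "odd l" "j + 3 \<le> m" for j l
    using Vj[OF that(1), of j] that Yeq[of j] nu1[of "j + 1"] by (simp add: C_def)
  have V2: "S m (g ^ (2 ^ (m - 2) * l)) = C (m - 2)" if "odd l" for l
  proof -
    have "m - 2 + 1 < m" "\<not> m - 2 + 3 \<le> m" "m - 2 < m" using m_ge by auto
    thus ?thesis
      using Vj[OF that, of "m - 2"] Yeq[of "m - 2"] nu1[of "m - 2 + 1"] by (simp add: C_def)
  qed
  have V1: "S m (g ^ (2 ^ (m - 1) * 1)) = D - \<nu> m * Y m"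
  proof -
    have j: "m - 1 + 1 = m" "\<not> m - 1 + 3 \<le> m" "m - 1 < m" "2 \<le> m - 1" using m_ge by auto
    have "base (m - 1) = base 2" using m_ge by (simp add: base_def)
    thus ?thesis
      using Vj[of 1 "m - 1"] Yeq[of "m - 1"] j by (simp add: D_def)
  qed
  have V0: "S m (g ^ 0) = D + \<nu> m * Y m"
  proof -
    have "(\<Sum>r=3..m. T r (g ^ 0)) = (\<Sum>r=3..m. \<nu> r * Y r)"
      using T8[of _ 0] by (intro sum.cong refl) auto
    also have "\<dots> = (\<Sum>r=3..m - 1. \<nu> r * Y r) + \<nu> m * Y m"
      using m_ge sum.nat_ivl_Suc'[of 3 "m - 1" "\<lambda>r. \<nu> r * Y r"] by simp
    finally show ?thesis
      using S_m_split[OF gnz, of 0] T_12_0 Yeq[of "m - 1"] m_ge by (simp add: D_def)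
  qed
  have inner: "(\<Sum>c<2 ^ (m - j - 1). S m (g ^ (2 ^ j * (2 * c + 1))) ^ n)
      = 2 ^ (m - j - 2) * ((C j + Z (j + 3)) ^ n + (C j - Z (j + 3)) ^ n)" if j: "j < m - 2" for j
  proof -
    have j3: "j + 3 \<le> m" using j by simp
    define F where "F c = (C j + of_int (oct_im (2 * c + 1)) * Z' (j + 3)) ^ n" for c :: nat
    \<comment> \<open>\<open>oct_im (2 * c + 1)\<close> runs through 1, 1, -1, -1 with period 4, so
      half of the \<open>2 ^ (m - j - 1)\<close> exponents give each sign.\<close>
    have "m - j - 1 = (m - j - 3) + 2" "m - j - 2 = Suc (m - j - 3)" using j by simp_all
    hence e: "(2::nat) ^ (m - j - 1) = 2 ^ (m - j - 3) * 4" "(2::complex) ^ (m - j - 2) = 2 ^ (m - j - 3) * 2"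
      by (simp_all only: power_add) simp_all
    have "S m (g ^ (2 ^ j * (2 * c + 1))) ^ n = F c" for c
      unfolding F_def by (subst Vlow[OF _ j3]) simp_all
    hence "(\<Sum>c<2 ^ (m - j - 1). S m (g ^ (2 ^ j * (2 * c + 1))) ^ n) = (\<Sum>c<2 ^ (m - j - 3) * 4. F c)"
      by (simp only: e(1))
    also have "\<dots> = of_nat (2 ^ (m - j - 3)) * (\<Sum>c<4. F c)"
    proof (rule sum_lessThan_periodic)
      fix c
      have "oct_im (2 * (c + 4) + 1) = oct_im (2 * c + 1)"
      proof -
        have "(2 * (c + 4) + 1) mod 8 = ((2 * c + 1) + 8) mod 8" by simp
        also have "\<dots> = (2 * c + 1) mod 8" by (rule mod_add_self2)
        finally show ?thesis unfolding oct_im_def by simp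
      qed
      thus "F (c + 4) = F c" by (simp only: F_def)
    qed
    also have "(\<Sum>c<4. F c) = 2 * ((C j + Z' (j + 3)) ^ n + (C j - Z' (j + 3)) ^ n)"
    proof -
      have "(\<Sum>c<4. F c) = F 0 + F 1 + F 2 + F 3" by (simp add: eval_nat_numeral)
      thus ?thesis by (simp add: F_def oct_im_def)
    qed
    also have "(C j + Z' (j + 3)) ^ n + (C j - Z' (j + 3)) ^ n = (C j + Z (j + 3)) ^ n + (C j - Z (j + 3)) ^ n"
    proof (rule power_pm_cong)
      have "\<delta> (j + 3) = 1 \<or> \<delta> (j + 3) = - 1" using db(1)[of "j + 3"] j3 by (simp add: power2_eq_1_iff)
      moreover have "\<beta> (j + 3) = B (j + 3) \<or> \<beta> (j + 3) = - B (j + 3)"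
        using db(3)[of "j + 3"] j3 by (simp add: power2_eq_iff)
      ultimately show "Z' (j + 3) = Z (j + 3) \<or> Z' (j + 3) = - Z (j + 3)"
        unfolding Z'_def Z_def \<nu>_def by (elim disjE) (simp_all add: mult_ac)
    qed
    finally show ?thesis unfolding e(2) by simp
  qed
  have top: "(D + \<nu> m * Y m) ^ n + (D - \<nu> m * Y m) ^ n = (D + \<i> * Y m) ^ n + (D - \<i> * Y m) ^ n"
  proof (rule power_pm_cong)
    have "\<delta> m = 1 \<or> \<delta> m = - 1" using db(1)[of m] m_ge by (simp add: power2_eq_1_iff)
    thus "\<nu> m * Y m = \<i> * Y m \<or> \<nu> m * Y m = - (\<i> * Y m)"
      unfolding \<nu>_def \<iota>_def by auto
  qed
  have "(\<Sum>l<2 ^ m. S m (g ^ l) ^ n) = (\<Sum>l<2 ^ (m - (m - 2)). S m (g ^ (2 ^ (m - 2) * l)) ^ n)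
      + (\<Sum>j<m - 2. \<Sum>c<2 ^ (m - j - 1). S m (g ^ (2 ^ j * (2 * c + 1))) ^ n)"
    by (rule sum_power2_split) simp
  also have "(\<Sum>l<2 ^ (m - (m - 2)). S m (g ^ (2 ^ (m - 2) * l)) ^ n)
      = 2 * C (m - 2) ^ n + ((D + \<nu> m * Y m) ^ n + (D - \<nu> m * Y m) ^ n)"
  proof -
    have "m - (m - 2) = 2" using m_ge by simp
    hence "(\<Sum>l<2 ^ (m - (m - 2)). S m (g ^ (2 ^ (m - 2) * l)) ^ n) = (\<Sum>l<4. S m (g ^ (2 ^ (m - 2) * l)) ^ n)" by simp
    \<comment> \<open>The multipliers 1 and 3 have valuation \<open>m - 2\<close> in total and give
      \<open>C (m - 2)\<close>; 2 and 0 give the two values built on \<open>D\<close>.\<close>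
    also have "\<dots> = S m (g ^ (2 ^ (m - 2) * 0)) ^ n + S m (g ^ (2 ^ (m - 2) * 1)) ^ n
        + S m (g ^ (2 ^ (m - 2) * 2)) ^ n + S m (g ^ (2 ^ (m - 2) * 3)) ^ n"
      by (simp add: eval_nat_numeral)
    also have "2 ^ (m - 2) * 2 = 2 ^ (m - 1) * (1::nat)"
    proof -
      have "m - 1 = Suc (m - 2)" using m_ge by simp
      thus ?thesis by simp
    qed
    finally show ?thesis using V0 V1 V2[of 1] V2[of 3] by simp
  qed
  finally show ?thesis unfolding top using inner by simp
qed

end

section \<open>The three cases of the formula\<close>

theorem theorem2:
  fixes p s q m n :: nat and A B :: "nat \<Rightarrow> int"
    and F :: "'a::{finite,field} itself"
  assumes hp: "prime p" and hp8: "p mod 8 = 3"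
    and hs: "s \<ge> 1" and hq: "q = p ^ s" and hcard: "CARD('a) = q"
    and hm: "m \<ge> 3" and hdvd: "2 ^ m dvd (q - 1)" and hndvd: "\<not> 2 ^ (m + 1) dvd (q - 1)"
    and hn: "n \<ge> 1"
    and hAB: "\<And>r. 2 \<le> r \<Longrightarrow> r \<le> m \<Longrightarrow>
                real p powr (real s / 2 ^ (r - 2)) = real_of_int (A r ^ 2 + 2 * B r ^ 2)"
    and hA4: "\<And>r. 2 \<le> r \<Longrightarrow> r \<le> m \<Longrightarrow> A r mod 4 = 3"
    and hAp: "\<And>r. 2 \<le> r \<Longrightarrow> r \<le> m \<Longrightarrow> \<not> int p dvd A r"
  defines "N \<equiv> card {x \<in> {..<n} \<rightarrow>\<^sub>E (UNIV :: 'a set). (\<Sum>j<n. x j ^ (2 ^ m)) = 0}"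
  shows
   "(m = 3 \<longrightarrow>
      complex_of_nat N = of_nat q ^ (n - 1) + (of_nat q - 1) / (8 * of_nat q) *
        (2 * ((- qpow q (1/2) + 4 * of_int (B 3) * qpow q (1/4) * \<i>) ^ n
              + (- qpow q (1/2) - 4 * of_int (B 3) * qpow q (1/4) * \<i>) ^ n)
         + 2 * 3 ^ n * qpow q (real n / 2)
         + (- qpow q (1/2) + 4 * of_int (A 3) * qpow q (1/4) * \<i>) ^ n
         + (- qpow q (1/2) - 4 * of_int (A 3) * qpow q (1/4) * \<i>) ^ n))
  \<and> (m = 4 \<longrightarrow>
      complex_of_nat N = of_nat q ^ (n - 1) + (of_nat q - 1) / (16 * of_nat q) *
        (4 * ((qpow q (1/2) + 4 * of_int (B 3) * qpow q (1/4)) ^ n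
              + (qpow q (1/2) - 4 * of_int (B 3) * qpow q (1/4)) ^ n)
         + 2 * ((qpow q (1/2) + 8 * of_int (B 4) * qpow q (3/8) * \<i>) ^ n
              + (qpow q (1/2) - 8 * of_int (B 4) * qpow q (3/8) * \<i>) ^ n)
         + 2 * (- 3 * qpow q (1/2) - 4 * of_int (A 3) * qpow q (1/4)) ^ n
         + (- 3 * qpow q (1/2) + 4 * of_int (A 3) * qpow q (1/4) + 8 * of_int (A 4) * qpow q (3/8) * \<i>) ^ n
         + (- 3 * qpow q (1/2) + 4 * of_int (A 3) * qpow q (1/4) - 8 * of_int (A 4) * qpow q (3/8) * \<i>) ^ n))
  \<and> (m \<ge> 5 \<longrightarrow>
      complex_of_nat N = of_nat q ^ (n - 1) + (of_nat q - 1) / (2 ^ m * of_nat q) *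
        (2 ^ (m - 2) * ((qpow q (1/2) + 4 * of_int (B 3) * qpow q (1/4)) ^ n
              + (qpow q (1/2) - 4 * of_int (B 3) * qpow q (1/4)) ^ n)
         + 2 ^ (m - 3) * ((qpow q (1/2) + 8 * of_int (B 4) * qpow q (3/8)) ^ n
              + (qpow q (1/2) - 8 * of_int (B 4) * qpow q (3/8)) ^ n)
         + (\<Sum>t = 2..m - 4. 2 ^ (m - t - 2) *
             ((- 3 * qpow q (1/2)
               + (\<Sum>r = 3..t. 2 ^ (r - 1) * of_int (A r) * qpow q ((2 ^ (r - 2) - 1) / 2 ^ (r - 1)))
               - 2 ^ t * of_int (A (t + 1)) * qpow q ((2 ^ (t - 1) - 1) / 2 ^ t)
               + 2 ^ (t + 2) * of_int (B (t + 3)) * qpow q ((2 ^ (t + 1) - 1) / 2 ^ (t + 2))) ^ n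
            + (- 3 * qpow q (1/2)
               + (\<Sum>r = 3..t. 2 ^ (r - 1) * of_int (A r) * qpow q ((2 ^ (r - 2) - 1) / 2 ^ (r - 1)))
               - 2 ^ t * of_int (A (t + 1)) * qpow q ((2 ^ (t - 1) - 1) / 2 ^ t)
               - 2 ^ (t + 2) * of_int (B (t + 3)) * qpow q ((2 ^ (t + 1) - 1) / 2 ^ (t + 2))) ^ n))
         + 2 * ((- 3 * qpow q (1/2)
               + (\<Sum>r = 3..m - 3. 2 ^ (r - 1) * of_int (A r) * qpow q ((2 ^ (r - 2) - 1) / 2 ^ (r - 1)))
               - 2 ^ (m - 3) * of_int (A (m - 2)) * qpow q ((2 ^ (m - 4) - 1) / 2 ^ (m - 3))
               + 2 ^ (m - 1) * of_int (B m) * qpow q ((2 ^ (m - 2) - 1) / 2 ^ (m - 1)) * \<i>) ^ n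
            + (- 3 * qpow q (1/2)
               + (\<Sum>r = 3..m - 3. 2 ^ (r - 1) * of_int (A r) * qpow q ((2 ^ (r - 2) - 1) / 2 ^ (r - 1)))
               - 2 ^ (m - 3) * of_int (A (m - 2)) * qpow q ((2 ^ (m - 4) - 1) / 2 ^ (m - 3))
               - 2 ^ (m - 1) * of_int (B m) * qpow q ((2 ^ (m - 2) - 1) / 2 ^ (m - 1)) * \<i>) ^ n)
         + 2 * (- 3 * qpow q (1/2)
               + (\<Sum>r = 3..m - 2. 2 ^ (r - 1) * of_int (A r) * qpow q ((2 ^ (r - 2) - 1) / 2 ^ (r - 1)))
               - 2 ^ (m - 2) * of_int (A (m - 1)) * qpow q ((2 ^ (m - 3) - 1) / 2 ^ (m - 2))) ^ n
         + (- 3 * qpow q (1/2)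
               + (\<Sum>r = 3..m - 1. 2 ^ (r - 1) * of_int (A r) * qpow q ((2 ^ (r - 2) - 1) / 2 ^ (r - 1)))
               + 2 ^ (m - 1) * of_int (A m) * qpow q ((2 ^ (m - 2) - 1) / 2 ^ (m - 1)) * \<i>) ^ n
         + (- 3 * qpow q (1/2)
               + (\<Sum>r = 3..m - 1. 2 ^ (r - 1) * of_int (A r) * qpow q ((2 ^ (r - 2) - 1) / 2 ^ (r - 1)))
               - 2 ^ (m - 1) * of_int (A m) * qpow q ((2 ^ (m - 2) - 1) / 2 ^ (m - 1)) * \<i>) ^ n))"
proof -
  have char: "CHAR('a) = p"
  proof -
    have "CHAR('a) dvd p ^ s" using CHAR_dvd_CARD[where ?'a = 'a] hcard hq by simp
    moreover have "prime CHAR('a)"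
      by (rule prime_CHAR_semidom) (simp add: finite_imp_CHAR_pos)
    ultimately show ?thesis using hp prime_dvd_power primes_dvd_imp_eq by blast
  qed
  obtain g :: 'a where g: "g \<noteq> 0" "\<And>x. x \<noteq> 0 \<Longrightarrow> \<exists>i. x = g ^ i"
    using finite_field_generator by blast
  obtain \<psi> :: "'a \<Rightarrow> complex" where psi: "\<And>x y. \<psi> (x + y) = \<psi> x * \<psi> y" "\<psi> 0 = 1"
    "\<And>x. \<psi> (x ^ p) = \<psi> x" "\<exists>x. \<psi> x \<noteq> 1"
    using frobenius_invariant_character[OF hp char] hcard hq by metis
  have "odd p" using hp8 by presburger
  interpret octic_field g \<psi> p q "q - 1" s m
    by unfold_locales (use hcard hp char \<open>odd p\<close> g psi hp8 hm hq hdvd hndvd in auto)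
  \<comment> \<open>\<open>s / 2 ^ (r - 2)\<close> is the integer \<open>2 ^ (m - r) * u\<close>, so
    the real power is an integral power of \<open>P\<close>.\<close>
  have form: "A r ^ 2 + 2 * B r ^ 2 = int (P ^ (2 ^ (m - r)))" if r: "2 \<le> r" "r \<le> m" for r
  proof -
    obtain u where u: "s = 2 ^ (m - 2) * u" "P = p ^ u" using P_decomp by blast
    have "m - 2 = (m - r) + (r - 2)" using r by simp
    hence "s = (2 ^ (m - r) * u) * 2 ^ (r - 2)" unfolding u by (simp add: power_add)
    hence "real s = real (2 ^ (m - r) * u) * 2 ^ (r - 2)" by (simp only: of_nat_mult of_nat_power of_nat_numeral)
    hence "real s / 2 ^ (r - 2) = real (2 ^ (m - r) * u)" by simp
    hence "real p powr (real s / 2 ^ (r - 2)) = real p ^ (2 ^ (m - r) * u)"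
      using prime_gt_0_nat[OF hp] by (simp only: powr_realpow of_nat_0_less_iff)
    also have "\<dots> = real_of_int (int (P ^ (2 ^ (m - r))))"
      unfolding u(2) by (simp add: power_mult[symmetric] mult.commute)
    finally show ?thesis using hAB[OF r] by (simp only: of_int_eq_iff)
  qed
  interpret octic_forms g \<psi> p q "q - 1" s m A B
    by unfold_locales (use form hA4 hAp in auto)
  have N: "of_nat N = of_nat q ^ (n - 1) + (of_nat q - 1) / (2 ^ m * of_nat q) *
     ((\<Sum>j<m - 2. 2 ^ (m - j - 2) * ((C j + Z (j + 3)) ^ n + (C j - Z (j + 3)) ^ n))
    + 2 * C (m - 2) ^ n + ((D + \<i> * Y m) ^ n + (D - \<i> * Y m) ^ n))"
    unfolding N_def card_solutions[OF hn] sum_periods ..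
  have half: "of_real (sqrt (real q)) = qpow q (1/2)"
    by (simp add: qpow_def powr_half_sqrt)
  have Er: "of_real (E r) = qpow q ((2 ^ (r - 2) - 1) / 2 ^ (r - 1))" for r
    by (simp add: qpow_def E_def)
  have Yr: "Y r = 2 ^ (r - 1) * of_int (A r) * qpow q ((2 ^ (r - 2) - 1) / 2 ^ (r - 1))" for r
    by (simp add: Y_def Er)
  have Zr: "Z r = 2 ^ (r - 1) * of_int (B r) * qpow q ((2 ^ (r - 2) - 1) / 2 ^ (r - 1)) * (if r = m then \<i> else 1)" for r
    by (simp add: Z_def Er \<iota>_def)
  show ?thesis
  proof (intro conjI impI)
    assume m: "m = 3"
    have m1: "m - 2 = 1" "m - 1 = 2" using m by auto
    have "sgn_r 3 = - 1" unfolding sgn_r_def using m by simp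
    hence b: "base 0 = - qpow q (1/2)" "base 1 = 3 * qpow q (1/2)" "base 2 = - qpow q (1/2)"
      unfolding base_def half by simp_all
    have c: "C 0 = - qpow q (1/2)" "C 1 = 3 * qpow q (1/2)"
      unfolding C_def b by simp_all
    have d: "D = - qpow q (1/2)" unfolding D_def m1 b by simp
    have z: "Z (0 + 3) = 4 * of_int (B 3) * qpow q (1/4) * \<i>" "Y m = 4 * of_int (A 3) * qpow q (1/4)"
      unfolding Zr Yr using m by simp_all
    have three: "(3 * qpow q (1/2)) ^ n = 3 ^ n * qpow q (real n / 2)"
      using q_gt_1 by (simp add: power_mult_distrib qpow_def powr_power flip: of_real_power)
    have one: "(\<Sum>j<m - 2. f j) = f 0" for f :: "nat \<Rightarrow> complex" unfolding m1 by simp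
    show "complex_of_nat N = of_nat q ^ (n - 1) + (of_nat q - 1) / (8 * of_nat q) *
        (2 * ((- qpow q (1/2) + 4 * of_int (B 3) * qpow q (1/4) * \<i>) ^ n
              + (- qpow q (1/2) - 4 * of_int (B 3) * qpow q (1/4) * \<i>) ^ n)
         + 2 * 3 ^ n * qpow q (real n / 2)
         + (- qpow q (1/2) + 4 * of_int (A 3) * qpow q (1/4) * \<i>) ^ n
         + (- qpow q (1/2) - 4 * of_int (A 3) * qpow q (1/4) * \<i>) ^ n)"
      unfolding N one unfolding z m1 c d three using m by (simp add: mult.commute[of \<i>] add.assoc mult.assoc)
  next
    assume m: "m = 4"
    have m1: "m - 2 = 2" "m - 1 = 3" using m by auto
    have "sgn_r 3 = 1" unfolding sgn_r_def using m by simp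
    hence b: "base j = (if j \<le> 1 then qpow q (1/2) else - 3 * qpow q (1/2))" for j
      unfolding base_def half by simp
    have y3: "Y 3 = 4 * of_int (A 3) * qpow q (1/4)" unfolding Yr by simp
    have c: "C 0 = qpow q (1/2)" "C 1 = qpow q (1/2)"
      "C 2 = - 3 * qpow q (1/2) - 4 * of_int (A 3) * qpow q (1/4)"
      unfolding C_def b y3[symmetric] by (simp_all add: eval_nat_numeral)
    have d: "D = - 3 * qpow q (1/2) + 4 * of_int (A 3) * qpow q (1/4)"
      unfolding D_def m1 b y3[symmetric] by simp
    have z: "Z (0 + 3) = 4 * of_int (B 3) * qpow q (1/4)"
      "Z (1 + 3) = 8 * of_int (B 4) * qpow q (3/8) * \<i>" "Y m = 8 * of_int (A 4) * qpow q (3/8)"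
      unfolding Zr Yr using m by simp_all
    have two: "(\<Sum>j<m - 2. f j) = f 0 + f 1" for f :: "nat \<Rightarrow> complex"
      unfolding m1 by (simp add: eval_nat_numeral)
    show "complex_of_nat N = of_nat q ^ (n - 1) + (of_nat q - 1) / (16 * of_nat q) *
        (4 * ((qpow q (1/2) + 4 * of_int (B 3) * qpow q (1/4)) ^ n
              + (qpow q (1/2) - 4 * of_int (B 3) * qpow q (1/4)) ^ n)
         + 2 * ((qpow q (1/2) + 8 * of_int (B 4) * qpow q (3/8) * \<i>) ^ n
              + (qpow q (1/2) - 8 * of_int (B 4) * qpow q (3/8) * \<i>) ^ n)
         + 2 * (- 3 * qpow q (1/2) - 4 * of_int (A 3) * qpow q (1/4)) ^ n
         + (- 3 * qpow q (1/2) + 4 * of_int (A 3) * qpow q (1/4) + 8 * of_int (A 4) * qpow q (3/8) * \<i>) ^ n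
         + (- 3 * qpow q (1/2) + 4 * of_int (A 3) * qpow q (1/4) - 8 * of_int (A 4) * qpow q (3/8) * \<i>) ^ n)"
      unfolding N two unfolding z m1 c d using m by (simp add: mult.commute[of \<i>] add.assoc mult.assoc)
  next
    assume m: "m \<ge> 5"
    have "sgn_r 3 = 1" unfolding sgn_r_def using m by simp
    hence b: "base j = (if j \<le> 1 then qpow q (1/2) else - 3 * qpow q (1/2))" for j
      unfolding base_def half by simp
    define f where "f j = 2 ^ (m - j - 2) * ((C j + Z (j + 3)) ^ n + (C j - Z (j + 3)) ^ n)" for j
    have Cj: "C j = - 3 * qpow q (1/2)
        + (\<Sum>r = 3..j. 2 ^ (r - 1) * of_int (A r) * qpow q ((2 ^ (r - 2) - 1) / 2 ^ (r - 1)))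
        - 2 ^ j * of_int (A (j + 1)) * qpow q ((2 ^ (j - 1) - 1) / 2 ^ j)" if "j \<ge> 2" for j
    proof -
      have "j + 1 - 2 = j - 1" "j + 1 - 1 = j" using that by auto
      thus ?thesis using that unfolding C_def b Yr by simp
    qed
    have Zj: "Z (j + 3) = 2 ^ (j + 2) * of_int (B (j + 3)) * qpow q ((2 ^ (j + 1) - 1) / 2 ^ (j + 2))" if "j + 3 < m" for j
      using that unfolding Zr by (simp add: numeral_3_eq_3 numeral_2_eq_2)
    \<comment> \<open>\<open>j = 0\<close> and \<open>j = 1\<close> stand apart because
      \<open>C j\<close> is there just \<open>sqrt q\<close>, and \<open>j = m - 3\<close> because
      \<open>Z m\<close> carries the factor \<open>\<i>\<close>. The middle range is empty for
      \<open>m = 5\<close>.\<close>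
    have split: "(\<Sum>j<m - 2. f j) = f 0 + f 1 + (\<Sum>j=2..m - 4. f j) + f (m - 3)"
    proof -
      have "{..<m - 2} = insert 0 (insert 1 (insert (m - 3) {2..m - 4}))" using m by auto
      moreover have "sum f (insert (m - 3) {2..m - 4}) = f (m - 3) + (\<Sum>j=2..m - 4. f j)"
        using m by (intro sum.insert) auto
      ultimately show ?thesis using m by (simp add: add_ac)
    qed
    have f0: "f 0 = 2 ^ (m - 2) * ((qpow q (1/2) + 4 * of_int (B 3) * qpow q (1/4)) ^ n
              + (qpow q (1/2) - 4 * of_int (B 3) * qpow q (1/4)) ^ n)"
      using m by (simp add: f_def C_def b Zr)
    have f1: "f 1 = 2 ^ (m - 3) * ((qpow q (1/2) + 8 * of_int (B 4) * qpow q (3/8)) ^ n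
              + (qpow q (1/2) - 8 * of_int (B 4) * qpow q (3/8)) ^ n)"
    proof -
      have "1 + 3 = (4::nat)" "m - 1 - 2 = m - 3" by simp_all
      thus ?thesis unfolding f_def using m by (simp only: Zr) (simp add: C_def b)
    qed
    have fm: "f (m - 3) = 2 * ((C (m - 3) + 2 ^ (m - 1) * of_int (B m) * qpow q ((2 ^ (m - 2) - 1) / 2 ^ (m - 1)) * \<i>) ^ n
        + (C (m - 3) - 2 ^ (m - 1) * of_int (B m) * qpow q ((2 ^ (m - 2) - 1) / 2 ^ (m - 1)) * \<i>) ^ n)"
    proof -
      have "m - 3 + 3 = m" "m - (m - 3) - 2 = 1" using m by auto
      thus ?thesis unfolding f_def by (simp add: Zr)
    qed
    have Cm3: "C (m - 3) = - 3 * qpow q (1/2)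
        + (\<Sum>r = 3..m - 3. 2 ^ (r - 1) * of_int (A r) * qpow q ((2 ^ (r - 2) - 1) / 2 ^ (r - 1)))
        - 2 ^ (m - 3) * of_int (A (m - 2)) * qpow q ((2 ^ (m - 4) - 1) / 2 ^ (m - 3))"
    proof -
      have "m - 3 + 1 = m - 2" "m - 3 - 1 = m - 4" "m - 3 \<ge> 2" using m by auto
      thus ?thesis using Cj[of "m - 3"] by simp
    qed
    have Cm2: "C (m - 2) = - 3 * qpow q (1/2)
        + (\<Sum>r = 3..m - 2. 2 ^ (r - 1) * of_int (A r) * qpow q ((2 ^ (r - 2) - 1) / 2 ^ (r - 1)))
        - 2 ^ (m - 2) * of_int (A (m - 1)) * qpow q ((2 ^ (m - 3) - 1) / 2 ^ (m - 2))"
    proof -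
      have "m - 2 + 1 = m - 1" "m - 2 - 1 = m - 3" "m - 2 \<ge> 2" using m by auto
      thus ?thesis using Cj[of "m - 2"] by simp
    qed
    have D: "D = - 3 * qpow q (1/2)
        + (\<Sum>r = 3..m - 1. 2 ^ (r - 1) * of_int (A r) * qpow q ((2 ^ (r - 2) - 1) / 2 ^ (r - 1)))"
      unfolding D_def b Yr by simp
    have Ym: "\<i> * Y m = 2 ^ (m - 1) * of_int (A m) * qpow q ((2 ^ (m - 2) - 1) / 2 ^ (m - 1)) * \<i>"
      unfolding Yr by (simp only: mult.commute)
    have mid: "(\<Sum>j=2..m - 4. f j) = (\<Sum>t = 2..m - 4. 2 ^ (m - t - 2) *
             ((- 3 * qpow q (1/2)
               + (\<Sum>r = 3..t. 2 ^ (r - 1) * of_int (A r) * qpow q ((2 ^ (r - 2) - 1) / 2 ^ (r - 1)))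
               - 2 ^ t * of_int (A (t + 1)) * qpow q ((2 ^ (t - 1) - 1) / 2 ^ t)
               + 2 ^ (t + 2) * of_int (B (t + 3)) * qpow q ((2 ^ (t + 1) - 1) / 2 ^ (t + 2))) ^ n
            + (- 3 * qpow q (1/2)
               + (\<Sum>r = 3..t. 2 ^ (r - 1) * of_int (A r) * qpow q ((2 ^ (r - 2) - 1) / 2 ^ (r - 1)))
               - 2 ^ t * of_int (A (t + 1)) * qpow q ((2 ^ (t - 1) - 1) / 2 ^ t)
               - 2 ^ (t + 2) * of_int (B (t + 3)) * qpow q ((2 ^ (t + 1) - 1) / 2 ^ (t + 2))) ^ n))"
    proof (rule sum.cong[OF refl])
      fix t assume "t \<in> {2..m - 4}"
      hence t: "t \<ge> 2" "t + 3 < m" using m by auto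
      show "f t = 2 ^ (m - t - 2) *
             ((- 3 * qpow q (1/2)
               + (\<Sum>r = 3..t. 2 ^ (r - 1) * of_int (A r) * qpow q ((2 ^ (r - 2) - 1) / 2 ^ (r - 1)))
               - 2 ^ t * of_int (A (t + 1)) * qpow q ((2 ^ (t - 1) - 1) / 2 ^ t)
               + 2 ^ (t + 2) * of_int (B (t + 3)) * qpow q ((2 ^ (t + 1) - 1) / 2 ^ (t + 2))) ^ n
            + (- 3 * qpow q (1/2)
               + (\<Sum>r = 3..t. 2 ^ (r - 1) * of_int (A r) * qpow q ((2 ^ (r - 2) - 1) / 2 ^ (r - 1)))
               - 2 ^ t * of_int (A (t + 1)) * qpow q ((2 ^ (t - 1) - 1) / 2 ^ t)
               - 2 ^ (t + 2) * of_int (B (t + 3)) * qpow q ((2 ^ (t + 1) - 1) / 2 ^ (t + 2))) ^ n)"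
        unfolding f_def Cj[OF t(1)] Zj[OF t(2)] ..
    qed
    show "complex_of_nat N = of_nat q ^ (n - 1) + (of_nat q - 1) / (2 ^ m * of_nat q) *
        (2 ^ (m - 2) * ((qpow q (1/2) + 4 * of_int (B 3) * qpow q (1/4)) ^ n
              + (qpow q (1/2) - 4 * of_int (B 3) * qpow q (1/4)) ^ n)
         + 2 ^ (m - 3) * ((qpow q (1/2) + 8 * of_int (B 4) * qpow q (3/8)) ^ n
              + (qpow q (1/2) - 8 * of_int (B 4) * qpow q (3/8)) ^ n)
         + (\<Sum>t = 2..m - 4. 2 ^ (m - t - 2) *
             ((- 3 * qpow q (1/2)
               + (\<Sum>r = 3..t. 2 ^ (r - 1) * of_int (A r) * qpow q ((2 ^ (r - 2) - 1) / 2 ^ (r - 1)))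
               - 2 ^ t * of_int (A (t + 1)) * qpow q ((2 ^ (t - 1) - 1) / 2 ^ t)
               + 2 ^ (t + 2) * of_int (B (t + 3)) * qpow q ((2 ^ (t + 1) - 1) / 2 ^ (t + 2))) ^ n
            + (- 3 * qpow q (1/2)
               + (\<Sum>r = 3..t. 2 ^ (r - 1) * of_int (A r) * qpow q ((2 ^ (r - 2) - 1) / 2 ^ (r - 1)))
               - 2 ^ t * of_int (A (t + 1)) * qpow q ((2 ^ (t - 1) - 1) / 2 ^ t)
               - 2 ^ (t + 2) * of_int (B (t + 3)) * qpow q ((2 ^ (t + 1) - 1) / 2 ^ (t + 2))) ^ n))
         + 2 * ((- 3 * qpow q (1/2)
               + (\<Sum>r = 3..m - 3. 2 ^ (r - 1) * of_int (A r) * qpow q ((2 ^ (r - 2) - 1) / 2 ^ (r - 1)))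
               - 2 ^ (m - 3) * of_int (A (m - 2)) * qpow q ((2 ^ (m - 4) - 1) / 2 ^ (m - 3))
               + 2 ^ (m - 1) * of_int (B m) * qpow q ((2 ^ (m - 2) - 1) / 2 ^ (m - 1)) * \<i>) ^ n
            + (- 3 * qpow q (1/2)
               + (\<Sum>r = 3..m - 3. 2 ^ (r - 1) * of_int (A r) * qpow q ((2 ^ (r - 2) - 1) / 2 ^ (r - 1)))
               - 2 ^ (m - 3) * of_int (A (m - 2)) * qpow q ((2 ^ (m - 4) - 1) / 2 ^ (m - 3))
               - 2 ^ (m - 1) * of_int (B m) * qpow q ((2 ^ (m - 2) - 1) / 2 ^ (m - 1)) * \<i>) ^ n)
         + 2 * (- 3 * qpow q (1/2)
               + (\<Sum>r = 3..m - 2. 2 ^ (r - 1) * of_int (A r) * qpow q ((2 ^ (r - 2) - 1) / 2 ^ (r - 1)))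
               - 2 ^ (m - 2) * of_int (A (m - 1)) * qpow q ((2 ^ (m - 3) - 1) / 2 ^ (m - 2))) ^ n
         + (- 3 * qpow q (1/2)
               + (\<Sum>r = 3..m - 1. 2 ^ (r - 1) * of_int (A r) * qpow q ((2 ^ (r - 2) - 1) / 2 ^ (r - 1)))
               + 2 ^ (m - 1) * of_int (A m) * qpow q ((2 ^ (m - 2) - 1) / 2 ^ (m - 1)) * \<i>) ^ n
         + (- 3 * qpow q (1/2)
               + (\<Sum>r = 3..m - 1. 2 ^ (r - 1) * of_int (A r) * qpow q ((2 ^ (r - 2) - 1) / 2 ^ (r - 1)))
               - 2 ^ (m - 1) * of_int (A m) * qpow q ((2 ^ (m - 2) - 1) / 2 ^ (m - 1)) * \<i>) ^ n)"
      unfolding N f_def[symmetric] split f0 f1 mid fm Cm3 Cm2 D Ym by (simp only: add.assoc)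
  qed
qed

end
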